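(* If $\mathcal{S}$ is a grid with $n$ distinct line segments, then the extremal guard cover problem for $\mathcal{S}$ can be solved in $O(n\log n+m)$ time, where $m$ is the number of intersection points of line segments of $\mathcal{S}$.
   Context: Let $\mathcal{S}=\{S_1,\ldots,S_n\}$ be a finite family of distinct vertical and horizontal closed line segments in the plane, where every two collinear line segments are disjoint. Such a family is called a grid if $n\ge 2$ and the union $S_1\cup\cdots\cup S_n$ is a connected subset of $\mathbb{R}^2$. $V_{\mathcal{S}}$ and $H_{\mathcal{S}}$ denote the sets of vertical and horizontal line segments of $\mathcal{S}$, respectively. A mobile guard is identified with a segment $x\in\mathcal{S}$; it patrols $x$ and all the segments of $\mathcal{S}$ intersected by $x$. A set $\mathcal{C}\subseteq\mathcal{S}$ is a patrolling set of $\mathcal{S}$ if every segment of $\mathcal{S}$ either is an element of $\mathcal{C}$ or is intersected by an element of $\mathcal{C}$. The grid $\mathcal{S}$ is extremal if the minimum cardinality of a patrolling set of $\mathcal{S}$ equals $\min\{|V_{\mathcal{S}}|,|H_{\mathcal{S}}|\}$. The extremal guard cover problem is: given a grid $\mathcal{S}$ (by the end-point coordinates of its segments), decide whether $\mathcal{S}$ is extremal. Running time is measured in the standard model of computational geometry (RAM in which coordinates can be stored and compared in unit time). *)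

theory Defs
  imports "HOL-Analysis.Analysis"
begin

type_synonym point = "real \<times> real"

text \<open>Segments are point sets of positive length, so no segment is both horizontal and vertical.\<close>

definition horizontal :: "point set \<Rightarrow> bool" where
  "horizontal A \<longleftrightarrow> (\<exists>x1 x2 y. x1 < x2 \<and> A = closed_segment (x1, y) (x2, y))"

definition vertical :: "point set \<Rightarrow> bool" where
  "vertical A \<longleftrightarrow> (\<exists>x y1 y2. y1 < y2 \<and> A = closed_segment (x, y1) (x, y2))"

definition grid :: "point set set \<Rightarrow> bool" where
  "grid S \<longleftrightarrow>
     finite S \<and>
     (\<forall>A\<in>S. horizontal A \<or> vertical A) \<and>
     (\<forall>A\<in>S. \<forall>B\<in>S. A \<noteq> B \<and> collinear (A \<union> B) \<longrightarrow> A \<inter> B = {}) \<and>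
     card S \<ge> 2 \<and>
     connected (\<Union>S)"

definition vertical_segments :: "point set set \<Rightarrow> point set set" where
  "vertical_segments S = {A \<in> S. vertical A}"

definition horizontal_segments :: "point set set \<Rightarrow> point set set" where
  "horizontal_segments S = {A \<in> S. horizontal A}"

definition patrolling_set :: "point set set \<Rightarrow> point set set \<Rightarrow> bool" where
  "patrolling_set S C \<longleftrightarrow> C \<subseteq> S \<and> (\<forall>A\<in>S. A \<in> C \<or> (\<exists>B\<in>C. A \<inter> B \<noteq> {}))"

definition extremal :: "point set set \<Rightarrow> bool" where
  "extremal S \<longleftrightarrow>
     Min {card C | C. patrolling_set S C} =
     min (card (vertical_segments S)) (card (horizontal_segments S))"

definition intersection_points :: "point set set \<Rightarrow> point set" where
  "intersection_points S = {p. \<exists>A\<in>S. \<exists>B\<in>S. A \<noteq> B \<and> p \<in> A \<and> p \<in> B}"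

text \<open>
  The model of computation is a unit-cost random access machine with structured control flow.
  Its memory consists of arrays of natural numbers and arrays of real coordinates, named by
  numbers. A program names only finitely many arrays, so interleaving them in one memory for
  numbers and one for coordinates costs a constant factor. Numbers (which also serve as
  indices) can be added, subtracted (truncating at 0) and compared; coordinates can only be
  copied and compared.
\<close>

record state =
  num :: "nat \<Rightarrow> nat \<Rightarrow> nat"
  crd :: "nat \<Rightarrow> nat \<Rightarrow> real"

datatype expr =
    Const nat
  | Cell nat expr
  | Plus expr expr
  | Minus expr expr

datatype test =
    Less expr expr
  | CrdLess nat expr nat expr
  | Neg test
  | Conj test test

datatype com =
    Skip
  | Assign nat expr expr
  | CrdCopy nat expr nat expr
  | Seq com com
  | If test com com
  | While test com

fun expr_val :: "expr \<Rightarrow> state \<Rightarrow> nat" where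
  "expr_val (Const k) s = k"
| "expr_val (Cell a i) s = num s a (expr_val i s)"
| "expr_val (Plus e f) s = expr_val e s + expr_val f s"
| "expr_val (Minus e f) s = expr_val e s - expr_val f s"

fun expr_cost :: "expr \<Rightarrow> nat" where
  "expr_cost (Const k) = 1"
| "expr_cost (Cell a i) = 1 + expr_cost i"
| "expr_cost (Plus e f) = 1 + expr_cost e + expr_cost f"
| "expr_cost (Minus e f) = 1 + expr_cost e + expr_cost f"

fun test_val :: "test \<Rightarrow> state \<Rightarrow> bool" where
  "test_val (Less e f) s \<longleftrightarrow> expr_val e s < expr_val f s"
| "test_val (CrdLess a i b j) s \<longleftrightarrow> crd s a (expr_val i s) < crd s b (expr_val j s)"
| "test_val (Neg p) s \<longleftrightarrow> \<not> test_val p s"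
| "test_val (Conj p q) s \<longleftrightarrow> test_val p s \<and> test_val q s"

fun test_cost :: "test \<Rightarrow> nat" where
  "test_cost (Less e f) = 1 + expr_cost e + expr_cost f"
| "test_cost (CrdLess a i b j) = 1 + expr_cost i + expr_cost j"
| "test_cost (Neg p) = 1 + test_cost p"
| "test_cost (Conj p q) = 1 + test_cost p + test_cost q"

definition set_cell :: "('a \<Rightarrow> 'b \<Rightarrow> 'c) \<Rightarrow> 'a \<Rightarrow> 'b \<Rightarrow> 'c \<Rightarrow> 'a \<Rightarrow> 'b \<Rightarrow> 'c" where
  "set_cell M a i v = M(a := (M a)(i := v))"

text \<open>\<open>exec c s t s'\<close>: started in state \<open>s\<close>, program \<open>c\<close> halts in state \<open>s'\<close> after \<open>t\<close> steps.\<close>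

inductive exec :: "com \<Rightarrow> state \<Rightarrow> nat \<Rightarrow> state \<Rightarrow> bool" where
  Skip: "exec Skip s 1 s"
| Assign: "exec (Assign a i e) s (1 + expr_cost i + expr_cost e)
     (s\<lparr>num := set_cell (num s) a (expr_val i s) (expr_val e s)\<rparr>)"
| CrdCopy: "exec (CrdCopy a i b j) s (1 + expr_cost i + expr_cost j)
     (s\<lparr>crd := set_cell (crd s) a (expr_val i s) (crd s b (expr_val j s))\<rparr>)"
| Seq: "exec c s t s' \<Longrightarrow> exec d s' u s'' \<Longrightarrow> exec (Seq c d) s (t + u) s''"
| IfTrue: "test_val p s \<Longrightarrow> exec c s t s' \<Longrightarrow> exec (If p c d) s (1 + test_cost p + t) s'"
| IfFalse: "\<not> test_val p s \<Longrightarrow> exec d s t s' \<Longrightarrow> exec (If p c d) s (1 + test_cost p + t) s'"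
| WhileFalse: "\<not> test_val p s \<Longrightarrow> exec (While p c) s (1 + test_cost p) s"
| WhileTrue: "test_val p s \<Longrightarrow> exec c s t s' \<Longrightarrow> exec (While p c) s' u s'' \<Longrightarrow>
     exec (While p c) s (1 + test_cost p + t + u) s''"

inductive_cases exec_cases:
  "exec Skip s t s'"
  "exec (Assign a i e) s t s'"
  "exec (CrdCopy a i b j) s t s'"
  "exec (Seq c d) s t s'"
  "exec (If p c d) s t s'"

inductive_cases exec_While_cases: "exec (While p c) s t s'"

lemma exec_deterministic:
  "exec c s t s' \<Longrightarrow> exec c s u s'' \<Longrightarrow> u = t \<and> s'' = s'"
proof (induction arbitrary: u s'' rule: exec.induct)
  case (Seq c s t1 s1 d t2 s2)
  from Seq.prems obtain v1 r1 v2 where "u = v1 + v2" "exec c s v1 r1" "exec d r1 v2 s''"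
    by (rule exec_cases)
  with Seq.IH show ?case by blast
next
  case (IfTrue p s c t1 s1 d)
  from IfTrue.prems IfTrue.hyps(1)
  obtain v where "u = 1 + test_cost p + v" "exec c s v s''"
    by (auto elim: exec_cases)
  with IfTrue.IH show ?case by blast
next
  case (IfFalse p s d t1 s1 c)
  from IfFalse.prems IfFalse.hyps(1)
  obtain v where "u = 1 + test_cost p + v" "exec d s v s''"
    by (auto elim: exec_cases)
  with IfFalse.IH show ?case by blast
next
  case (WhileFalse p s c)
  then show ?case by (auto elim: exec_While_cases)
next
  case (WhileTrue p s c t1 s1 t2 s2)
  from WhileTrue.prems WhileTrue.hyps(1)
  obtain v1 r1 v2 where "u = 1 + test_cost p + v1 + v2" "exec c s v1 r1" "exec (While p c) r1 v2 s''"
    by (auto elim: exec_While_cases)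
  with WhileTrue.IH show ?case by blast
qed (auto elim: exec_cases)

text \<open>
  A grid is presented to the machine as a list of endpoint pairs: the segments come in any
  order, without repetition, and so do the two endpoints of each segment.
\<close>

definition lists_segments :: "(point \<times> point) list \<Rightarrow> point set set \<Rightarrow> bool" where
  "lists_segments xs S \<longleftrightarrow>
     distinct (map (\<lambda>(p, q). closed_segment p q) xs) \<and>
     set (map (\<lambda>(p, q). closed_segment p q) xs) = S"

text \<open>
  Initially cell 0 of number array 0 holds the number of segments, the coordinate arrays 0 to 3
  hold the coordinates of the first and then of the second endpoints, and all other cells hold 0.
\<close>

definition initial_state :: "(point \<times> point) list \<Rightarrow> state" where
  "initial_state xs =
    \<lparr>num = set_cell (\<lambda>a i. 0) 0 0 (length xs),
     crd = (\<lambda>a i.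
       if i < length xs then
         (if a = 0 then fst (fst (xs ! i))
          else if a = 1 then snd (fst (xs ! i))
          else if a = 2 then fst (snd (xs ! i))
          else if a = 3 then snd (snd (xs ! i))
          else 0)
       else 0)\<rparr>"

definition answer :: "state \<Rightarrow> nat" where
  "answer s = num s 0 0"

end

theory Submission
  imports Defs
begin

text \<open>
  Let \<open>A\<close> be the smaller and \<open>B\<close> the larger of the two directions. The crossing graph is bipartite without
  isolated vertices, so \<open>A\<close> is dominating, and it is minimum iff any two vertices of \<open>A\<close> that have a common
  neighbour and no neighbour of degree one have two neighbours of degree two in common. If this holds,
  a segment of \<open>B\<close> crosses at most four segments of \<open>A\<close> without neighbour of degree one: the common
  neighbours of degree two pass beyond the segments in between, which is impossible for five segments
  on a common line. Hence the condition can be checked in time linear in the number of crossings, with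
  a table indexed by pairs of segments in the zero-initialised memory.

  The crossings are reported by a downward sweep. The vertical segments are leaves of a segment tree over the
  sorted abscissas; a horizontal segment is pushed onto the stacks of the \<open>O(log n)\<close> nodes that
  decompose its \<open>x\<close>-interval, and a vertical segment, at its lower end, reads the stacks of its
  ancestors from the top until they leave its \<open>y\<close>-interval. Nothing is ever removed, and a crossing is
  found at exactly one node.
\<close>

section \<open>A weakest-precondition calculus with time\<close>

text \<open>Two twins per pair are the exact threshold. With at most one, both vertices of the pair
  can be exchanged for a single common neighbour, and nothing loses its guard. With two, every
  vertex of \<open>A\<close> missing from a dominating set can be charged to a vertex of
  \<open>B\<close> of its own, even when two missing vertices compete for the same twins.

  Examining all pairs of neighbours would cost the square of a degree, which the time bound does not
  allow. The bound four turns this obstacle into a decision: a fifth unsupported neighbour already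
  refutes the condition, so the lists are cut off there.

  Touching closed segments make ties between coordinates essential. They are broken by index, and
  the lower key of every segment is stored twice, so that strict comparisons of positions in a
  sorted order express the closed conditions on coordinates.

  The machine neither multiplies nor divides. Parents in the tree and row offsets of the pair table
  are therefore tabulated by additions before they are used.\<close>

definition wp :: "com \<Rightarrow> (nat \<Rightarrow> state \<Rightarrow> bool) \<Rightarrow> state \<Rightarrow> bool" where
  "wp c Q s \<longleftrightarrow> (\<exists>t s'. exec c s t s' \<and> Q t s')"

lemma set_cell_apply:
  "set_cell M a i v b j = (if b = a \<and> j = i then v else M b j)"
  by (simp add: set_cell_def)

lemma set_cell_same [simp]: "set_cell M a i v a = (M a)(i := v)"
  and set_cell_other [simp]: "b \<noteq> a \<Longrightarrow> set_cell M a i v b = M b"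
  by (auto simp: set_cell_def)

text \<open>Determinism turns the existential in \<open>wp\<close> into an evaluation, so that
  straight-line code can be run by the simplifier.\<close>

lemma wp_exec: "exec c s t s' \<Longrightarrow> wp c Q s \<longleftrightarrow> Q t s'"
  unfolding wp_def by (blast dest: exec_deterministic)

lemma wp_Skip [simp]: "wp Skip Q s \<longleftrightarrow> Q 1 s"
  by (rule wp_exec[OF exec.Skip])

lemma wp_Assign [simp]:
  "wp (Assign a i e) Q s \<longleftrightarrow> Q (1 + expr_cost i + expr_cost e)
     (s\<lparr>num := set_cell (num s) a (expr_val i s) (expr_val e s)\<rparr>)"
  by (rule wp_exec[OF exec.Assign])

lemma wp_CrdCopy [simp]:
  "wp (CrdCopy a i b j) Q s \<longleftrightarrow> Q (1 + expr_cost i + expr_cost j)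
     (s\<lparr>crd := set_cell (crd s) a (expr_val i s) (crd s b (expr_val j s))\<rparr>)"
  by (rule wp_exec[OF exec.CrdCopy])

lemma wp_Seq [simp]: "wp (Seq c d) Q s \<longleftrightarrow> wp c (\<lambda>t. wp d (\<lambda>u. Q (t + u))) s"
  unfolding wp_def by (fast intro: exec.Seq elim: exec_cases(4))

lemma wp_If [simp]:
  "wp (If p c d) Q s \<longleftrightarrow>
     (if test_val p s then wp c (\<lambda>t. Q (1 + test_cost p + t)) s
      else wp d (\<lambda>t. Q (1 + test_cost p + t)) s)"
proof -
  have "exec (If p c d) s t s' \<longleftrightarrow>
      (\<exists>u. t = 1 + test_cost p + u \<and> exec (if test_val p s then c else d) s u s')" for t s'
    by (cases "test_val p s")
      (auto intro: exec.IfTrue[simplified] exec.IfFalse[simplified] elim: exec_cases(5))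
  then show ?thesis unfolding wp_def by auto
qed

lemma wp_mono: "wp c Q s \<Longrightarrow> (\<And>t s'. Q t s' \<Longrightarrow> R t s') \<Longrightarrow> wp c R s"
  unfolding wp_def by blast

lemma wp_While_unfold:
  "wp (While p c) Q s \<longleftrightarrow>
     (if test_val p s then wp c (\<lambda>t. wp (While p c) (\<lambda>u. Q (1 + test_cost p + t + u))) s
      else Q (1 + test_cost p) s)"
proof (cases "test_val p s")
  case True
  have "exec (While p c) s t s' \<longleftrightarrow>
      (\<exists>u v r. t = 1 + test_cost p + u + v \<and> exec c s u r \<and> exec (While p c) r v s')" for t s'
    by (rule iffI, erule exec_While_cases) (use True in \<open>auto intro: exec.WhileTrue[simplified]\<close>)
  with True show ?thesis unfolding wp_def by (simp, blast)
next
  case False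
  then show ?thesis by (simp add: wp_exec[OF exec.WhileFalse])
qed

section \<open>Arrays that a program cannot change\<close>

primrec num_writes :: "com \<Rightarrow> nat set" where
  "num_writes Skip = {}"
| "num_writes (Assign a i e) = {a}"
| "num_writes (CrdCopy a i b j) = {}"
| "num_writes (Seq c d) = num_writes c \<union> num_writes d"
| "num_writes (If p c d) = num_writes c \<union> num_writes d"
| "num_writes (While p c) = num_writes c"

primrec crd_writes :: "com \<Rightarrow> nat set" where
  "crd_writes Skip = {}"
| "crd_writes (Assign a i e) = {}"
| "crd_writes (CrdCopy a i b j) = {a}"
| "crd_writes (Seq c d) = crd_writes c \<union> crd_writes d"
| "crd_writes (If p c d) = crd_writes c \<union> crd_writes d"
| "crd_writes (While p c) = crd_writes c"

text \<open>Whole arrays are tracked, not cells: the sets of written arrays are computed from the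
  syntax, and everything outside them is preserved without an invariant.\<close>

definition frame :: "com \<Rightarrow> state \<Rightarrow> state \<Rightarrow> bool" where
  "frame c s s' \<longleftrightarrow>
     (\<forall>a i. a \<notin> num_writes c \<longrightarrow> num s' a i = num s a i) \<and>
     (\<forall>a i. a \<notin> crd_writes c \<longrightarrow> crd s' a i = crd s a i)"

lemma frame_num: "frame c s s' \<Longrightarrow> a \<notin> num_writes c \<Longrightarrow> num s' a i = num s a i"
  and frame_crd: "frame c s s' \<Longrightarrow> a \<notin> crd_writes c \<Longrightarrow> crd s' a i = crd s a i"
  by (auto simp: frame_def)

lemma exec_frame: "exec c s t s' \<Longrightarrow> frame c s s'"
  by (induction rule: exec.induct) (auto simp: frame_def)

lemma frame_trans: "frame c s s' \<Longrightarrow> frame c s' s'' \<Longrightarrow> frame c s s''"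
  by (auto simp: frame_def)

lemma frame_refl: "frame c s s"
  by (auto simp: frame_def)

lemma wp_frame: "wp c Q s \<Longrightarrow> (\<And>t s'. Q t s' \<Longrightarrow> frame c s s' \<Longrightarrow> R t s') \<Longrightarrow> wp c R s"
  unfolding wp_def using exec_frame by blast

lemma wp_SeqI:
  assumes "wp c Q s" "\<And>t s'. Q t s' \<Longrightarrow> frame c s s' \<Longrightarrow> wp d (\<lambda>u. R (t + u)) s'"
  shows "wp (Seq c d) R s"
  using wp_frame[OF assms] by simp

text \<open>The first argument of the invariant is the time spent so far.\<close>

lemma wp_While:
  fixes \<mu> :: "state \<Rightarrow> nat"
  assumes init: "I 0 s"
    and step: "\<And>T s'. I T s' \<Longrightarrow> frame c s s' \<Longrightarrow> test_val p s' \<Longrightarrow>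
      wp c (\<lambda>t s''. I (1 + test_cost p + T + t) s'' \<and> \<mu> s'' < \<mu> s') s'"
    and post: "\<And>T s'. I T s' \<Longrightarrow> frame c s s' \<Longrightarrow> \<not> test_val p s' \<Longrightarrow> Q (1 + test_cost p + T) s'"
  shows "wp (While p c) Q s"
proof -
  have "wp (While p c) (\<lambda>t. Q (T + t)) s'" if "I T s'" "frame c s s'" for T s'
    using that
  proof (induction "\<mu> s'" arbitrary: T s' rule: less_induct)
    case less
    show ?case
    proof (cases "test_val p s'")
      case True
      have "wp c (\<lambda>t. wp (While p c) (\<lambda>u. Q (T + (1 + test_cost p + t + u)))) s'"
      proof (rule wp_frame[OF step[OF less.prems True]])
        fix t s'' assume "I (1 + test_cost p + T + t) s'' \<and> \<mu> s'' < \<mu> s'" "frame c s' s''"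
        with less have "wp (While p c) (\<lambda>u. Q (1 + test_cost p + T + t + u)) s''"
          by (blast intro: frame_trans)
        then show "wp (While p c) (\<lambda>u. Q (T + (1 + test_cost p + t + u))) s''"
          by (simp add: algebra_simps)
      qed
      with True show ?thesis by (subst wp_While_unfold) simp
    next
      case False
      with post[OF less.prems] show ?thesis
        by (subst wp_While_unfold) (simp add: algebra_simps)
    qed
  qed
  from this[OF init frame_refl] show ?thesis by simp
qed

abbreviation Var :: "nat \<Rightarrow> expr" where
  "Var x \<equiv> Cell x (Const 0)"

abbreviation Set :: "nat \<Rightarrow> expr \<Rightarrow> com" where
  "Set x e \<equiv> Assign x (Const 0) e"

abbreviation Incr :: "nat \<Rightarrow> com" where
  "Incr x \<equiv> Set x (Plus (Var x) (Const 1))"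

definition For :: "nat \<Rightarrow> expr \<Rightarrow> com \<Rightarrow> com" where
  "For x e c = Seq (Set x (Const 0)) (While (Less (Var x) e) (Seq c (Incr x)))"

lemma num_writes_For [simp]: "num_writes (For x e c) = insert x (num_writes c)"
  and crd_writes_For [simp]: "crd_writes (For x e c) = crd_writes c"
  by (auto simp: For_def)

text \<open>The bound \<open>e\<close> is evaluated anew in every round, hence the hypothesis that
  its value stays \<open>n\<close>. The body must leave the counter as it found it; a uniform time
  bound \<open>C\<close> on the body then gives a bound on the loop.\<close>

lemma wp_For:
  assumes init: "I 0 (s\<lparr>num := set_cell (num s) x 0 0\<rparr>)"
    and bound: "\<And>k s'. I k s' \<Longrightarrow> k \<le> n \<Longrightarrow> frame (For x e c) s s' \<Longrightarrow> expr_val e s' = n"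
    and step: "\<And>k s'. I k s' \<Longrightarrow> k < n \<Longrightarrow> num s' x 0 = k \<Longrightarrow> frame (For x e c) s s' \<Longrightarrow>
      wp c (\<lambda>t s''. t \<le> C \<and> num s'' x 0 = k \<and>
        I (Suc k) (s''\<lparr>num := set_cell (num s'') x 0 (Suc k)\<rparr>)) s'"
    and post: "\<And>t s'. I n s' \<Longrightarrow> frame (For x e c) s s' \<Longrightarrow>
      t \<le> (n + 1) * (C + expr_cost e + 10) \<Longrightarrow> Q t s'"
  shows "wp (For x e c) Q s"
proof -
  define s0 where "s0 = s\<lparr>num := set_cell (num s) x 0 0\<rparr>"
  \<comment> \<open>The 10 is exact: 1 for the loop, 3 for the test beyond
    \<open>expr_cost e\<close>, and 6 for the increment.\<close>
  define B where "B = C + expr_cost e + 10"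
  have f0: "frame (For x e c) s s'" if "frame (Seq c (Incr x)) s0 s'" for s'
    using that by (auto simp: frame_def s0_def set_cell_apply)
  have "wp (While (Less (Var x) e) (Seq c (Incr x))) (\<lambda>u. Q (3 + u)) s0"
  proof (rule wp_While[where \<mu> = "\<lambda>s'. n - num s' x 0" and
        I = "\<lambda>T s'. num s' x 0 \<le> n \<and> I (num s' x 0) s' \<and> T \<le> num s' x 0 * B"])
    show "num s0 x 0 \<le> n \<and> I (num s0 x 0) s0 \<and> 0 \<le> num s0 x 0 * B"
      using init by (simp add: s0_def)
  next
    fix T s'
    assume inv: "num s' x 0 \<le> n \<and> I (num s' x 0) s' \<and> T \<le> num s' x 0 * B"
      and f: "frame (Seq c (Incr x)) s0 s'" and t: "test_val (Less (Var x) e) s'"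
    have lt: "num s' x 0 < n" using t bound[of "num s' x 0" s'] inv f0[OF f] by simp
    show "wp (Seq c (Incr x)) (\<lambda>t s''. (num s'' x 0 \<le> n \<and> I (num s'' x 0) s'' \<and>
        1 + test_cost (Less (Var x) e) + T + t \<le> num s'' x 0 * B) \<and>
        n - num s'' x 0 < n - num s' x 0) s'"
      unfolding wp_Seq
    proof (rule wp_mono[OF step[of "num s' x 0" s']])
      fix t s''
      assume "t \<le> C \<and> num s'' x 0 = num s' x 0 \<and>
        I (Suc (num s' x 0)) (s''\<lparr>num := set_cell (num s'') x 0 (Suc (num s' x 0))\<rparr>)"
      with inv lt show "wp (Incr x) (\<lambda>u s''. (num s'' x 0 \<le> n \<and> I (num s'' x 0) s'' \<and>
        1 + test_cost (Less (Var x) e) + T + (t + u) \<le> num s'' x 0 * B) \<and>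
        n - num s'' x 0 < n - num s' x 0) s''"
        by (auto simp: B_def algebra_simps)
    qed (use inv lt f0[OF f] in auto)
  next
    fix T s'
    assume inv: "num s' x 0 \<le> n \<and> I (num s' x 0) s' \<and> T \<le> num s' x 0 * B"
      and f: "frame (Seq c (Incr x)) s0 s'" and t: "\<not> test_val (Less (Var x) e) s'"
    have eq: "num s' x 0 = n" using t bound[of "num s' x 0" s'] inv f0[OF f] by simp
    show "Q (3 + (1 + test_cost (Less (Var x) e) + T)) s'"
      by (rule post) (use inv eq f0[OF f] in \<open>auto simp: B_def algebra_simps\<close>)
  qed
  then show ?thesis by (simp add: For_def s0_def numeral_3_eq_3)
qed

text \<open>
  Use of the number arrays: 0 number of segments and answer; 2--8, 11, 13--15, 17, 18 scalars;
  10 number of keys; 12 number of leaves of the tree; 16 number of vertical segments;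
  20 sorted order, 21 its scratch copy; 22 positions in the order of the \<open>x\<close>-keys; 23 halves;
  24 vertical segments; 25--28 heads, links, values and allocation mark of the stacks;
  30--32 vertical ends, horizontal ends and number of the crossings; 40, 41 crossings with the
  smaller direction first; 42 degrees; 43 supported vertices; 44, 45 slots for up to four unsupported
  neighbours and their number; 46 failure flag; 47 multiples of the number of segments; 48 number of
  twins of a pair. Coordinate array 4 holds the keys.
\<close>

section \<open>Merge sort\<close>

text \<open>Breaking ties by index makes the order strict and total even when many ends share a
  coordinate. A comparison of positions in the sorted order is then equivalent to a comparison in
  \<open>key_less\<close>.\<close>

definition key_less :: "(nat \<Rightarrow> real) \<Rightarrow> nat \<Rightarrow> nat \<Rightarrow> bool" where
  "key_less K i j \<longleftrightarrow> K i < K j \<or> K i = K j \<and> i < j"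

lemma key_less_trans: "key_less K i j \<Longrightarrow> key_less K j k \<Longrightarrow> key_less K i k"
  by (auto simp: key_less_def)

lemma key_less_total: "i \<noteq> j \<Longrightarrow> key_less K i j \<or> key_less K j i"
  by (auto simp: key_less_def)

lemma key_less_asym: "key_less K i j \<Longrightarrow> \<not> key_less K j i"
  by (auto simp: key_less_def)

definition merge_step :: com where
  "merge_step = Seq
     (If (Conj (Less (Var 6) (Var 4))
            (Neg (Conj (Less (Var 7) (Var 5)) (CrdLess 4 (Cell 20 (Var 7)) 4 (Cell 20 (Var 6))))))
        (Seq (Assign 21 (Var 8) (Cell 20 (Var 6))) (Incr 6))
        (Seq (Assign 21 (Var 8) (Cell 20 (Var 7))) (Incr 7)))
     (Incr 8)"

definition merge_loop :: com where
  "merge_loop = While (Less (Var 8) (Var 5)) merge_step"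

lemma merge_loop_writes [simp]:
  "num_writes merge_loop = {6, 7, 8, 21}" "crd_writes merge_loop = {}"
  by (auto simp: merge_loop_def merge_step_def)

text \<open>The two runs are \<open>c\<close> to \<open>d\<close> and \<open>d\<close> to
  \<open>e\<close>; \<open>i\<close> and \<open>j\<close> are the read positions, \<open>p\<close>
  is the write position, and \<open>Q0\<close> is the scratch array before the merge.\<close>

definition merge_inv ::
  "nat \<Rightarrow> nat \<Rightarrow> nat \<Rightarrow> (nat \<Rightarrow> nat) \<Rightarrow> (nat \<Rightarrow> real) \<Rightarrow> (nat \<Rightarrow> nat) \<Rightarrow> nat \<Rightarrow> nat \<Rightarrow> nat \<Rightarrow> (nat \<Rightarrow> nat) \<Rightarrow> bool" where
  "merge_inv c d e P K Q0 i j p Q \<longleftrightarrow>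
     c \<le> i \<and> i \<le> d \<and> d \<le> j \<and> j \<le> e \<and> p + d = i + j \<and>
     (\<forall>a. c \<le> a \<and> a < p \<longrightarrow> Q a \<in> P ` {c..<e}) \<and>
     (\<forall>a b. c \<le> a \<and> a < b \<and> b < p \<longrightarrow> key_less K (Q a) (Q b)) \<and>
     (\<forall>a x. c \<le> a \<and> a < p \<and> (i \<le> x \<and> x < d \<or> j \<le> x \<and> x < e) \<longrightarrow> key_less K (Q a) (P x)) \<and>
     (\<forall>a. a < c \<or> e \<le> a \<longrightarrow> Q a = Q0 a)"

lemma merge_inv_left:
  assumes "merge_inv c d e P K Q0 i j p Q" "i < d"
    and new: "\<And>x. Suc i \<le> x \<and> x < d \<or> j \<le> x \<and> x < e \<Longrightarrow> key_less K (P i) (P x)"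
  shows "merge_inv c d e P K Q0 (Suc i) j (Suc p) (Q(p := P i))"
proof -
  have *: "a < p" if "a < Suc p" "a \<noteq> p" for a using that by simp
  have i: "P i \<in> P ` {c..<e}" and p: "c \<le> p" "p < e" using assms by (auto simp: merge_inv_def)
  have "c \<le> Suc i \<and> Suc i \<le> d \<and> d \<le> j \<and> j \<le> e \<and> Suc p + d = Suc i + j"
    using assms by (simp add: merge_inv_def)
  moreover have "(Q(p := P i)) a \<in> P ` {c..<e}" if "c \<le> a \<and> a < Suc p" for a
    using that i * assms(1) unfolding merge_inv_def by (cases "a = p") auto
  moreover have "key_less K ((Q(p := P i)) a) ((Q(p := P i)) b)" if "c \<le> a \<and> a < b \<and> b < Suc p" for a b
    using that assms(1,2) unfolding merge_inv_def by (cases "b = p") auto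
  moreover have "key_less K ((Q(p := P i)) a) (P x)"
    if "c \<le> a \<and> a < Suc p \<and> (Suc i \<le> x \<and> x < d \<or> j \<le> x \<and> x < e)" for a x
    using that assms(1,2) new[of x] unfolding merge_inv_def by (cases "a = p") auto
  moreover have "(Q(p := P i)) a = Q0 a" if "a < c \<or> e \<le> a" for a
    using that p assms(1) unfolding merge_inv_def by auto
  ultimately show ?thesis unfolding merge_inv_def by blast
qed

lemma merge_inv_right:
  assumes "merge_inv c d e P K Q0 i j p Q" "j < e"
    and new: "\<And>x. i \<le> x \<and> x < d \<or> Suc j \<le> x \<and> x < e \<Longrightarrow> key_less K (P j) (P x)"
  shows "merge_inv c d e P K Q0 i (Suc j) (Suc p) (Q(p := P j))"
proof -
  have *: "a < p" if "a < Suc p" "a \<noteq> p" for a using that by simp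
  have j: "P j \<in> P ` {c..<e}" and p: "c \<le> p" "p < e" using assms by (auto simp: merge_inv_def)
  have "c \<le> i \<and> i \<le> d \<and> d \<le> Suc j \<and> Suc j \<le> e \<and> Suc p + d = i + Suc j"
    using assms by (simp add: merge_inv_def)
  moreover have "(Q(p := P j)) a \<in> P ` {c..<e}" if "c \<le> a \<and> a < Suc p" for a
    using that j * assms(1) unfolding merge_inv_def by (cases "a = p") auto
  moreover have "key_less K ((Q(p := P j)) a) ((Q(p := P j)) b)" if "c \<le> a \<and> a < b \<and> b < Suc p" for a b
    using that assms(1,2) unfolding merge_inv_def by (cases "b = p") auto
  moreover have "key_less K ((Q(p := P j)) a) (P x)"
    if "c \<le> a \<and> a < Suc p \<and> (i \<le> x \<and> x < d \<or> Suc j \<le> x \<and> x < e)" for a x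
    using that assms(1,2) new[of x] unfolding merge_inv_def by (cases "a = p") auto
  moreover have "(Q(p := P j)) a = Q0 a" if "a < c \<or> e \<le> a" for a
    using that p assms(1) unfolding merge_inv_def by auto
  ultimately show ?thesis unfolding merge_inv_def by blast
qed

lemma wp_merge_loop:
  assumes vars: "num s 8 0 = c" "num s 6 0 = c" "num s 4 0 = d" "num s 7 0 = d" "num s 5 0 = e"
    and le: "c \<le> d" "d \<le> e"
    and P: "num s 20 = P" and K: "crd s 4 = K"
    and left: "\<And>a b. c \<le> a \<Longrightarrow> a < b \<Longrightarrow> b < d \<Longrightarrow> key_less K (P a) (P b)"
    and right: "\<And>a b. d \<le> a \<Longrightarrow> a < b \<Longrightarrow> b < e \<Longrightarrow> key_less K (P a) (P b)"
    and across: "\<And>a b. c \<le> a \<Longrightarrow> a < d \<Longrightarrow> d \<le> b \<Longrightarrow> b < e \<Longrightarrow> P a < P b"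
  shows "wp merge_loop (\<lambda>t s'. t \<le> 60 * (e - c) + 60 \<and>
     (\<forall>a. c \<le> a \<and> a < e \<longrightarrow> num s' 21 a \<in> P ` {c..<e}) \<and>
     (\<forall>a b. c \<le> a \<and> a < b \<and> b < e \<longrightarrow> key_less K (num s' 21 a) (num s' 21 b)) \<and>
     (\<forall>a. a < c \<or> e \<le> a \<longrightarrow> num s' 21 a = num s 21 a)) s"
proof -
  let ?M = "merge_inv c d e P K (num s 21)"
  let ?I = "\<lambda>T s'. T + 60 * c \<le> 60 * num s' 8 0 \<and>
     ?M (num s' 6 0) (num s' 7 0) (num s' 8 0) (num s' 21)"
  show ?thesis
    unfolding merge_loop_def
  proof (rule wp_While[where I = ?I and \<mu> = "\<lambda>s'. e - num s' 8 0"])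
    show "?I 0 s" using vars le by (auto simp: merge_inv_def)
  next
    fix T s'
    assume inv: "?I T s'" and f: "frame merge_step s s'"
      and t: "test_val (Less (Var 8) (Var 5)) s'"
    have fr: "num s' 4 0 = d" "num s' 5 0 = e" "num s' 20 = P" "crd s' 4 = K"
      using vars P K by (auto simp: fun_eq_iff frame_num[OF f] frame_crd[OF f] merge_step_def)
    obtain i j p where ijp: "num s' 6 0 = i" "num s' 7 0 = j" "num s' 8 0 = p" by blast
    have M: "?M i j p (num s' 21)" using inv ijp by simp
    then have b: "c \<le> i" "i \<le> d" "d \<le> j" "j \<le> e" "p + d = i + j" by (auto simp: merge_inv_def)
    have pe: "p < e" using t ijp fr by simp
    show "wp merge_step (\<lambda>t s''. ?I (1 + test_cost (Less (Var 8) (Var 5)) + T + t) s'' \<and>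
        e - num s'' 8 0 < e - num s' 8 0) s'"
    proof (cases "i < d \<and> \<not> (j < e \<and> K (P j) < K (P i))")
      case True
      have new: "key_less K (P i) (P x)" if "Suc i \<le> x \<and> x < d \<or> j \<le> x \<and> x < e" for x
        using that
      proof
        assume "Suc i \<le> x \<and> x < d" then show ?thesis using left b by auto
      next
        assume x: "j \<le> x \<and> x < e"
        then have "key_less K (P i) (P j)"
          using True b across[of i j] by (auto simp: key_less_def)
        then show ?thesis using x right[of j x] b
          by (cases "x = j") (auto intro: key_less_trans)
      qed
      have "?M (Suc i) j (Suc p) ((num s' 21)(p := P i))"
        by (rule merge_inv_left[OF M _ new]) (use True in auto)
      then show ?thesis
        using True inv ijp fr pe by (simp add: merge_step_def diff_less_mono2 fun_upd_def)
    next
      case False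
      then have je: "j < e" using b pe by auto
      have new: "key_less K (P j) (P x)" if "i \<le> x \<and> x < d \<or> Suc j \<le> x \<and> x < e" for x
        using that
      proof
        assume x: "i \<le> x \<and> x < d"
        then have "key_less K (P j) (P i)"
          using False b by (auto simp: key_less_def)
        then show ?thesis using x left[of i x] b
          by (cases "x = i") (auto intro: key_less_trans)
      next
        assume "Suc j \<le> x \<and> x < e" then show ?thesis using right b by auto
      qed
      have "?M i (Suc j) (Suc p) ((num s' 21)(p := P j))"
        by (rule merge_inv_right[OF M je new])
      moreover have "\<not> (i < d \<and> (j < e \<longrightarrow> \<not> K (P j) < K (P i)))" "\<not> (i < d \<and> \<not> (j < e \<and> K (P j) < K (P i)))"
        using False by blast+
      ultimately show ?thesis
        using inv ijp fr pe by (simp add: merge_step_def diff_less_mono2 fun_upd_def del: not_less not_imp de_Morgan_conj)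
    qed
  next
    fix T s'
    assume inv: "?I T s'" and f: "frame merge_step s s'"
      and t: "\<not> test_val (Less (Var 8) (Var 5)) s'"
    have fr: "num s' 5 0 = e"
      using vars by (auto simp: frame_num[OF f] merge_step_def)
    have "num s' 8 0 = e" using t inv fr by (simp add: merge_inv_def)
    with inv have "T \<le> 60 * (e - c)" and M: "?M (num s' 6 0) (num s' 7 0) e (num s' 21)" by auto
    then have "1 + test_cost (Less (Var 8) (Var 5)) + T \<le> 60 * (e - c) + 60" by simp
    with M show "1 + test_cost (Less (Var 8) (Var 5)) + T \<le> 60 * (e - c) + 60 \<and>
     (\<forall>a. c \<le> a \<and> a < e \<longrightarrow> num s' 21 a \<in> P ` {c..<e}) \<and>
     (\<forall>a b. c \<le> a \<and> a < b \<and> b < e \<longrightarrow> key_less K (num s' 21 a) (num s' 21 b)) \<and>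
     (\<forall>a. a < c \<or> e \<le> a \<longrightarrow> num s' 21 a = num s 21 a)"
      unfolding merge_inv_def by blast
  qed
qed

text \<open>Indices never leave their block, so an index of a left block is smaller than one of the right block;
  taking the left element on equal keys therefore yields the lexicographic order of key and index.\<close>

definition blocks :: "(nat \<Rightarrow> real) \<Rightarrow> nat \<Rightarrow> nat \<Rightarrow> nat \<Rightarrow> (nat \<Rightarrow> nat) \<Rightarrow> bool" where
  "blocks K M c w P \<longleftrightarrow> (\<forall>a<c. P a < M \<and> P a div w = a div w) \<and>
     (\<forall>a b. a < b \<and> b < c \<and> a div w = b div w \<longrightarrow> key_less K (P a) (P b))"

definition min_expr :: "expr \<Rightarrow> expr \<Rightarrow> expr" where
  "min_expr a b = Minus a (Minus a b)"

lemma min_expr [simp]: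
  "expr_val (min_expr a b) s = min (expr_val a s) (expr_val b s)"
  "expr_cost (min_expr a b) = 2 + 2 * expr_cost a + expr_cost b"
  by (auto simp: min_expr_def)

definition merge_block :: com where
  "merge_block = Seq (Set 4 (min_expr (Plus (Var 3) (Var 2)) (Var 10)))
     (Seq (Set 5 (min_expr (Plus (Var 4) (Var 2)) (Var 10)))
     (Seq (Set 6 (Var 3)) (Seq (Set 7 (Var 4)) (Seq (Set 8 (Var 3))
     (Seq merge_loop (Set 3 (Var 5)))))))"

definition merge_pass :: com where
  "merge_pass = Seq (Set 3 (Const 0)) (While (Less (Var 3) (Var 10)) merge_block)"

lemma merge_block_writes [simp]:
  "num_writes merge_block = {3, 4, 5, 6, 7, 8, 21}" "crd_writes merge_block = {}"
  by (auto simp: merge_block_def)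

lemma merge_pass_writes [simp]:
  "num_writes merge_pass = {3, 4, 5, 6, 7, 8, 21}" "crd_writes merge_pass = {}"
  by (auto simp: merge_pass_def)

lemma div_eq_of_bounds: "q * w \<le> a \<Longrightarrow> a < Suc q * w \<Longrightarrow> a div w = (q::nat)"
  by (metis div_nat_eqI mult.commute)

lemma wp_merge_block:
  assumes vars: "num s 10 0 = M" "num s 2 0 = w" "num s 3 0 = c" "0 < w" "c < M" "2 * w dvd c"
    and P: "num s 20 = P" and K: "crd s 4 = K"
    and blocks: "blocks K M M w P" and prev: "blocks K M c (2 * w) (num s 21)"
  shows "wp merge_block (\<lambda>t s'. t + 240 * c \<le> 240 * num s' 3 0 \<and> c < num s' 3 0 \<and> num s' 3 0 \<le> M \<and>
     (2 * w dvd num s' 3 0 \<or> num s' 3 0 = M) \<and> blocks K M (num s' 3 0) (2 * w) (num s' 21)) s"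
proof -
  define d where "d = min (c + w) M"
  define e where "e = min (c + 2 * w) M"
  have e': "min (d + w) M = e" using vars by (auto simp: d_def e_def)
  have cde: "c < d" "d \<le> e" "e \<le> M" using vars by (auto simp: d_def e_def)
  obtain q where q: "c = 2 * q * w" using vars(6) by (auto simp: dvd_def mult.assoc mult.left_commute mult.commute)
  have dl: "a div w = 2 * q" if "c \<le> a" "a < d" for a
    by (rule div_eq_of_bounds) (use that q in \<open>auto simp: d_def\<close>)
  have dr: "a div w = 2 * q + 1" if "d \<le> a" "a < e" for a
    by (rule div_eq_of_bounds) (use that q in \<open>auto simp: d_def e_def min_def split: if_splits\<close>)
  have Pdiv: "P a div w = a div w" "P a < M" if "a < M" for a
    using blocks that by (auto simp: blocks_def)
  have Pless: "key_less K (P a) (P b)" if "a < b" "b < M" "a div w = b div w" for a b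
    using blocks that by (auto simp: blocks_def)
  let ?R = "\<lambda>t s'. t \<le> 60 * (e - c) + 60 \<and>
     (\<forall>a. c \<le> a \<and> a < e \<longrightarrow> num s' 21 a \<in> P ` {c..<e}) \<and>
     (\<forall>a b. c \<le> a \<and> a < b \<and> b < e \<longrightarrow> key_less K (num s' 21 a) (num s' 21 b)) \<and>
     (\<forall>a. a < c \<or> e \<le> a \<longrightarrow> num s' 21 a = num s 21 a)"
  let ?s = "s\<lparr>num := set_cell (set_cell (set_cell (set_cell (set_cell (num s) 4 0 d) 5 0 e)
       6 0 c) 7 0 d) 8 0 c\<rparr>"
  have "wp merge_loop (\<lambda>t s'. t \<le> 60 * (e - c) + 60 \<and>
     (\<forall>a. c \<le> a \<and> a < e \<longrightarrow> num s' 21 a \<in> P ` {c..<e}) \<and>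
     (\<forall>a b. c \<le> a \<and> a < b \<and> b < e \<longrightarrow> key_less K (num s' 21 a) (num s' 21 b)) \<and>
     (\<forall>a. a < c \<or> e \<le> a \<longrightarrow> num s' 21 a = num ?s 21 a)) ?s"
  proof (rule wp_merge_loop)
    show "key_less K (P a) (P b)" if "c \<le> a" "a < b" "b < d" for a b
      using that cde by (intro Pless) (auto simp: dl)
    show "key_less K (P a) (P b)" if "d \<le> a" "a < b" "b < e" for a b
      using that cde by (intro Pless) (auto simp: dr)
    show "P a < P b" if "c \<le> a" "a < d" "d \<le> b" "b < e" for a b
    proof (rule ccontr)
      assume "\<not> P a < P b"
      \<comment> \<open>Indices stay inside their blocks, so the block numbers \<open>2 * q\<close>
        and \<open>2 * q + 1\<close> already order the indices.\<close>
      then have "P b div w \<le> P a div w" by (intro div_le_mono) simp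
      then show False using that cde Pdiv[of a] Pdiv[of b] dl[of a] dr[of b] by simp
    qed
  qed (use cde P K in auto)
  then have loop: "wp merge_loop ?R ?s" by simp
  have fin: "t + 120 + 240 * c \<le> 240 * e \<and> blocks K M e (2 * w) (num s' 21)" if R: "?R t s'" for t s'
  proof
    \<comment> \<open>A block contains at least one element, so the 60 for leaving the loop and the
      120 allowed for the assignments around it can be charged to the elements at 180 each.\<close>
    show "t + 120 + 240 * c \<le> 240 * e" using conjunct1[OF R] cde by linarith
    have blk: "b div w = 2 * q \<or> b div w = 2 * q + 1" if "c \<le> b" "b < e" for b
      using dl[of b] dr[of b] that by fastforce
    have blk2: "b div (2 * w) = q" if "c \<le> b" "b < e" for b
      using blk[OF that] by (simp add: mult.commute[of 2] div_mult2_eq) auto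
    have blkP: "P b div (2 * w) = q" if "c \<le> b" "b < e" for b
      using blk[OF that] Pdiv[of b] that cde
      by (simp add: mult.commute[of 2] div_mult2_eq) auto
    have old: "num s' 21 a = num s 21 a" if "a < c" for a using R that by auto
    have small: "a div (2 * w) < q" if "a < c" for a
      using that vars(4) by (auto simp: q less_mult_imp_div_less mult.commute mult.left_commute)
    have "num s' 21 a < M \<and> num s' 21 a div (2 * w) = a div (2 * w)" if "a < e" for a
    proof (cases "a < c")
      case True
      then show ?thesis using prev old by (auto simp: blocks_def)
    next
      case False
      then obtain b where "c \<le> b" "b < e" "num s' 21 a = P b" using R \<open>a < e\<close> by (force simp: not_less)
      then show ?thesis using blkP[of b] blk2[of a] Pdiv[of b] False \<open>a < e\<close> cde by simp
    qed
    moreover have "key_less K (num s' 21 a) (num s' 21 b)"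
      if "a < b" "b < e" "a div (2 * w) = b div (2 * w)" for a b
    proof (cases "b < c")
      case True
      then show ?thesis using prev old that by (auto simp: blocks_def)
    next
      case False
      then have "\<not> a < c" using small[of a] blk2[of b] that by auto
      then show ?thesis using R that by (simp add: not_less)
    qed
    ultimately show "blocks K M e (2 * w) (num s' 21)" unfolding blocks_def by blast
  qed
  \<comment> \<open>The last block may be cut off at \<open>M\<close>; the position reached is then
    \<open>M\<close> rather than a multiple of \<open>2 * w\<close>.\<close>
  have dvd: "2 * w dvd e \<or> e = M" using vars(6) by (auto simp: e_def min_def)
  show ?thesis
    unfolding merge_block_def
    apply (simp add: vars d_def[symmetric] e')
    apply (rule wp_frame[OF loop])
    subgoal premises prems for t s'
    proof -
      have "num s' 5 0 = e" using frame_num[OF prems(2), of 5 0] by simp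
      then show ?thesis using fin[OF prems(1)] dvd cde by simp
    qed
    done
qed

lemma wp_merge_pass:
  assumes vars: "num s 10 0 = M" "num s 2 0 = w" "0 < w"
    and P: "num s 20 = P" and K: "crd s 4 = K"
    and blocks: "blocks K M M w P"
  shows "wp merge_pass (\<lambda>t s'. t \<le> 300 * M + 20 \<and> blocks K M M (2 * w) (num s' 21)) s"
proof -
  let ?s = "s\<lparr>num := set_cell (num s) 3 0 0\<rparr>"
  let ?I = "\<lambda>T s'. T \<le> 300 * num s' 3 0 \<and> num s' 3 0 \<le> M \<and>
     (2 * w dvd num s' 3 0 \<or> num s' 3 0 = M) \<and> blocks K M (num s' 3 0) (2 * w) (num s' 21)"
  have "wp (While (Less (Var 3) (Var 10)) merge_block)
      (\<lambda>t s'. 3 + t \<le> 300 * M + 20 \<and> blocks K M M (2 * w) (num s' 21)) ?s"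
  proof (rule wp_While[where I = ?I and \<mu> = "\<lambda>s'. M - num s' 3 0"])
    show "?I 0 ?s" by (simp add: blocks_def)
  next
    fix T s' assume inv: "?I T s'" and f: "frame merge_block ?s s'"
      and t: "test_val (Less (Var 3) (Var 10)) s'"
    have fr: "num s' 10 0 = M" "num s' 2 0 = w" "num s' 20 = P" "crd s' 4 = K"
      using vars P K by (auto simp: fun_eq_iff frame_num[OF f] frame_crd[OF f])
    show "wp merge_block (\<lambda>t s''. ?I (1 + test_cost (Less (Var 3) (Var 10)) + T + t) s'' \<and>
        M - num s'' 3 0 < M - num s' 3 0) s'"
      by (rule wp_mono[OF wp_merge_block[OF fr(1,2) refl vars(3) _ _ fr(3,4) blocks]])
        (use inv t fr in auto)
  next
    fix T s' assume inv: "?I T s'" and f: "frame merge_block ?s s'"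
      and t: "\<not> test_val (Less (Var 3) (Var 10)) s'"
    have "num s' 10 0 = M" using vars by (auto simp: frame_num[OF f])
    with inv t show "3 + (1 + test_cost (Less (Var 3) (Var 10)) + T) \<le> 300 * M + 20 \<and>
        blocks K M M (2 * w) (num s' 21)"
      by auto
  qed
  then show ?thesis by (simp add: merge_pass_def numeral_3_eq_3)
qed

definition merge_round :: com where
  "merge_round = Seq merge_pass (Seq (For 8 (Var 10) (Assign 20 (Var 8) (Cell 21 (Var 8))))
     (Set 2 (Plus (Var 2) (Var 2))))"

definition merge_sort :: com where
  "merge_sort = Seq (For 8 (Var 10) (Assign 20 (Var 8) (Var 8)))
     (Seq (Set 2 (Const 1)) (While (Less (Var 2) (Var 10)) merge_round))"

lemma merge_round_writes [simp]:
  "num_writes merge_round = {2, 3, 4, 5, 6, 7, 8, 20, 21}" "crd_writes merge_round = {}"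
  by (auto simp: merge_round_def)

lemma merge_sort_writes [simp]:
  "num_writes merge_sort = {2, 3, 4, 5, 6, 7, 8, 20, 21}" "crd_writes merge_sort = {}"
  by (auto simp: merge_sort_def)

lemma wp_merge_merge_round:
  assumes vars: "num s 10 0 = M" "num s 2 0 = w" "0 < w" and K: "crd s 4 = K"
    and blocks: "blocks K M M w (num s 20)"
  shows "wp merge_round (\<lambda>t s'. t \<le> 400 * M + 100 \<and> num s' 2 0 = 2 * w \<and>
     blocks K M M (2 * w) (num s' 20)) s"
  unfolding merge_round_def
proof (rule wp_SeqI[OF wp_merge_pass[OF vars refl K blocks]])
  fix t s'
  assume Q: "t \<le> 300 * M + 20 \<and> blocks K M M (2 * w) (num s' 21)" and f: "frame merge_pass s s'"
  have fr: "num s' 10 0 = M" "num s' 2 0 = w" using vars by (auto simp: frame_num[OF f])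
  let ?c = "For 8 (Var 10) (Assign 20 (Var 8) (Cell 21 (Var 8)))"
  have "wp ?c (\<lambda>u s''. u \<le> 50 * M + 50 \<and> (\<forall>a<M. num s'' 20 a = num s' 21 a)) s'"
  proof (rule wp_For[where n = M and C = 20 and I = "\<lambda>k s''. \<forall>a<k. num s'' 20 a = num s' 21 a"])
    show "expr_val (Var 10) s'' = M" if "frame ?c s' s''" for s''
      using fr by (simp add: frame_num[OF that])
    show "wp (Assign 20 (Var 8) (Cell 21 (Var 8))) (\<lambda>t s''. t \<le> 20 \<and> num s'' 8 0 = k \<and>
         (\<forall>a<Suc k. num (s''\<lparr>num := set_cell (num s'') 8 0 (Suc k)\<rparr>) 20 a = num s' 21 a)) s1"
      if "\<forall>a<k. num s1 20 a = num s' 21 a" "num s1 8 0 = k" "frame ?c s' s1" for k s1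
      using that frame_num[OF that(3), of 21] by (auto simp: less_Suc_eq)
  qed auto
  then show "wp (Seq ?c (Set 2 (Plus (Var 2) (Var 2)))) (\<lambda>u s'. t + u \<le> 400 * M + 100 \<and>
     num s' 2 0 = 2 * w \<and> blocks K M M (2 * w) (num s' 20)) s'"
  proof (rule wp_SeqI)
    fix u s'' assume A: "u \<le> 50 * M + 50 \<and> (\<forall>a<M. num s'' 20 a = num s' 21 a)" and f: "frame ?c s' s''"
    have "blocks K M M (2 * w) (num s'' 20)"
      using A Q by (auto simp: blocks_def)
    moreover have "num s'' 2 0 = w" using fr by (simp add: frame_num[OF f])
    ultimately show "wp (Set 2 (Plus (Var 2) (Var 2))) (\<lambda>v s'. t + (u + v) \<le> 400 * M + 100 \<and>
      num s' 2 0 = 2 * w \<and> blocks K M M (2 * w) (num s' 20)) s''"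
      using A Q by simp
  qed
qed

definition sorts :: "(nat \<Rightarrow> real) \<Rightarrow> nat \<Rightarrow> (nat \<Rightarrow> nat) \<Rightarrow> bool" where
  "sorts K M P \<longleftrightarrow> (\<forall>a<M. P a < M) \<and> (\<forall>a b. a < b \<and> b < M \<longrightarrow> key_less K (P a) (P b))"

text \<open>The exponent \<open>l\<close> is the number of rounds. The final block width is exported
  as well, because it is a power of two between \<open>M\<close> and \<open>2 * M\<close> and serves
  again as the number of leaves of the tree.\<close>

lemma wp_merge_sort:
  assumes M: "num s 10 0 = M" "0 < M" and K: "crd s 4 = K"
  shows "wp merge_sort (\<lambda>t s'. sorts K M (num s' 20) \<and>
     (\<exists>l. num s' 2 0 = 2 ^ l \<and> M \<le> 2 ^ l \<and> 2 ^ l < 2 * M \<and> t \<le> 600 * (M + 1) * (l + 1))) s"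
  unfolding merge_sort_def
proof (rule wp_SeqI)
  let ?c = "For 8 (Var 10) (Assign 20 (Var 8) (Var 8))"
  show "wp ?c (\<lambda>u s'. u \<le> 50 * M + 50 \<and> (\<forall>a<M. num s' 20 a = a)) s"
  proof (rule wp_For[where n = M and C = 20 and I = "\<lambda>k s'. \<forall>a<k. num s' 20 a = a"])
    show "expr_val (Var 10) s'' = M" if "frame ?c s s''" for s''
      using M by (simp add: frame_num[OF that])
  qed (auto simp: less_Suc_eq)
  fix t s' assume A: "t \<le> 50 * M + 50 \<and> (\<forall>a<M. num s' 20 a = a)" and f: "frame ?c s s'"
  have fr: "num s' 10 0 = M" "crd s' 4 = K"
    using M K by (auto simp: fun_eq_iff frame_num[OF f] frame_crd[OF f])
  let ?s = "s'\<lparr>num := set_cell (num s') 2 0 1\<rparr>"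
  let ?w = "While (Less (Var 2) (Var 10)) merge_round"
  let ?I = "\<lambda>T s''. \<exists>l. num s'' 2 0 = 2 ^ l \<and> (2::nat) ^ l < 2 * M \<and> T \<le> (400 * M + 150) * l \<and>
     blocks K M M (2 ^ l) (num s'' 20)"
  have "wp ?w (\<lambda>u s'. sorts K M (num s' 20) \<and>
     (\<exists>l. num s' 2 0 = 2 ^ l \<and> M \<le> 2 ^ l \<and> 2 ^ l < 2 * M \<and> t + (3 + u) \<le> 600 * (M + 1) * (l + 1))) ?s"
  proof (rule wp_While[where I = ?I and \<mu> = "\<lambda>s'. M - num s' 2 0"])
    show "?I 0 ?s" using A M by (intro exI[of _ 0]) (auto simp: blocks_def)
  next
    fix T s'' assume inv: "?I T s''" and f: "frame merge_round ?s s''" and t: "test_val (Less (Var 2) (Var 10)) s''"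
    then obtain l where l: "num s'' 2 0 = 2 ^ l" "T \<le> (400 * M + 150) * l"
      "blocks K M M (2 ^ l) (num s'' 20)" by blast
    have fr': "num s'' 10 0 = M" "crd s'' 4 = K"
      using fr by (auto simp: fun_eq_iff frame_num[OF f] frame_crd[OF f])
    have lt: "2 ^ l < M" using t fr' l by simp
    show "wp merge_round (\<lambda>t s'''. ?I (1 + test_cost (Less (Var 2) (Var 10)) + T + t) s''' \<and>
        M - num s''' 2 0 < M - num s'' 2 0) s''"
    proof (rule wp_mono[OF wp_merge_merge_round[OF fr'(1) l(1) _ fr'(2) l(3)]])
      fix t s3 assume "t \<le> 400 * M + 100 \<and> num s3 2 0 = 2 * 2 ^ l \<and> blocks K M M (2 * 2 ^ l) (num s3 20)"
      with lt l show "?I (1 + test_cost (Less (Var 2) (Var 10)) + T + t) s3 \<and>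
        M - num s3 2 0 < M - num s'' 2 0"
        by (intro conjI exI[of _ "Suc l"]) (auto simp: diff_less_mono2)
    qed simp
  next
    fix T s'' assume inv: "?I T s''" and f: "frame merge_round ?s s''" and t: "\<not> test_val (Less (Var 2) (Var 10)) s''"
    then obtain l where l: "num s'' 2 0 = 2 ^ l" "T \<le> (400 * M + 150) * l" "(2::nat) ^ l < 2 * M"
      "blocks K M M (2 ^ l) (num s'' 20)" by blast
    have fr': "num s'' 10 0 = M" using fr by (auto simp: frame_num[OF f])
    have ge: "M \<le> 2 ^ l" using t fr' l by simp
    have "sorts K M (num s'' 20)" using l(4) ge by (auto simp: sorts_def blocks_def)
    moreover have "t + (3 + (1 + test_cost (Less (Var 2) (Var 10)) + T)) \<le> 600 * (M + 1) * (l + 1)"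
    proof -
      have "t + (3 + (1 + test_cost (Less (Var 2) (Var 10)) + T)) \<le> 50 * M + 60 + (400 * M + 150) * l"
        using A l(2) by simp
      also have "\<dots> \<le> 600 * (M + 1) * (l + 1)" by (simp add: algebra_simps)
      finally show ?thesis .
    qed
    ultimately show "sorts K M (num s'' 20) \<and> (\<exists>l. num s'' 2 0 = 2 ^ l \<and> M \<le> 2 ^ l \<and> 2 ^ l < 2 * M \<and>
        t + (3 + (1 + test_cost (Less (Var 2) (Var 10)) + T)) \<le> 600 * (M + 1) * (l + 1))"
      using l ge by blast
  qed
  then show "wp (Seq (Set 2 (Const 1)) ?w) (\<lambda>u s'. sorts K M (num s' 20) \<and>
     (\<exists>l. num s' 2 0 = 2 ^ l \<and> M \<le> 2 ^ l \<and> 2 ^ l < 2 * M \<and> t + u \<le> 600 * (M + 1) * (l + 1))) s'"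
    by (simp add: numeral_3_eq_3)
qed

section \<open>A segment tree of stacks\<close>

text \<open>The nodes into which the half-open interval of nodes from \<open>l\<close> to \<open>r\<close> of one level of a binary
  heap decomposes; the parent of node \<open>x\<close> is \<open>x div 2\<close>.\<close>

function canon :: "nat \<Rightarrow> nat \<Rightarrow> nat set" where
  "canon l r = (if l < r then (if odd l then {l} else {}) \<union> (if odd r then {r - 1} else {}) \<union>
     canon ((l + 1) div 2) (r div 2) else {})"
  by auto
termination by (relation "Wellfounded.measure snd") auto

declare canon.simps [simp del]

fun ups :: "nat \<Rightarrow> nat list" where
  "ups x = (if x = 0 then [] else x # ups (x div 2))"

declare ups.simps [simp del]

lemma ups_0 [simp]: "ups 0 = []" by (simp add: ups.simps)

lemma ups_pos: "0 < x \<Longrightarrow> ups x = x # ups (x div 2)" by (subst ups.simps) simp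

lemma ups_le: "y \<in> set (ups x) \<Longrightarrow> y \<le> x"
proof (induction x rule: ups.induct)
  case (1 x)
  then show ?case by (cases "x = 0") (auto simp: ups_pos intro: le_trans[OF _ div_le_dividend])
qed

lemma distinct_ups: "distinct (ups x)"
proof (induction x rule: ups.induct)
  case (1 x)
  then show ?case by (cases "x = 0") (auto simp: ups_pos dest: ups_le)
qed

lemma canon_empty: "r \<le> l \<Longrightarrow> canon l r = {}"
  by (simp add: canon.simps)

lemma canon_less: "x \<in> canon l r \<Longrightarrow> x < r"
proof (induction l r rule: canon.induct)
  case (1 l r)
  then show ?case by (subst (asm) canon.simps) (auto split: if_splits)
qed

lemma canon_next_less:
  assumes "2 ^ k \<le> l" "r \<le> 2 ^ Suc k" "x \<in> canon ((l + 1) div 2) (r div 2)"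
  shows "x < 2 ^ k"
proof -
  have "r div 2 \<le> 2 ^ k" using div_le_mono[OF assms(2), of 2] by simp
  with canon_less[OF assms(3)] show ?thesis by simp
qed

text \<open>On one level the decomposition takes only an odd left border and the node before an odd
  right border; for any other \<open>q\<close>, membership in the interval is passed on to the
  parent and the interval of parents. A node that is taken has its parent outside that smaller
  interval, whence uniqueness. The powers of two keep nodes of different levels apart.\<close>

lemma canon_ups:
  assumes "2 ^ k \<le> l" "r \<le> 2 ^ Suc k" "2 ^ k \<le> q" "q < 2 ^ Suc k"
  shows "(\<exists>x\<in>set (ups q). x \<in> canon l r) \<longleftrightarrow> l \<le> q \<and> q < r"
    and "x \<in> set (ups q) \<Longrightarrow> x \<in> canon l r \<Longrightarrow> y \<in> set (ups q) \<Longrightarrow> y \<in> canon l r \<Longrightarrow> x = y"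
proof -
  have "((\<exists>x\<in>set (ups q). x \<in> canon l r) \<longleftrightarrow> l \<le> q \<and> q < r) \<and>
    (\<forall>x y. x \<in> set (ups q) \<and> x \<in> canon l r \<and> y \<in> set (ups q) \<and> y \<in> canon l r \<longrightarrow> x = y)"
    using assms
  proof (induction k arbitrary: l r q)
    case 0
    have q: "q = 1" "ups q = [1]" using 0 by (auto simp: ups_pos)
    show ?case
    proof (cases "l < r")
      case True
      then have "l = 1" "r = 2" using 0 by auto
      then show ?thesis using q by (subst canon.simps) (auto simp: canon_empty)
    next
      case False
      then show ?thesis using q by (auto simp: canon_empty)
    qed
  next
    case (Suc k)
    let ?l = "(l + 1) div 2" and ?r = "r div 2" and ?q = "q div 2"
    have q0: "0 < q" using Suc.prems(3) by (metis gr0I not_le zero_less_numeral zero_less_power)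
    have IH: "((\<exists>x\<in>set (ups ?q). x \<in> canon ?l ?r) \<longleftrightarrow> ?l \<le> ?q \<and> ?q < ?r) \<and>
      (\<forall>x y. x \<in> set (ups ?q) \<and> x \<in> canon ?l ?r \<and> y \<in> set (ups ?q) \<and> y \<in> canon ?l ?r \<longrightarrow> x = y)"
      by (rule Suc.IH) (use Suc.prems in auto)
    show ?case
    proof (cases "l < r")
      case True
      have c: "canon l r = (if odd l then {l} else {}) \<union> (if odd r then {r - 1} else {}) \<union> canon ?l ?r"
        using True by (subst canon.simps) simp
      have nq: "q \<notin> canon ?l ?r" using canon_next_less[of "Suc k" l r q] Suc.prems by auto
      have small: "y < 2 ^ Suc k" if "y \<in> set (ups ?q)" for y
        using ups_le[OF that] Suc.prems(4) by simp
      have lo: "l \<notin> set (ups ?q)" "r - 1 \<notin> set (ups ?q)"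
        using small[of l] small[of "r - 1"] Suc.prems True by auto
      have u: "set (ups q) = insert q (set (ups ?q))" using q0 by (simp add: ups_pos)
      have eq1: "(l \<le> q \<and> q < r) \<longleftrightarrow> (odd l \<and> q = l) \<or> (odd r \<and> q = r - 1) \<or> (?l \<le> ?q \<and> ?q < ?r)"
        using True by (cases "even l"; cases "even r"; cases "even q") (auto elim!: evenE oddE)
      have ex: "(odd l \<and> q = l) \<or> (odd r \<and> q = r - 1) \<Longrightarrow> \<not> (?l \<le> ?q \<and> ?q < ?r)"
        using True by (cases "even l"; cases "even r"; cases "even q") (auto elim!: evenE oddE)
      have mem: "y \<in> canon l r \<longleftrightarrow> y \<in> canon ?l ?r" if "y \<in> set (ups ?q)" for y
        using that lo by (auto simp: c)
      have memq: "q \<in> canon l r \<longleftrightarrow> (odd l \<and> q = l) \<or> (odd r \<and> q = r - 1)"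
        using nq by (auto simp: c)
      have "(\<exists>x\<in>set (ups q). x \<in> canon l r) \<longleftrightarrow> q \<in> canon l r \<or> (\<exists>x\<in>set (ups ?q). x \<in> canon ?l ?r)"
        unfolding u using mem by blast
      then have "(\<exists>x\<in>set (ups q). x \<in> canon l r) \<longleftrightarrow> l \<le> q \<and> q < r"
        unfolding eq1 memq using conjunct1[OF IH] by blast
      moreover have "x = y" if x: "x \<in> set (ups q)" "x \<in> canon l r" and y: "y \<in> set (ups q)" "y \<in> canon l r" for x y
      proof (cases "q \<in> canon l r")
        case True
        then have "\<not> (\<exists>x\<in>set (ups ?q). x \<in> canon l r)"
          using conjunct1[OF IH] ex mem unfolding memq by blast
        then show ?thesis using x y unfolding u by blast
      next
        case False
        then have "x \<in> set (ups ?q)" "y \<in> set (ups ?q)" using x y unfolding u by auto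
        then show ?thesis using x y mem conjunct2[OF IH] by blast
      qed
      ultimately show ?thesis by blast
    next
      case False
      then show ?thesis by (auto simp: canon_empty)
    qed
  qed
  then show "(\<exists>x\<in>set (ups q). x \<in> canon l r) \<longleftrightarrow> l \<le> q \<and> q < r"
    and "x \<in> set (ups q) \<Longrightarrow> x \<in> canon l r \<Longrightarrow> y \<in> set (ups q) \<Longrightarrow> y \<in> canon l r \<Longrightarrow> x = y"
    by blast+
qed

text \<open>\<open>0\<close> is the null pointer. All cells in use lie below the allocation mark \<open>t\<close>, so a push leaves the
  existing lists intact.\<close>

fun chain :: "(nat \<Rightarrow> nat) \<Rightarrow> (nat \<Rightarrow> nat) \<Rightarrow> nat \<Rightarrow> nat \<Rightarrow> nat list \<Rightarrow> bool" where
  "chain val nxt t c [] \<longleftrightarrow> c = 0"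
| "chain val nxt t c (h # hs) \<longleftrightarrow> 0 < c \<and> c \<le> t \<and> val c = h \<and> chain val nxt t (nxt c) hs"

lemma chain_alloc:
  "chain val nxt t c hs \<Longrightarrow> chain (val(Suc t := a)) (nxt(Suc t := b)) (Suc t) c hs"
  by (induction hs arbitrary: c) auto

definition stacks :: "state \<Rightarrow> (nat \<Rightarrow> nat list) \<Rightarrow> bool" where
  "stacks s S \<longleftrightarrow> (\<forall>x. chain (num s 27) (num s 26) (num s 28 0) (num s 25 x) (S x))"

definition push_node :: "nat \<Rightarrow> com" where
  "push_node x = Seq (Incr 28) (Seq (Assign 27 (Var 28) (Var 13))
     (Seq (Assign 26 (Var 28) (Cell 25 (Var x))) (Assign 25 (Var x) (Var 28))))"

lemma push_node_writes [simp]: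
  "num_writes (push_node x) = {25, 26, 27, 28}" "crd_writes (push_node x) = {}"
  by (auto simp: push_node_def)

lemma wp_push_node:
  assumes "stacks s S" "num s 13 0 = h" "num s x 0 = y" "x < 25"
  shows "wp (push_node x) (\<lambda>t s'. t \<le> 40 \<and> stacks s' (S(y := h # S y))) s"
proof -
  have "chain ((num s 27)(Suc (num s 28 0) := a)) ((num s 26)(Suc (num s 28 0) := b))
      (Suc (num s 28 0)) (num s 25 z) (S z)" for a b z
    using assms(1) by (intro chain_alloc) (simp add: stacks_def)
  then show ?thesis using assms by (simp add: push_node_def stacks_def fun_upd_def)
qed

definition push_left :: com where
  "push_left = If (Less (Plus (Cell 23 (Var 14)) (Cell 23 (Var 14))) (Var 14))
     (Seq (push_node 14) (Incr 14)) Skip"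

definition push_right :: com where
  "push_right = If (Less (Plus (Cell 23 (Var 15)) (Cell 23 (Var 15))) (Var 15))
     (Seq (Set 15 (Minus (Var 15) (Const 1))) (push_node 15)) Skip"

definition push_loop :: com where
  "push_loop = While (Less (Var 14) (Var 15)) (Seq push_left (Seq push_right
     (Seq (Set 14 (Cell 23 (Var 14))) (Set 15 (Cell 23 (Var 15))))))"

lemma push_side_writes [simp]:
  "num_writes push_left = {14, 25, 26, 27, 28}" "crd_writes push_left = {}"
  "num_writes push_right = {15, 25, 26, 27, 28}" "crd_writes push_right = {}"
  by (auto simp: push_left_def push_right_def)

lemma push_loop_writes [simp]:
  "num_writes push_loop = {14, 15, 25, 26, 27, 28}" "crd_writes push_loop = {}"
  by (auto simp: push_loop_def)

text \<open>With the table of halves this is the parity test of \<open>push_left\<close> and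
  \<open>push_right\<close>.\<close>

lemma half_odd: "x div 2 + x div 2 < x \<longleftrightarrow> odd (x::nat)"
  by presburger

lemma wp_push_left:
  assumes "stacks s S" "num s 13 0 = h" "num s 14 0 = l" "num s 23 l = l div 2"
  shows "wp push_left (\<lambda>t s'. t \<le> 60 \<and> num s' 14 0 = (if odd l then l + 1 else l) \<and>
     stacks s' (if odd l then S(l := h # S l) else S)) s"
proof (cases "odd l")
  case True
  then show ?thesis using assms half_odd[of l]
    by (auto simp: push_left_def intro!: wp_frame[OF wp_push_node[OF assms(1-3)]])
      (auto simp: stacks_def dest: frame_num[of _ _ _ 14 0])
next
  case False
  then show ?thesis using assms half_odd[of l] by (simp add: push_left_def)
qed

lemma wp_push_right:
  assumes "stacks s S" "num s 13 0 = h" "num s 15 0 = r" "num s 23 r = r div 2"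
  shows "wp push_right (\<lambda>t s'. t \<le> 60 \<and> num s' 15 0 = (if odd r then r - 1 else r) \<and>
     stacks s' (if odd r then S(r - 1 := h # S (r - 1)) else S)) s"
proof (cases "odd r")
  case True
  let ?s = "s\<lparr>num := set_cell (num s) 15 0 (r - 1)\<rparr>"
  have "stacks ?s S" using assms by (simp add: stacks_def)
  then have "wp (push_node 15) (\<lambda>t s'. t \<le> 40 \<and> stacks s' (S(r - 1 := h # S (r - 1)))) ?s"
    by (rule wp_push_node) (use assms in auto)
  then have "wp (push_node 15) (\<lambda>t s'. t \<le> 40 \<and> stacks s' (S(r - 1 := h # S (r - 1))) \<and>
      num s' 15 0 = r - 1) ?s"
    by (rule wp_frame) (auto dest: frame_num[of _ _ _ 15 0])
  then show ?thesis using assms True half_odd[of r]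
    by (simp add: push_right_def) (erule wp_mono, simp)
next
  case False
  then show ?thesis using assms half_odd[of r] by (simp add: push_right_def)
qed

text \<open>Every round moves both borders one level up from level \<open>k\<close>, which gives at
  most \<open>k + 1\<close> rounds. The level is required only of a nonempty interval, because the
  borders may pass each other on the way.\<close>

lemma wp_push_loop:
  assumes "stacks s S" "num s 13 0 = h" "num s 14 0 = l" "num s 15 0 = r"
    and "\<And>x. x \<le> r \<Longrightarrow> num s 23 x = x div 2"
    and "l < r \<Longrightarrow> 2 ^ k \<le> l \<and> r \<le> 2 ^ Suc k"
  shows "wp push_loop (\<lambda>t s'. t \<le> (if l < r then 200 * (k + 1) else 0) + 20 \<and>
     stacks s' (\<lambda>x. if x \<in> canon l r then h # S x else S x)) s"
  using assms
proof (induction l r arbitrary: s S k rule: canon.induct)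
  case (1 l r)
  show ?case
  proof (cases "l < r")
    case False
    then show ?thesis using 1 by (simp add: push_loop_def wp_While_unfold canon_empty)
  next
    case True
    let ?l = "(l + 1) div 2" and ?r = "r div 2"
    let ?S1 = "if odd l then S(l := h # S l) else S"
    let ?S2 = "if odd r then ?S1(r - 1 := h # ?S1 (r - 1)) else ?S1"
    let ?Q = "\<lambda>t s'. t \<le> (if l < r then 200 * (k + 1) else 0) + 20 \<and>
       stacks s' (\<lambda>x. if x \<in> canon l r then h # S x else S x)"
    have lev: "2 ^ k \<le> l" "r \<le> 2 ^ Suc k" using 1 True by auto
    \<comment> \<open>The nodes pushed at this level never recur higher up, so the remaining rounds
      leave their stacks alone.\<close>
    have notin: "l \<notin> canon ?l ?r" "r - 1 \<notin> canon ?l ?r"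
      using canon_next_less[OF lev, of l] canon_next_less[OF lev, of "r - 1"] lev True by auto
    define C where "C = canon ?l ?r"
    have C: "canon l r = (if odd l then {l} else {}) \<union> (if odd r then {r - 1} else {}) \<union> C"
      using True by (subst canon.simps) (simp add: C_def)
    have ne: "odd l \<Longrightarrow> odd r \<Longrightarrow> l \<noteq> r - 1" using True by presburger
    have S2: "(\<lambda>x. if x \<in> C then h # ?S2 x else ?S2 x) =
        (\<lambda>x. if x \<in> canon l r then h # S x else S x)"
    proof
      fix x
      show "(if x \<in> C then h # ?S2 x else ?S2 x) = (if x \<in> canon l r then h # S x else S x)"
        using notin ne unfolding C_def[symmetric] C by (cases "x = l"; cases "x = r - 1") auto
    qed
    have rest: "wp push_loop (\<lambda>t s'. t \<le> (if ?l < ?r then 200 * k else 0) + 20 \<and>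
       stacks s' (\<lambda>x. if x \<in> canon l r then h # S x else S x)) s'"
      if "stacks s' ?S2" "num s' 13 0 = h" "num s' 14 0 = ?l" "num s' 15 0 = ?r"
        "num s' 23 = num s 23" for s'
    proof -
      \<comment> \<open>At level 0 only the root exists, and the interval of its parents is empty; a
        nonempty interval thus has a level above it.\<close>
      have lev': "?l < ?r \<Longrightarrow> k \<noteq> 0 \<and> 2 ^ (k - 1) \<le> ?l \<and> ?r \<le> 2 ^ Suc (k - 1)"
      proof
        assume lt: "?l < ?r"
        show k: "k \<noteq> 0"
        proof
          assume "k = 0"
          then have "1 \<le> ?l" "?r \<le> 1" using lev by auto
          then show False using lt by linarith
        qed
        then obtain j where j: "k = Suc j" using not0_implies_Suc by blast
        have "2 ^ j \<le> ?l" "?r \<le> 2 ^ Suc j" using lev unfolding j by auto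
        then show "2 ^ (k - 1) \<le> ?l \<and> ?r \<le> 2 ^ Suc (k - 1)" by (simp add: j)
      qed
      have "wp push_loop (\<lambda>t s'. t \<le> (if ?l < ?r then 200 * (k - 1 + 1) else 0) + 20 \<and>
        stacks s' (\<lambda>x. if x \<in> C then h # ?S2 x else ?S2 x)) s'"
        unfolding C_def
      proof (rule "1.IH"[OF True that(1-4)])
        show "num s' 23 x = x div 2" if "x \<le> ?r" for x
          using 1(6)[of x] \<open>num s' 23 = num s 23\<close> order.trans[OF that div_le_dividend] by simp
        show "2 ^ (k - 1) \<le> ?l \<and> ?r \<le> 2 ^ Suc (k - 1)" if "?l < ?r"
          using lev'[OF that] by blast
      qed
      moreover have eq: "(if ?l < ?r then 200 * (k - 1 + 1) else 0) = (if ?l < ?r then 200 * k else 0)"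
      proof (cases "?l < ?r")
        case True
        then have "k - 1 + 1 = k" using lev'[OF True] by linarith
        then show ?thesis by (simp only:)
      qed (simp only: if_False)
      ultimately show ?thesis unfolding S2 by (simp only:)
    qed
    show ?thesis
      unfolding push_loop_def
      apply (subst wp_While_unfold)
      apply (fold push_loop_def)
      apply (simp only: test_val.simps expr_val.simps "1.prems" True if_True wp_Seq)
      apply (rule wp_frame[OF wp_push_left[OF "1.prems"(1-3)]])
      subgoal using 1(6) True by simp
      subgoal premises p1 for t s1
      proof -
        have fr1: "num s1 13 0 = h" "num s1 15 0 = r" "num s1 23 = num s 23"
          using 1 by (auto simp: fun_eq_iff frame_num[OF p1(2)])
        show ?thesis
          apply (simp only: wp_Seq)
          apply (rule wp_frame[OF wp_push_right[where S = ?S1, OF _ fr1(1,2)]])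
          subgoal using p1(1) by blast
          subgoal using 1(6) fr1(3) by simp
          subgoal premises p2 for u s2
          proof -
            have fr2: "num s2 13 0 = h" "num s2 14 0 = (if odd l then l + 1 else l)" "num s2 23 = num s 23"
              using fr1 p1(1) by (auto simp: fun_eq_iff frame_num[OF p2(2)])
            have r2: "num s2 15 0 = (if odd r then r - 1 else r)" and t: "t \<le> 60" "u \<le> 60"
              using p1(1) p2(1) by blast+
            have hl: "num s2 23 (num s2 14 0) = ?l"
              using 1(6) True fr2(2,3) by (auto elim!: oddE evenE)
            have hr: "num s2 23 (num s2 15 0) = ?r"
              using 1(6)[of r] 1(6)[of "r - 1"] fr2(3) r2 by (auto elim!: oddE)
            let ?s = "s2\<lparr>num := set_cell (set_cell (num s2) 14 0 ?l) 15 0 ?r\<rparr>"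
            have R: "wp push_loop (\<lambda>t s'. t \<le> (if ?l < ?r then 200 * k else 0) + 20 \<and>
               stacks s' (\<lambda>x. if x \<in> canon l r then h # S x else S x)) ?s"
              by (rule rest) (use p2(1) fr2 in \<open>auto simp: stacks_def\<close>)
            have st: "s2\<lparr>num := set_cell (num s2) 14 0 (num s2 23 (num s2 14 0))\<rparr>
                \<lparr>num := set_cell (num (s2\<lparr>num := set_cell (num s2) 14 0 (num s2 23 (num s2 14 0))\<rparr>)) 15 0
                 (num (s2\<lparr>num := set_cell (num s2) 14 0 (num s2 23 (num s2 14 0))\<rparr>) 23
                 (num (s2\<lparr>num := set_cell (num s2) 14 0 (num s2 23 (num s2 14 0))\<rparr>) 15 0))\<rparr> = ?s"
              unfolding hl using hr by simp
            show ?thesis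
              unfolding wp_Seq wp_Assign expr_val.simps st
              by (rule wp_mono[OF R]) (use t in \<open>auto split: if_splits\<close>)
          qed
          done
      qed
      done
  qed
qed

section \<open>Output-sensitive reading of the stacks\<close>

definition edges :: "state \<Rightarrow> (nat \<times> nat) list \<Rightarrow> bool" where
  "edges s es \<longleftrightarrow> num s 32 0 = length es \<and>
     (\<forall>k<length es. num s 30 k = fst (es ! k) \<and> num s 31 k = snd (es ! k))"

definition chain_step :: com where
  "chain_step = Seq (Assign 30 (Var 32) (Var 13)) (Seq (Assign 31 (Var 32) (Cell 27 (Var 15)))
     (Seq (Incr 32) (Set 15 (Cell 26 (Var 15)))))"

definition chain_loop :: com where
  "chain_loop = While (Conj (Less (Const 0) (Var 15))
       (Neg (CrdLess 4 (Plus (Plus (Var 0) (Var 0)) (Var 13)) 4 (Cell 27 (Var 15))))) chain_step"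

lemma chain_loop_writes [simp]:
  "num_writes chain_loop = {15, 30, 31, 32}" "crd_writes chain_loop = {}"
  by (auto simp: chain_loop_def chain_step_def)

text \<open>Every round appends one crossing and only the final failing test does not, so the time
  is stated as growth of the output counter. Summed over the sweep this charges 60 steps to each
  crossing, and a constant to each stack that is opened.\<close>

lemma wp_chain_loop:
  assumes "chain (num s 27) (num s 26) m (num s 15 0) hs" "edges s es"
    and "num s 13 0 = v" "num s 0 0 = n" "crd s 4 = K"
  shows "wp chain_loop (\<lambda>t s'. edges s' (es @ map (Pair v) (takeWhile (\<lambda>h. K h \<le> K (n + n + v)) hs)) \<and>
     t + 60 * length es \<le> 60 * num s' 32 0 + 30) s"
  using assms
proof (induction hs arbitrary: s es)
  case Nil
  then show ?case by (simp add: chain_loop_def wp_While_unfold edges_def)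
next
  case (Cons h hs)
  let ?c = "num s 15 0"
  show ?case
  proof (cases "K h \<le> K (n + n + v)")
    case False
    then show ?thesis using Cons.prems
      by (simp add: chain_loop_def wp_While_unfold edges_def)
  next
    case True
    let ?s = "s\<lparr>num := set_cell (set_cell (set_cell (set_cell (num s) 30 (length es) v) 31 (length es) h)
        32 0 (Suc (length es))) 15 0 (num s 26 ?c)\<rparr>"
    let ?es = "es @ [(v, h)]"
    have "wp chain_loop (\<lambda>t s'. edges s' (?es @ map (Pair v) (takeWhile (\<lambda>h. K h \<le> K (n + n + v)) hs)) \<and>
     t + 60 * length ?es \<le> 60 * num s' 32 0 + 30) ?s"
      by (rule Cons.IH) (use Cons.prems in \<open>auto simp: edges_def nth_append less_Suc_eq\<close>)
    then show ?thesis
      using Cons.prems True unfolding chain_loop_def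
      by (subst wp_While_unfold) (simp add: chain_step_def edges_def, erule wp_mono, simp)
  qed
qed

definition query_loop :: com where
  "query_loop = While (Less (Const 0) (Var 14))
     (Seq (Set 15 (Cell 25 (Var 14))) (Seq chain_loop (Set 14 (Cell 23 (Var 14)))))"

lemma query_loop_writes [simp]:
  "num_writes query_loop = {14, 15, 30, 31, 32}" "crd_writes query_loop = {}"
  by (auto simp: query_loop_def)

definition reported :: "(nat \<Rightarrow> nat list) \<Rightarrow> (nat \<Rightarrow> real) \<Rightarrow> real \<Rightarrow> nat \<Rightarrow> nat list" where
  "reported S K y q = concat (map (\<lambda>x. takeWhile (\<lambda>h. K h \<le> y) (S x)) (ups q))"

lemma wp_query_loop:
  assumes "stacks s S" "edges s es" "num s 13 0 = v" "num s 0 0 = n" "crd s 4 = K"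
    and "num s 14 0 = q" "q < 2 ^ k" "\<And>x. x \<le> q \<Longrightarrow> num s 23 x = x div 2"
  shows "wp query_loop (\<lambda>t s'. edges s' (es @ map (Pair v) (reported S K (K (n + n + v)) q)) \<and>
     t + 60 * length es \<le> 60 * num s' 32 0 + 60 * k + 10) s"
  using assms
proof (induction q arbitrary: s es k rule: ups.induct)
  case (1 q)
  show ?case
  proof (cases "q = 0")
    case True
    with 1 show ?thesis by (simp add: query_loop_def wp_While_unfold reported_def edges_def)
  next
    case False
    let ?es = "es @ map (Pair v) (takeWhile (\<lambda>h. K h \<le> K (n + n + v)) (S q))"
    have q0: "0 < q" using False by simp
    obtain j where j: "k = Suc j" using False "1.prems"(7) by (cases k) auto
    show ?thesis
      unfolding query_loop_def
      apply (subst wp_While_unfold)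
      apply (fold query_loop_def)
      apply (simp only: test_val.simps expr_val.simps "1.prems" wp_Seq wp_Assign)
      apply (simp only: q0 if_True)
      apply (rule wp_frame[OF wp_chain_loop[where hs = "S q" and m = "num s 28 0" and es = es and v = v and n = n and K = K]])
      subgoal using "1.prems"(1) by (simp add: stacks_def)
      subgoal using "1.prems"(2) by (simp add: edges_def)
      subgoal using "1.prems"(3) by simp
      subgoal using "1.prems"(4) by simp
      subgoal using "1.prems"(5) by simp
      subgoal premises p for t s'
      proof -
        note f = p(2)
        have E: "edges s' ?es" "t + 60 * length es \<le> 60 * num s' 32 0 + 30"
          using p(1) by auto
        let ?t = "s'\<lparr>num := set_cell (num s') 14 0 (q div 2)\<rparr>"
        have fr: "num s' 14 0 = q" "num s' 23 q = q div 2"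
          using "1.prems" by (auto simp: frame_num[OF f])
        have "wp query_loop (\<lambda>t s'. edges s' (?es @ map (Pair v) (reported S K (K (n + n + v)) (q div 2))) \<and>
           t + 60 * length ?es \<le> 60 * num s' 32 0 + 60 * j + 10) ?t"
        proof (rule "1.IH"[OF False])
          have "num s' 25 = num s 25" "num s' 26 = num s 26" "num s' 27 = num s 27" "num s' 28 = num s 28"
            by (auto simp: fun_eq_iff frame_num[OF f])
          then show "stacks ?t S" using "1.prems"(1) by (simp add: stacks_def)
          show "edges ?t ?es" using E by (simp add: edges_def)
          show "crd ?t 4 = K" using "1.prems"(5) by (auto simp: fun_eq_iff frame_crd[OF f])
          show "q div 2 < 2 ^ j" using "1.prems"(7) j by auto
          show "num ?t 23 x = x div 2" if "x \<le> q div 2" for x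
            using "1.prems"(8)[of x] order.trans[OF that div_le_dividend] by (simp add: frame_num[OF f])
        qed (use "1.prems" in \<open>auto simp: frame_num[OF f]\<close>)
        moreover have "num s' 32 0 = length ?es" using E by (simp add: edges_def)
        ultimately show ?thesis
          using fr E False j by (simp, elim wp_mono) (simp add: reported_def ups_pos)
      qed
      done
  qed
qed

section \<open>Reporting all crossings\<close>

text \<open>The copy of the lower key at \<open>n + i\<close> serves the ties. In the order of
  abscissas a horizontal segment \<open>h\<close> occupies the positions from index \<open>h\<close>
  up to index \<open>n + n + h\<close>, and a vertical segment \<open>v\<close> is represented by
  index \<open>n + v\<close>: at equal abscissas the index order places \<open>v\<close> inside both
  closed ends.\<close>

definition keys :: "nat \<Rightarrow> nat \<Rightarrow> com" where
  "keys a b = For 11 (Var 0) (If (CrdLess b (Var 11) a (Var 11))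
     (Seq (CrdCopy 4 (Var 11) b (Var 11)) (Seq (CrdCopy 4 (Plus (Var 0) (Var 11)) b (Var 11))
       (CrdCopy 4 (Plus (Plus (Var 0) (Var 0)) (Var 11)) a (Var 11))))
     (Seq (CrdCopy 4 (Var 11) a (Var 11)) (Seq (CrdCopy 4 (Plus (Var 0) (Var 11)) a (Var 11))
       (CrdCopy 4 (Plus (Plus (Var 0) (Var 0)) (Var 11)) b (Var 11)))))"

lemma keys_writes [simp]: "num_writes (keys a b) = {11}" "crd_writes (keys a b) = {4}"
  by (auto simp: keys_def)

lemma wp_keys:
  assumes "num s 0 0 = n" "a < 4" "b < 4"
  shows "wp (keys a b) (\<lambda>t s'. t \<le> 100 * (n + 1) \<and>
     (\<forall>i<n. crd s' 4 i = min (crd s a i) (crd s b i) \<and> crd s' 4 (n + i) = min (crd s a i) (crd s b i) \<and>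
       crd s' 4 (n + n + i) = max (crd s a i) (crd s b i))) s"
  unfolding keys_def
proof (rule wp_For[where n = n and C = 60 and I = "\<lambda>k s'. \<forall>i<k. crd s' 4 i = min (crd s a i) (crd s b i) \<and>
     crd s' 4 (n + i) = min (crd s a i) (crd s b i) \<and>
     crd s' 4 (n + n + i) = max (crd s a i) (crd s b i)"], goal_cases)
  case 1
  then show ?case by simp
next
  case (2 k s')
  then show ?case using assms by (simp add: frame_num[OF 2(3)])
next
  case (3 k s')
  have "num s' 0 0 = n" "crd s' a = crd s a" "crd s' b = crd s b"
    using assms by (auto simp: fun_eq_iff frame_num[OF 3(4)] frame_crd[OF 3(4)])
  then show ?case using 3 assms by (auto simp: less_Suc_eq)
next
  case (4 t s')
  then show ?case by simp
qed

definition mark_vertical :: com where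
  "mark_vertical = For 11 (Var 0)
     (If (Conj (Neg (CrdLess 0 (Var 11) 2 (Var 11))) (Neg (CrdLess 2 (Var 11) 0 (Var 11))))
       (Seq (Assign 24 (Var 11) (Const 1)) (Incr 16)) Skip)"

lemma mark_vertical_writes [simp]:
  "num_writes mark_vertical = {11, 16, 24}" "crd_writes mark_vertical = {}"
  by (auto simp: mark_vertical_def)

lemma wp_mark_vertical:
  assumes "num s 0 0 = n" "num s 16 0 = 0" "num s 24 = (\<lambda>_. 0)"
  shows "wp mark_vertical (\<lambda>t s'. t \<le> 100 * (n + 1) \<and>
     (\<forall>i<n. 0 < num s' 24 i \<longleftrightarrow> crd s 0 i = crd s 2 i) \<and>
     num s' 16 0 = card {i. i < n \<and> crd s 0 i = crd s 2 i}) s"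
  unfolding mark_vertical_def
proof (rule wp_For[where n = n and C = 60 and I = "\<lambda>k s'. (\<forall>i<n. 0 < num s' 24 i \<longleftrightarrow> i < k \<and> crd s 0 i = crd s 2 i) \<and>
     num s' 16 0 = card {i. i < k \<and> crd s 0 i = crd s 2 i}"], goal_cases)
  case 1
  then show ?case using assms by simp
next
  case (2 k s')
  then show ?case using assms by (simp add: frame_num[OF 2(3)])
next
  case (3 k s')
  have fr: "num s' 0 0 = n" "crd s' 0 = crd s 0" "crd s' 2 = crd s 2"
    using assms by (auto simp: fun_eq_iff frame_num[OF 3(4)] frame_crd[OF 3(4)])
  show ?case
  proof (cases "crd s 0 k = crd s 2 k")
    case True
    have "{i. i < Suc k \<and> crd s 0 i = crd s 2 i} = insert k {i. i < k \<and> crd s 0 i = crd s 2 i}"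
      using True by (auto simp: less_Suc_eq)
    then show ?thesis using 3 fr True by (auto simp: less_Suc_eq)
  next
    case False
    have "{i. i < Suc k \<and> crd s 0 i = crd s 2 i} = {i. i < k \<and> crd s 0 i = crd s 2 i}"
      using False by (auto simp: less_Suc_eq)
    then show ?thesis using 3 fr False by (auto simp: less_Suc_eq)
  qed
next
  case (4 t s')
  then show ?case by simp
qed

definition half_table :: com where
  "half_table = For 11 (Var 12) (Seq (Assign 23 (Plus (Var 11) (Var 11)) (Var 11))
     (Assign 23 (Plus (Plus (Var 11) (Var 11)) (Const 1)) (Var 11)))"

lemma half_table_writes [simp]: "num_writes half_table = {11, 23}" "crd_writes half_table = {}"
  by (auto simp: half_table_def)

lemma wp_half_table:
  assumes "num s 12 0 = N"
  shows "wp half_table (\<lambda>t s'. t \<le> 100 * (N + 1) \<and> (\<forall>x<2 * N. num s' 23 x = x div 2)) s"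
  unfolding half_table_def
proof (rule wp_For[where n = N and C = 60 and I = "\<lambda>k s'. \<forall>x<2 * k. num s' 23 x = x div 2"], goal_cases)
  case 1
  then show ?case by simp
next
  case (2 k s')
  then show ?case using assms by (simp add: frame_num[OF 2(3)])
next
  case (3 k s')
  have "x div 2 = k" if "\<not> x < 2 * k" "x < 2 + 2 * k" for x using that by auto
  then show ?case using 3 by (auto simp: less_Suc_eq)
next
  case (4 t s')
  then show ?case by simp
qed

definition inverse_table :: com where
  "inverse_table = For 11 (Var 10) (Assign 22 (Cell 20 (Var 11)) (Var 11))"

lemma inverse_table_writes [simp]: "num_writes inverse_table = {11, 22}" "crd_writes inverse_table = {}"
  by (auto simp: inverse_table_def)

lemma wp_inverse_table:
  assumes "num s 10 0 = M" "inj_on (num s 20) {..<M}"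
  shows "wp inverse_table (\<lambda>t s'. t \<le> 100 * (M + 1) \<and> (\<forall>a<M. num s' 22 (num s 20 a) = a)) s"
  unfolding inverse_table_def
proof (rule wp_For[where n = M and C = 60 and I = "\<lambda>k s'. \<forall>a<k. num s' 22 (num s 20 a) = a"], goal_cases)
  case 1
  then show ?case by simp
next
  case (2 k s')
  then show ?case using assms by (simp add: frame_num[OF 2(3)])
next
  case (3 k s')
  have "num s' 20 = num s 20" by (auto simp: fun_eq_iff frame_num[OF 3(4)])
  then show ?case using 3 assms(2) by (auto simp: less_Suc_eq inj_on_def)
next
  case (4 t s')
  then show ?case by simp
qed

definition query :: com where
  "query = Seq (Set 13 (Var 18)) (Seq (Set 14 (Plus (Var 12) (Cell 22 (Plus (Var 0) (Var 13))))) query_loop)"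

definition push :: com where
  "push = Seq (Set 14 (Plus (Var 12) (Cell 22 (Var 13))))
     (Seq (Set 15 (Plus (Var 12) (Cell 22 (Plus (Plus (Var 0) (Var 0)) (Var 13))))) push_loop)"

text \<open>An index below \<open>n\<close> is a query if its segment is vertical, an index from
  \<open>n\<close> to \<open>n + n\<close> is a push if its segment is horizontal, and the remaining
  indices are passed over: upper ends act as keys only.\<close>

definition sweep_step :: com where
  "sweep_step = Seq (Set 17 (Minus (Var 17) (Const 1))) (Seq (Set 18 (Cell 20 (Var 17)))
     (If (Less (Var 18) (Var 0)) (If (Less (Const 0) (Cell 24 (Var 18))) query Skip)
       (If (Less (Var 18) (Plus (Var 0) (Var 0)))
         (Seq (Set 13 (Minus (Var 18) (Var 0))) (If (Less (Const 0) (Cell 24 (Var 13))) Skip push)) Skip)))"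

definition sweep :: com where
  "sweep = Seq (Set 17 (Var 10)) (While (Less (Const 0) (Var 17)) sweep_step)"

lemma query_writes [simp]: "num_writes query = {13, 14, 15, 30, 31, 32}" "crd_writes query = {}"
  by (auto simp: query_def)

lemma push_writes [simp]: "num_writes push = {14, 15, 25, 26, 27, 28}" "crd_writes push = {}"
  by (auto simp: push_def)

lemma sweep_step_writes [simp]:
  "num_writes sweep_step = {13, 14, 15, 17, 18, 25, 26, 27, 28, 30, 31, 32}" "crd_writes sweep_step = {}"
  by (auto simp: sweep_step_def)

lemma sweep_writes [simp]:
  "num_writes sweep = {13, 14, 15, 17, 18, 25, 26, 27, 28, 30, 31, 32}" "crd_writes sweep = {}"
  by (auto simp: sweep_def)

text \<open>Index \<open>i < n\<close> of the sorted order \<open>P\<close> stands for the lower end of segment \<open>i\<close>; index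
  \<open>n + i\<close> carries the same key and comes later, so in the downward sweep a horizontal segment is
  pushed before the vertical segments that start on it are queried.\<close>

locale sweep_data =
  fixes n M N L :: nat and P :: "nat \<Rightarrow> nat" and K :: "nat \<Rightarrow> real" and V :: "nat \<Rightarrow> bool"
    and pos :: "nat \<Rightarrow> nat"
  assumes N: "N = 2 ^ L" "M \<le> N" and M: "M = 3 * n"
    and P_less: "\<And>a. a < M \<Longrightarrow> P a < M" and pos_less: "\<And>i. i < M \<Longrightarrow> pos i < M"
begin

text \<open>The sweep runs from \<open>M\<close> down, so increasing positions from \<open>k\<close>
  on list the pushes from the latest to the earliest, which is the order of a stack read from its
  top.\<close>

definition pushed :: "nat \<Rightarrow> nat list" where
  "pushed k = map (\<lambda>a. P a - n) (filter (\<lambda>a. n \<le> P a \<and> P a < n + n \<and> \<not> V (P a - n)) [k..<M])"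

definition stack :: "nat \<Rightarrow> nat \<Rightarrow> nat list" where
  "stack k x = filter (\<lambda>h. x \<in> canon (N + pos h) (N + pos (n + n + h))) (pushed k)"

text \<open>The list follows the downward sweep. A query event pushes nothing, so
  \<open>stack a\<close> is the content both before and after the event at \<open>a\<close>.\<close>

definition found :: "nat \<Rightarrow> (nat \<times> nat) list" where
  "found k = concat (map (\<lambda>a. if P a < n \<and> V (P a)
     then map (Pair (P a)) (reported (stack a) K (K (n + n + P a)) (N + pos (n + P a))) else []) (rev [k..<M]))"

definition ready :: "state \<Rightarrow> bool" where
  "ready s \<longleftrightarrow> num s 0 0 = n \<and> num s 10 0 = M \<and> num s 12 0 = N \<and> (\<forall>a<M. num s 20 a = P a) \<and>
     (\<forall>i<M. num s 22 i = pos i) \<and> (\<forall>x<2 * N. num s 23 x = x div 2) \<and>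
     (\<forall>i<n. 0 < num s 24 i \<longleftrightarrow> V i) \<and> crd s 4 = K"

lemma ready_frame:
  "ready s \<Longrightarrow> frame c s s' \<Longrightarrow> num_writes c \<inter> {0, 10, 12, 20, 22, 23, 24} = {} \<Longrightarrow> 4 \<notin> crd_writes c \<Longrightarrow> ready s'"
  by (auto simp: ready_def frame_def fun_eq_iff)

lemma wp_sweep_step:
  assumes r: "ready s" and k: "num s 17 0 = Suc k" "Suc k \<le> M"
    and S: "stacks s (stack (Suc k))" and E: "edges s (found (Suc k))"
  shows "wp sweep_step (\<lambda>t s'. num s' 17 0 = k \<and> stacks s' (stack k) \<and> edges s' (found k) \<and>
     t + 60 * length (found (Suc k)) \<le> 60 * length (found k) + 200 * L + 400) s"
proof -
  have upt: "[k..<M] = k # [Suc k..<M]" using k by (simp add: upt_conv_Cons)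
  have kM: "k < M" using k by simp
  have v: "num s 0 0 = n" "num s 10 0 = M" "num s 12 0 = N" "num s 20 k = P k"
    "\<And>i. i < M \<Longrightarrow> num s 22 i = pos i" "\<And>x. x < 2 * N \<Longrightarrow> num s 23 x = x div 2"
    "\<And>i. i < n \<Longrightarrow> 0 < num s 24 i \<longleftrightarrow> V i" "crd s 4 = K"
    using r kM by (auto simp: ready_def)
  let ?s = "s\<lparr>num := set_cell (set_cell (num s) 17 0 k) 18 0 (P k)\<rparr>"
  have lenE: "num s 32 0 = length (found (Suc k))" using E by (simp add: edges_def)
  consider (query) "P k < n" "V (P k)" | (push) "n \<le> P k" "P k < n + n" "\<not> V (P k - n)"
    | (nop) "\<not> (P k < n \<and> V (P k))" "\<not> (n \<le> P k \<and> P k < n + n \<and> \<not> V (P k - n))" by linarith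
  then show ?thesis
  proof cases
    case query
    have st: "stack k = stack (Suc k)" using query by (simp add: fun_eq_iff stack_def pushed_def upt)
    have fd: "found k = found (Suc k) @ map (Pair (P k))
        (reported (stack (Suc k)) K (K (n + n + P k)) (N + pos (n + P k)))"
      using query by (simp add: found_def upt st)
    have pl: "pos (n + P k) < M" "n + P k < M" using query M pos_less[of "n + P k"] by auto
    let ?t = "?s\<lparr>num := set_cell (set_cell (num ?s) 13 0 (P k)) 14 0 (N + pos (n + P k))\<rparr>"
    have "wp query_loop (\<lambda>t s'. edges s' (found (Suc k) @ map (Pair (P k))
        (reported (stack (Suc k)) K (K (n + n + P k)) (N + pos (n + P k)))) \<and>
       t + 60 * length (found (Suc k)) \<le> 60 * num s' 32 0 + 60 * (L + 1) + 10) ?t"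
    proof (rule wp_query_loop)
      show "stacks ?t (stack (Suc k))" using S by (simp add: stacks_def)
      show "edges ?t (found (Suc k))" using E by (simp add: edges_def)
      show "N + pos (n + P k) < 2 ^ (L + 1)" using pl N by simp
      show "num ?t 23 x = x div 2" if "x \<le> N + pos (n + P k)" for x
        using that pl N v(6)[of x] by simp
    qed (use v in auto)
    then have *: "wp query_loop (\<lambda>t s'. num s' 17 0 = k \<and> stacks s' (stack k) \<and> edges s' (found k) \<and>
      t + 60 * length (found (Suc k)) \<le> 60 * length (found k) + 60 * (L + 1) + 10) ?t"
    proof (rule wp_frame)
      fix t s' assume A: "edges s' (found (Suc k) @ map (Pair (P k))
        (reported (stack (Suc k)) K (K (n + n + P k)) (N + pos (n + P k)))) \<and>
       t + 60 * length (found (Suc k)) \<le> 60 * num s' 32 0 + 60 * (L + 1) + 10" and f: "frame query_loop ?t s'"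
      have "num s' 25 = num s 25" "num s' 26 = num s 26" "num s' 27 = num s 27" "num s' 28 = num s 28" "num s' 17 0 = k"
        by (auto simp: fun_eq_iff frame_num[OF f])
      then show "num s' 17 0 = k \<and> stacks s' (stack k) \<and> edges s' (found k) \<and>
        t + 60 * length (found (Suc k)) \<le> 60 * length (found k) + 60 * (L + 1) + 10"
        using A S unfolding fd[symmetric] by (simp add: stacks_def st edges_def)
    qed
    show ?thesis
      unfolding sweep_step_def
      using query k v pl
      by (simp add: query_def) (rule wp_mono[OF *[simplified]], simp)
  next
    case push
    let ?h = "P k - n"
    have hn: "?h < n" using push by linarith
    have eq: "n + n + ?h = n + P k" using push by simp
    have pl: "pos ?h < M" "?h < M" "pos (n + n + ?h) < M" "n + n + ?h < M" using hn M pos_less[of ?h] pos_less[of "n + n + ?h"] by auto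
    have st: "stack k = (\<lambda>x. if x \<in> canon (N + pos ?h) (N + pos (n + n + ?h))
        then ?h # stack (Suc k) x else stack (Suc k) x)"
      using push by (auto simp: fun_eq_iff stack_def pushed_def upt)
    have fd: "found k = found (Suc k)" using push by (simp add: found_def upt)
    let ?t = "?s\<lparr>num := set_cell (set_cell (set_cell (num ?s) 13 0 ?h) 14 0 (N + pos ?h)) 15 0 (N + pos (n + n + ?h))\<rparr>"
    have "wp push_loop (\<lambda>t s'. t \<le> (if N + pos ?h < N + pos (n + n + ?h) then 200 * (L + 1) else 0) + 20 \<and>
       stacks s' (\<lambda>x. if x \<in> canon (N + pos ?h) (N + pos (n + n + ?h))
        then ?h # stack (Suc k) x else stack (Suc k) x)) ?t"
    proof (rule wp_push_loop)
      show "stacks ?t (stack (Suc k))" using S by (simp add: stacks_def)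
      show "2 ^ L \<le> N + pos ?h \<and> N + pos (n + n + ?h) \<le> 2 ^ Suc L" using pl N by simp
      show "num ?t 23 x = x div 2" if "x \<le> N + pos (n + n + ?h)" for x
        using that pl N v(6)[of x] by simp
    qed auto
    then have *: "wp push_loop (\<lambda>t s'. num s' 17 0 = k \<and> stacks s' (stack k) \<and> edges s' (found k) \<and>
      t \<le> 200 * (L + 1) + 20) ?t"
    proof (rule wp_frame)
      fix t s' assume A: "t \<le> (if N + pos ?h < N + pos (n + n + ?h) then 200 * (L + 1) else 0) + 20 \<and>
       stacks s' (\<lambda>x. if x \<in> canon (N + pos ?h) (N + pos (n + n + ?h))
        then ?h # stack (Suc k) x else stack (Suc k) x)" and f: "frame push_loop ?t s'"
      have "num s' 30 = num s 30" "num s' 31 = num s 31" "num s' 32 = num s 32" "num s' 17 0 = k"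
        by (auto simp: fun_eq_iff frame_num[OF f])
      then show "num s' 17 0 = k \<and> stacks s' (stack k) \<and> edges s' (found k) \<and> t \<le> 200 * (L + 1) + 20"
        using A E unfolding st[symmetric] by (simp add: edges_def fd split: if_splits)
    qed
    have V0: "num s 24 ?h = 0" using v(7)[OF hn] push by simp
    show ?thesis
      unfolding sweep_step_def
      using push k v pl V0
      by (simp add: push_def) (rule wp_mono[OF *[unfolded eq, simplified]], simp add: fd)
  next
    case nop
    have "pushed k = pushed (Suc k)"
      by (simp only: pushed_def upt filter.simps nop(2) if_False)
    then have st: "stack k = stack (Suc k)" by (simp add: fun_eq_iff stack_def)
    have fd: "found k = found (Suc k)" using nop by (auto simp: found_def upt)
    have "stacks ?s (stack (Suc k))" using S by (simp add: stacks_def)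
    moreover have "edges ?s (found (Suc k))" using E by (simp add: edges_def)
    moreover have "stacks (?s\<lparr>num := set_cell (num ?s) 13 0 x\<rparr>) (stack (Suc k))" for x
      using S by (simp add: stacks_def)
    moreover have "edges (?s\<lparr>num := set_cell (num ?s) 13 0 x\<rparr>) (found (Suc k))" for x
      using E by (simp add: edges_def)
    moreover have "P k < n \<Longrightarrow> num s 24 (P k) = 0" using nop(1) v(7)[of "P k"] by simp
    moreover have "\<not> P k < n \<Longrightarrow> P k < n + n \<Longrightarrow> 0 < num s 24 (P k - n)"
      using nop(2) v(7)[of "P k - n"] by auto
    ultimately show ?thesis
      unfolding sweep_step_def
      using k v by (simp add: st fd)
  qed
qed

lemma wp_sweep:
  assumes r: "ready s" and S: "stacks s (\<lambda>_. [])" and E: "edges s []"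
  shows "wp sweep (\<lambda>t s'. edges s' (found 0) \<and>
     t \<le> 60 * length (found 0) + M * (200 * L + 500) + 20) s"
proof -
  let ?s = "s\<lparr>num := set_cell (num s) 17 0 M\<rparr>"
  let ?I = "\<lambda>T s'. num s' 17 0 \<le> M \<and> stacks s' (stack (num s' 17 0)) \<and> edges s' (found (num s' 17 0)) \<and>
     T + num s' 17 0 * (200 * L + 500) \<le> 60 * length (found (num s' 17 0)) + M * (200 * L + 500)"
  have rs: "ready ?s" using r by (simp add: ready_def)
  have "wp (While (Less (Const 0) (Var 17)) sweep_step) (\<lambda>t s'. edges s' (found 0) \<and>
     5 + t \<le> 60 * length (found 0) + M * (200 * L + 500) + 20) ?s"
  proof (rule wp_While[where I = ?I and \<mu> = "\<lambda>s'. num s' 17 0"])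
    have "stack M = (\<lambda>_. [])" "found M = []" by (auto simp: stack_def pushed_def found_def)
    then show "?I 0 ?s" using S E by (simp add: stacks_def edges_def)
  next
    fix T s' assume inv: "?I T s'" and f: "frame sweep_step ?s s'" and t: "test_val (Less (Const 0) (Var 17)) s'"
    have r': "ready s'" by (rule ready_frame[OF rs f]) auto
    obtain k where k: "num s' 17 0 = Suc k" using t by (auto simp: gr0_conv_Suc)
    show "wp sweep_step (\<lambda>t s''. ?I (1 + test_cost (Less (Const 0) (Var 17)) + T + t) s'' \<and> num s'' 17 0 < num s' 17 0) s'"
      by (rule wp_mono[OF wp_sweep_step[OF r' k]]) (use inv k in auto)
  next
    fix T s' assume inv: "?I T s'" and f: "frame sweep_step ?s s'" and t: "\<not> test_val (Less (Const 0) (Var 17)) s'"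
    have "num s' 17 0 = 0" using t by simp
    then show "edges s' (found 0) \<and> 5 + (1 + test_cost (Less (Const 0) (Var 17)) + T) \<le>
       60 * length (found 0) + M * (200 * L + 500) + 20"
      using inv by simp
  qed
  then have "wp (While (Less (Const 0) (Var 17)) sweep_step) (\<lambda>t s'. edges s' (found 0) \<and>
     4 + t \<le> 60 * length (found 0) + M * (200 * L + 500) + 20) ?s" by (rule wp_mono) simp
  then show ?thesis using r by (simp add: sweep_def ready_def)
qed

end

section \<open>Deciding the degree condition\<close>

definition degree_in :: "(nat \<times> nat) list \<Rightarrow> nat \<Rightarrow> nat" where
  "degree_in es b = length (filter (\<lambda>e. snd e = b) es)"

definition supported :: "(nat \<times> nat) list \<Rightarrow> nat \<Rightarrow> bool" where
  "supported es a \<longleftrightarrow> (\<exists>b. (a, b) \<in> set es \<and> degree_in es b < 2)"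

definition free_nbrs :: "(nat \<Rightarrow> bool) \<Rightarrow> (nat \<times> nat) list \<Rightarrow> nat \<Rightarrow> nat list" where
  "free_nbrs sp es b = map fst (filter (\<lambda>e. snd e = b \<and> \<not> sp (fst e)) es)"

definition stored :: "state \<Rightarrow> (nat \<times> nat) list \<Rightarrow> bool" where
  "stored s es \<longleftrightarrow> num s 32 0 = length es \<and>
     (\<forall>k<length es. num s 40 k = fst (es ! k) \<and> num s 41 k = snd (es ! k))"

lemma stored_frame: "stored s es \<Longrightarrow> frame c s s' \<Longrightarrow> num_writes c \<inter> {32, 40, 41} = {} \<Longrightarrow> stored s' es"
  by (auto simp: stored_def frame_def)

definition count_degrees :: com where
  "count_degrees = For 11 (Var 32)
     (Assign 42 (Cell 41 (Var 11)) (Plus (Cell 42 (Cell 41 (Var 11))) (Const 1)))"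

lemma count_degrees_writes [simp]:
  "num_writes count_degrees = {11, 42}" "crd_writes count_degrees = {}"
  by (auto simp: count_degrees_def)

lemma wp_count_degrees:
  assumes es: "stored s es" and z: "\<And>b. num s 42 b = 0"
  shows "wp count_degrees (\<lambda>t s'. t \<le> 100 * (length es + 1) \<and> (\<forall>b. num s' 42 b = degree_in es b)) s"
  unfolding count_degrees_def
proof (rule wp_For[where n = "length es" and C = 60 and I = "\<lambda>k s'. \<forall>b. num s' 42 b = degree_in (take k es) b"], goal_cases)
  case 1
  then show ?case using z by (simp add: degree_in_def)
next
  case (2 k s')
  then show ?case using es by (simp add: frame_num[OF 2(3)] stored_def)
next
  case (3 k s')
  have "stored s' es" by (rule stored_frame[OF es 3(4)]) auto
  then show ?case using 3 by (simp add: stored_def take_Suc_conv_app_nth degree_in_def)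
next
  case (4 t s')
  then show ?case by simp
qed

definition mark_supported :: com where
  "mark_supported = For 11 (Var 32) (If (Less (Cell 42 (Cell 41 (Var 11))) (Const 2))
     (Assign 43 (Cell 40 (Var 11)) (Const 1)) Skip)"

lemma mark_supported_writes [simp]:
  "num_writes mark_supported = {11, 43}" "crd_writes mark_supported = {}"
  by (auto simp: mark_supported_def)

lemma wp_mark_supported:
  assumes es: "stored s es" and z: "\<And>b. num s 43 b = 0" and d: "\<And>b. num s 42 b = degree_in es b"
  shows "wp mark_supported (\<lambda>t s'. t \<le> 100 * (length es + 1) \<and> (\<forall>a. 0 < num s' 43 a \<longleftrightarrow> supported es a)) s"
  unfolding mark_supported_def
proof (rule wp_For[where n = "length es" and C = 60 and
    I = "\<lambda>k s'. \<forall>a. 0 < num s' 43 a \<longleftrightarrow> (\<exists>b. (a, b) \<in> set (take k es) \<and> degree_in es b < 2)"], goal_cases)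
  case 1
  then show ?case using z by simp
next
  case (2 k s')
  then show ?case using es by (simp add: frame_num[OF 2(3)] stored_def)
next
  case (3 k s')
  have st: "stored s' es" by (rule stored_frame[OF es 3(4)]) auto
  have d': "num s' 42 b = degree_in es b" for b using d by (simp add: frame_num[OF 3(4)])
  obtain a b where ab: "es ! k = (a, b)" by fastforce
  have "num s' 40 k = a" "num s' 41 k = b" using st 3(2) ab by (auto simp: stored_def)
  then show ?case using 3 d' ab by (auto simp: take_Suc_conv_app_nth)
next
  case (4 t s')
  then show ?case by (simp add: supported_def)
qed

definition quadruple :: "expr \<Rightarrow> expr" where
  "quadruple e = Plus (Plus e e) (Plus e e)"

lemma quadruple [simp]:
  "expr_val (quadruple e) s = 4 * expr_val e s" "expr_cost (quadruple e) = 3 + 4 * expr_cost e"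
  by (auto simp: quadruple_def)

definition collect_step :: com where
  "collect_step = If (Less (Cell 43 (Cell 40 (Var 11))) (Const 1))
     (If (Less (Cell 45 (Cell 41 (Var 11))) (Const 4))
       (Seq (Assign 44 (Plus (quadruple (Cell 41 (Var 11))) (Cell 45 (Cell 41 (Var 11)))) (Cell 40 (Var 11)))
         (Assign 45 (Cell 41 (Var 11)) (Plus (Cell 45 (Cell 41 (Var 11))) (Const 1))))
       (Set 46 (Const 1)))
     Skip"

definition collect :: com where
  "collect = For 11 (Var 32) collect_step"

lemma collect_writes [simp]:
  "num_writes collect = {11, 44, 45, 46}" "crd_writes collect = {}"
  by (auto simp: collect_def collect_step_def)

definition slots :: "state \<Rightarrow> (nat \<Rightarrow> nat list) \<Rightarrow> bool" where
  "slots s W \<longleftrightarrow> (\<forall>b. length (W b) \<le> 4 \<and> num s 45 b = length (W b) \<and>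
     (\<forall>i<length (W b). num s 44 (4 * b + i) = W b ! i))"

lemma slot_inj: "i < 4 \<Longrightarrow> j < 4 \<Longrightarrow> 4 * b + i = 4 * c + j \<Longrightarrow> b = c \<and> i = (j::nat)"
  by presburger

text \<open>Stopping at four slots keeps the work per crossing constant. On overflow the flag in
  array 46 already determines a negative answer, whatever the truncated lists contain.\<close>

lemma wp_collect:
  assumes es: "stored s es" and z: "\<And>b. num s 45 b = 0" "num s 46 0 = 0"
    and sp: "\<And>a. 0 < num s 43 a \<longleftrightarrow> sp a"
  shows "wp collect (\<lambda>t s'. t \<le> 100 * (length es + 1) \<and> slots s' (\<lambda>b. take 4 (free_nbrs sp es b)) \<and>
     (0 < num s' 46 0 \<longleftrightarrow> (\<exists>b. 4 < length (free_nbrs sp es b)))) s"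
  unfolding collect_def
proof (rule wp_For[where n = "length es" and C = 80 and
    I = "\<lambda>k s'. slots s' (\<lambda>b. take 4 (free_nbrs sp (take k es) b)) \<and>
     (0 < num s' 46 0 \<longleftrightarrow> (\<exists>b. 4 < length (free_nbrs sp (take k es) b)))"], goal_cases)
  case 1
  then show ?case using z by (simp add: slots_def free_nbrs_def)
next
  case (2 k s')
  then show ?case using es by (simp add: frame_num[OF 2(3)[folded collect_def]] stored_def)
next
  case (3 k s')
  note f = 3(4)[folded collect_def]
  have st: "stored s' es" by (rule stored_frame[OF es f]) auto
  have sp': "0 < num s' 43 a \<longleftrightarrow> sp a" for a using sp by (simp add: frame_num[OF f])
  obtain a b where ab: "es ! k = (a, b)" by fastforce
  have v: "num s' 40 k = a" "num s' 41 k = b" "num s' 11 0 = k" using st 3 ab by (auto simp: stored_def)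
  let ?U = "\<lambda>k. free_nbrs sp (take k es)"
  have U: "?U (Suc k) = (if sp a then ?U k else (?U k)(b := ?U k b @ [a]))"
    using ab 3(2) by (auto simp: fun_eq_iff take_Suc_conv_app_nth free_nbrs_def)
  from 3(1) have sl: "slots s' (\<lambda>b. take 4 (?U k b))"
    and fl: "0 < num s' 46 0 \<longleftrightarrow> (\<exists>b. 4 < length (?U k b))" by blast+
  have cnt: "num s' 45 b = min 4 (length (?U k b))" for b
    using sl by (simp add: slots_def min.commute)
  consider (sp) "sp a" | (room) "\<not> sp a" "length (?U k b) < 4" | (full) "\<not> sp a" "4 \<le> length (?U k b)"
    by linarith
  then show ?case
  proof cases
    case sp
    then have "\<not> num s' 43 a < 1" using sp'[of a] by simp
    then show ?thesis
      using v sl fl sp by (simp add: collect_step_def U slots_def)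
  next
    case room
    let ?l = "length (?U k b)"
    have s43: "num s' 43 a < 1" using sp'[of a] room by simp
    let ?s = "s'\<lparr>num := set_cell (set_cell (set_cell (num s') 44 (4 * b + ?l) a) 45 b (?l + 1)) 11 0 (Suc k)\<rparr>"
    have "slots ?s (\<lambda>b. take 4 (?U (Suc k) b))"
      unfolding slots_def
    proof (intro allI conjI impI)
      fix c
      show "length (take 4 (?U (Suc k) c)) \<le> 4" by simp
      show "num ?s 45 c = length (take 4 (?U (Suc k) c))"
        using cnt[of c] room by (simp add: U min.commute)
      fix i assume i: "i < length (take 4 (?U (Suc k) c))"
      show "num ?s 44 (4 * c + i) = take 4 (?U (Suc k) c) ! i"
      proof (cases "c = b \<and> i = ?l")
        case True
        then show ?thesis using room by (simp add: U)
      next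
        case False
        then have ne: "4 * c + i \<noteq> 4 * b + ?l" using slot_inj[of i ?l c b] i room by auto
        have i': "i < length (take 4 (?U k c))" using i False room by (auto simp: U split: if_splits)
        then have "num s' 44 (4 * c + i) = take 4 (?U k c) ! i" using sl by (simp add: slots_def)
        then show ?thesis using ne i' room by (auto simp: U nth_append)
      qed
    qed
    moreover have "(\<exists>b. 4 < length (?U (Suc k) b)) \<longleftrightarrow> (\<exists>b. 4 < length (?U k b))"
    proof -
      have "4 < length (?U (Suc k) c) \<longleftrightarrow> 4 < length (?U k c)" for c
        using room by (simp add: U)
      then show ?thesis by blast
    qed
    ultimately show ?thesis
      using v fl s43 cnt[of b] room by (simp add: collect_step_def)
  next
    case full
    have s43: "num s' 43 a < 1" using sp'[of a] full by simp
    have "take 4 (?U (Suc k) c) = take 4 (?U k c)" for c using full by (simp add: U)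
    moreover have "4 < length (?U (Suc k) b)" using full by (simp add: U)
    then have "\<exists>b. 4 < length (?U (Suc k) b)" by blast
    ultimately show ?thesis
      using v s43 cnt[of b] full sl by (simp add: collect_step_def slots_def)
  qed
next
  case (4 t s')
  then show ?case by simp
qed

text \<open>Row offsets \<open>x * n\<close> of the pair table, obtained by repeated addition
  because expressions have no product.\<close>

definition multiples :: com where
  "multiples = For 11 (Var 0)
     (Assign 47 (Plus (Var 11) (Const 1)) (Plus (Cell 47 (Var 11)) (Var 0)))"

lemma multiples_writes [simp]: "num_writes multiples = {11, 47}" "crd_writes multiples = {}"
  by (auto simp: multiples_def)

lemma wp_multiples:
  assumes "num s 0 0 = n" "num s 47 0 = 0"
  shows "wp multiples (\<lambda>t s'. t \<le> 100 * (n + 1) \<and> (\<forall>x<n. num s' 47 x = x * n)) s"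
  unfolding multiples_def
proof (rule wp_For[where n = n and C = 60 and I = "\<lambda>k s'. \<forall>x\<le>k. num s' 47 x = x * n"], goal_cases)
  case 1
  then show ?case using assms by simp
next
  case (2 k s')
  then show ?case using assms by (simp add: frame_num[OF 2(3)])
next
  case (3 k s')
  have "num s' 0 0 = n" using assms by (simp add: frame_num[OF 3(4)])
  then show ?case using 3 by (auto simp: le_Suc_eq)
next
  case (4 t s')
  then show ?case by simp
qed

definition slot :: "expr \<Rightarrow> expr \<Rightarrow> expr" where
  "slot b i = Cell 44 (Plus (quadruple b) i)"

definition pair_index :: "expr \<Rightarrow> expr \<Rightarrow> expr" where
  "pair_index x y = Plus (Cell 47 x) y"

lemma slot [simp]:
  "expr_val (slot b i) s = num s 44 (4 * expr_val b s + expr_val i s)"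
  "expr_cost (slot b i) = 5 + 4 * expr_cost b + expr_cost i"
  by (auto simp: slot_def)

lemma pair_index [simp]:
  "expr_val (pair_index x y) s = num s 47 (expr_val x s) + expr_val y s"
  "expr_cost (pair_index x y) = 2 + expr_cost x + expr_cost y"
  by (auto simp: pair_index_def)

text \<open>A vertex of degree two with both neighbours unsupported is counted in both orders of the
  pair, so a later lookup need not know the order. Only the cells of such pairs are touched; the
  quadratic table is never traversed.\<close>

definition count_pairs :: com where
  "count_pairs = For 11 (Var 0) (If (Conj (Less (Const 1) (Cell 42 (Var 11)))
       (Conj (Less (Cell 42 (Var 11)) (Const 3)) (Less (Const 1) (Cell 45 (Var 11)))))
     (Seq (Assign 48 (pair_index (slot (Var 11) (Const 0)) (slot (Var 11) (Const 1)))
        (Plus (Cell 48 (pair_index (slot (Var 11) (Const 0)) (slot (Var 11) (Const 1)))) (Const 1)))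
      (Assign 48 (pair_index (slot (Var 11) (Const 1)) (slot (Var 11) (Const 0)))
        (Plus (Cell 48 (pair_index (slot (Var 11) (Const 1)) (slot (Var 11) (Const 0)))) (Const 1))))
     Skip)"

lemma count_pairs_writes [simp]: "num_writes count_pairs = {11, 48}" "crd_writes count_pairs = {}"
  by (auto simp: count_pairs_def)

text \<open>The lists in \<open>W\<close> omit supported neighbours; \<open>d b = 2\<close> ensures
  that nothing was omitted. For the true degrees this is the set \<open>twins x y\<close>, see
  \<open>dedicated_eq\<close>.\<close>

definition dedicated :: "(nat \<Rightarrow> nat) \<Rightarrow> (nat \<Rightarrow> nat list) \<Rightarrow> nat \<Rightarrow> nat \<Rightarrow> nat set" where
  "dedicated d W x y = {b. d b = 2 \<and> (W b = [x, y] \<or> W b = [y, x])}"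

lemma pair_index_inj: "y < n \<Longrightarrow> y' < n \<Longrightarrow> x * n + y = x' * n + y' \<Longrightarrow> x = x' \<and> y = (y'::nat)"
  by (metis div_mult_self3 mod_mult_self3 div_less mod_less add.commute add_0 gr_implies_not0)

lemma wp_count_pairs:
  assumes n: "num s 0 0 = n" and mul: "\<forall>x<n. num s 47 x = x * n" and z: "\<And>i. num s 48 i = 0"
    and d: "\<And>b. num s 42 b = d b" and W: "slots s W" "\<And>b a. a \<in> set (W b) \<Longrightarrow> a < n"
    and Wd: "\<And>b. length (W b) \<le> d b"
  shows "wp count_pairs (\<lambda>t s'. t \<le> 200 * (n + 1) \<and>
     (\<forall>x<n. \<forall>y<n. x \<noteq> y \<longrightarrow> num s' 48 (x * n + y) = card ({..<n} \<inter> dedicated d W x y))) s"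
  unfolding count_pairs_def
proof (rule wp_For[where n = n and C = 180 and I = "\<lambda>k s'. \<forall>x<n. \<forall>y<n. x \<noteq> y \<longrightarrow>
    num s' 48 (x * n + y) = card ({..<k} \<inter> dedicated d W x y)"], goal_cases)
  case 1
  then show ?case using z by simp
next
  case (2 k s')
  then show ?case using n by (simp add: frame_num[OF 2(3)])
next
  case (3 k s')
  note f = 3(4)[folded count_pairs_def]
  have v: "num s' 42 k = d k" "num s' 45 k = length (W k)"
    "\<And>i. i < length (W k) \<Longrightarrow> num s' 44 (4 * k + i) = W k ! i" "\<And>x. x < n \<Longrightarrow> num s' 47 x = x * n"
    using d W(1) mul by (auto simp: frame_num[OF f] slots_def)
  have lW: "length (W k) \<le> 4" using W(1) by (auto simp: slots_def)
  have step: "card ({..<Suc k} \<inter> dedicated d W x y) =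
      card ({..<k} \<inter> dedicated d W x y) + (if k \<in> dedicated d W x y then 1 else 0)" for x y
    by (auto simp: lessThan_Suc Int_insert_left)
  show ?case
  proof (cases "d k = 2 \<and> length (W k) = 2")
    case True
    then obtain a b where W2: "W k = [a, b]" by (auto simp: length_Suc_conv numeral_2_eq_2)
    have ab: "a < n" "b < n" using W(2)[of _ k] W2 by auto
    have nb: "num s' 44 (4 * k) = a" "num s' 44 (4 * k + 1) = b" using v(3)[of 0] v(3)[of 1] W2 by auto
    have mem: "k \<in> dedicated d W x y \<longleftrightarrow> x = a \<and> y = b \<or> x = b \<and> y = a" for x y
      using True W2 by (auto simp: dedicated_def)
    have idx: "x * n + y = a * n + b \<longleftrightarrow> x = a \<and> y = b" "x * n + y = b * n + a \<longleftrightarrow> x = b \<and> y = a"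
      if "x < n" "y < n" for x y
      using that ab pair_index_inj[of y n b x a] pair_index_inj[of y n a x b] by auto
    have IH: "num s' 48 (x * n + y) = card ({..<k} \<inter> dedicated d W x y)" if "x < n" "y < n" "x \<noteq> y" for x y
      using 3(1) that by blast
    have mulab: "num s' 47 a = a * n" "num s' 47 b = b * n" using v(4) ab by auto
    let ?D = "(num s' 48)(a * n + b := num s' 48 (a * n + b) + 1)"
    have D: "(?D(b * n + a := ?D (b * n + a) + 1)) (x * n + y) = card ({..<Suc k} \<inter> dedicated d W x y)"
      if "x < n" "y < n" "x \<noteq> y" for x y
      using that ab by (auto simp: step mem IH idx)
    have nb': "num s' 44 (Suc (4 * k)) = b" using nb by simp
    show ?thesis
      using 3(3) v(1,2) True nb nb' mulab D by (simp del: fun_upd_apply)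
  next
    case False
    then have mem: "k \<notin> dedicated d W x y" for x y by (auto simp: dedicated_def)
    \<comment> \<open>A vertex of degree two has at most two listed neighbours by \<open>Wd\<close>,
      so the machine's test for more than one amounts to exactly two.\<close>
    have "\<not> (1 < d k \<and> d k < 3 \<and> 1 < length (W k))" using False Wd[of k] by linarith
    then have "\<not> (Suc 0 < d k \<and> d k < 3 \<and> Suc 0 < length (W k))" by simp
    then show ?thesis using 3(1,3) v by (cases "Suc 0 < d k"; cases "d k < 3") (simp_all add: step mem)
  qed
next
  case (4 t s')
  then show ?case by simp
qed

definition check_pair :: com where
  "check_pair = If (Conj (Less (Var 13) (Var 14))
       (Less (Cell 48 (pair_index (slot (Var 11) (Var 13)) (slot (Var 11) (Var 14)))) (Const 2)))
     (Set 46 (Const 1)) Skip"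

definition check_row :: com where
  "check_row = For 14 (Cell 45 (Var 11)) check_pair"

definition check_vertex :: com where
  "check_vertex = For 13 (Cell 45 (Var 11)) check_row"

definition check_all :: com where
  "check_all = For 11 (Var 0) check_vertex"

lemma check_writes [simp]:
  "num_writes check_pair = {46}" "crd_writes check_pair = {}"
  "num_writes check_row = {14, 46}" "crd_writes check_row = {}"
  "num_writes check_vertex = {13, 14, 46}" "crd_writes check_vertex = {}"
  "num_writes check_all = {11, 13, 14, 46}" "crd_writes check_all = {}"
  by (auto simp: check_all_def check_vertex_def check_row_def check_pair_def)

definition rare :: "nat \<Rightarrow> (nat \<Rightarrow> nat) \<Rightarrow> (nat \<Rightarrow> nat list) \<Rightarrow> nat \<Rightarrow> nat \<Rightarrow> nat \<Rightarrow> bool" where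
  "rare n d W b p q \<longleftrightarrow> p < q \<and> q < length (W b) \<and> card ({..<n} \<inter> dedicated d W (W b ! p) (W b ! q)) < 2"

definition checkable :: "state \<Rightarrow> nat \<Rightarrow> (nat \<Rightarrow> nat) \<Rightarrow> (nat \<Rightarrow> nat list) \<Rightarrow> bool" where
  "checkable s n d W \<longleftrightarrow> num s 0 0 = n \<and> slots s W \<and> (\<forall>x<n. num s 47 x = x * n) \<and>
     (\<forall>b. distinct (W b) \<and> set (W b) \<subseteq> {..<n}) \<and>
     (\<forall>x<n. \<forall>y<n. x \<noteq> y \<longrightarrow> num s 48 (x * n + y) = card ({..<n} \<inter> dedicated d W x y))"

lemma checkable_frame:
  "checkable s n d W \<Longrightarrow> frame c s s' \<Longrightarrow> num_writes c \<inter> {0, 44, 45, 47, 48} = {} \<Longrightarrow> checkable s' n d W"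
  by (auto simp: checkable_def frame_def slots_def)

lemma wp_check_row:
  assumes c: "checkable s n d W" and b: "num s 11 0 = b" and p: "num s 13 0 = p" "p < length (W b)"
  shows "wp check_row (\<lambda>t s'. t \<le> 600 \<and> (0 < num s' 46 0 \<longleftrightarrow> 0 < num s 46 0 \<or> (\<exists>q. rare n d W b p q))) s"
  unfolding check_row_def
proof (rule wp_For[where n = "length (W b)" and C = 60 and
    I = "\<lambda>k s'. 0 < num s' 46 0 \<longleftrightarrow> 0 < num s 46 0 \<or> (\<exists>q<k. rare n d W b p q)"], goal_cases)
  case 1
  then show ?case by simp
next
  case (2 k s')
  have "checkable s' n d W" by (rule checkable_frame[OF c 2(3)]) auto
  then show ?case using b by (simp add: checkable_def slots_def frame_num[OF 2(3)])
next
  case (3 k s')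
  have c': "checkable s' n d W" by (rule checkable_frame[OF c 3(4)]) auto
  have v: "num s' 11 0 = b" "num s' 13 0 = p" "num s' 14 0 = k" using b p 3(3) by (auto simp: frame_num[OF 3(4)])
  have sl: "num s' 44 (4 * b + p) = W b ! p" "num s' 44 (4 * b + k) = W b ! k"
    using c' p 3(2) by (auto simp: checkable_def slots_def)
  have ran: "W b ! p < n" "W b ! k < n" and dist: "p < k \<Longrightarrow> W b ! p \<noteq> W b ! k"
  proof -
    have less: "x < n" if "x \<in> set (W b)" for x using c' that by (auto simp: checkable_def)
    show "W b ! p < n" "W b ! k < n" using less[OF nth_mem] p(2) 3(2) by auto
    show "p < k \<Longrightarrow> W b ! p \<noteq> W b ! k"
      using c' p(2) 3(2) by (simp add: nth_eq_iff_index_eq checkable_def)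
  qed
  have D: "num s' 47 (W b ! p) = W b ! p * n" using c' ran by (simp add: checkable_def)
  have D2: "p < k \<Longrightarrow> num s' 48 (W b ! p * n + W b ! k) = card ({..<n} \<inter> dedicated d W (W b ! p) (W b ! k))"
    using c' ran dist unfolding checkable_def by blast
  have ex: "(\<exists>q<Suc k. rare n d W b p q) \<longleftrightarrow> (\<exists>q<k. rare n d W b p q) \<or> rare n d W b p k"
    by (auto simp: less_Suc_eq)
  have rare: "rare n d W b p k \<longleftrightarrow> p < k \<and> num s' 48 (W b ! p * n + W b ! k) < 2"
    using D2 3(2) by (auto simp: rare_def)
  show ?case
    using 3(1) v sl D unfolding ex rare
    by (simp add: check_pair_def) blast
next
  case (4 t s')
  have "length (W b) \<le> 4" using c by (auto simp: checkable_def slots_def)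
  moreover have "(\<exists>q<length (W b). rare n d W b p q) \<longleftrightarrow> (\<exists>q. rare n d W b p q)" by (auto simp: rare_def)
  \<comment> \<open>Here the four slots make the time per row independent of the degree.\<close>
  moreover have "t \<le> (4 + 1) * (60 + expr_cost (Cell 45 (Var 11)) + 10)"
    using 4(3) \<open>length (W b) \<le> 4\<close> by (auto intro: order.trans)
  ultimately show ?case using 4(1) by simp
qed

lemma wp_check_vertex:
  assumes c: "checkable s n d W" and b: "num s 11 0 = b"
  shows "wp check_vertex (\<lambda>t s'. t \<le> 5000 \<and> (0 < num s' 46 0 \<longleftrightarrow> 0 < num s 46 0 \<or> (\<exists>p q. rare n d W b p q))) s"
  unfolding check_vertex_def
proof (rule wp_For[where n = "length (W b)" and C = 600 and
    I = "\<lambda>k s'. 0 < num s' 46 0 \<longleftrightarrow> 0 < num s 46 0 \<or> (\<exists>p<k. \<exists>q. rare n d W b p q)"], goal_cases)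
  case 1
  then show ?case by simp
next
  case (2 k s')
  have "checkable s' n d W" by (rule checkable_frame[OF c 2(3)]) auto
  then show ?case using b by (simp add: checkable_def slots_def frame_num[OF 2(3)])
next
  case (3 k s')
  have c': "checkable s' n d W" by (rule checkable_frame[OF c 3(4)]) auto
  have v: "num s' 11 0 = b" using b by (simp add: frame_num[OF 3(4)])
  show ?case
    by (rule wp_frame[OF wp_check_row[OF c' v 3(3,2)]])
      (use 3(1,3) in \<open>auto simp: less_Suc_eq dest: frame_num[of _ _ _ 13 0]\<close>)
next
  case (4 t s')
  have "length (W b) \<le> 4" using c by (auto simp: checkable_def slots_def)
  moreover have "(\<exists>p<length (W b). \<exists>q. rare n d W b p q) \<longleftrightarrow> (\<exists>p q. rare n d W b p q)"
    by (auto simp: rare_def intro: less_trans)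
  moreover have "t \<le> (4 + 1) * (600 + expr_cost (Cell 45 (Var 11)) + 10)"
    using 4(3) \<open>length (W b) \<le> 4\<close> by (auto intro: order.trans)
  ultimately show ?case using 4(1) by simp
qed

lemma wp_check_all:
  assumes c: "checkable s n d W"
  shows "wp check_all (\<lambda>t s'. t \<le> 6000 * (n + 1) \<and>
    (0 < num s' 46 0 \<longleftrightarrow> 0 < num s 46 0 \<or> (\<exists>b<n. \<exists>p q. rare n d W b p q))) s"
  unfolding check_all_def
proof (rule wp_For[where n = n and C = 5000 and
    I = "\<lambda>k s'. 0 < num s' 46 0 \<longleftrightarrow> 0 < num s 46 0 \<or> (\<exists>b<k. \<exists>p q. rare n d W b p q)"], goal_cases)
  case 1
  then show ?case by simp
next
  case (2 k s')
  have "checkable s' n d W" by (rule checkable_frame[OF c 2(3)]) auto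
  then show ?case by (simp add: checkable_def)
next
  case (3 k s')
  have c': "checkable s' n d W" by (rule checkable_frame[OF c 3(4)]) auto
  show ?case
    by (rule wp_frame[OF wp_check_vertex[OF c' 3(3)]])
      (use 3(1,3) in \<open>auto simp: less_Suc_eq dest: frame_num[of _ _ _ 11 0]\<close>)
next
  case (4 t s')
  then show ?case by simp
qed

definition graph :: com where
  "graph = Seq count_degrees (Seq mark_supported (Seq collect (Seq multiples (Seq count_pairs check_all))))"

text \<open>This is the condition as computed, overflow included. For a grid the first conjunct
  follows from the second: \<open>graph_ok_iff\<close> translates both, and
  \<open>rich_imp_card_le_4\<close> supplies the implication.\<close>

definition graph_ok :: "nat \<Rightarrow> (nat \<times> nat) list \<Rightarrow> bool" where
  "graph_ok n es \<longleftrightarrow> (\<forall>b. length (free_nbrs (supported es) es b) \<le> 4) \<and>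
     \<not> (\<exists>b<n. \<exists>p q. rare n (degree_in es) (free_nbrs (supported es) es) b p q)"

lemma graph_writes [simp]:
  "num_writes graph = {11, 13, 14, 42, 43, 44, 45, 46, 47, 48}" "crd_writes graph = {}"
  by (auto simp: graph_def)

lemma distinct_free_nbrs: "distinct es \<Longrightarrow> distinct (free_nbrs sp es b)"
  by (auto simp: free_nbrs_def distinct_map inj_on_def prod_eq_iff)

lemma length_free_nbrs: "length (free_nbrs sp es b) \<le> degree_in es b"
  by (induction es) (auto simp: free_nbrs_def degree_in_def)

lemma wp_graph:
  assumes es: "stored s es" "distinct es" "\<And>e. e \<in> set es \<Longrightarrow> fst e < n \<and> snd e < n"
    and n: "num s 0 0 = n" and z: "\<And>a i. 42 \<le> a \<Longrightarrow> a \<le> 48 \<Longrightarrow> num s a i = 0"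
  shows "wp graph (\<lambda>t s'. t \<le> 300 * (length es + 1) + 6300 * (n + 1) \<and>
     (num s' 46 0 = 0 \<longleftrightarrow> graph_ok n es)) s"
  unfolding graph_def
proof (rule wp_SeqI[OF wp_count_degrees[OF es(1)]], goal_cases)
  case (1 b)
  then show ?case using z by simp
next
  case (2 t1 s1)
  let ?d = "degree_in es" and ?U = "free_nbrs (supported es) es"
  let ?W = "\<lambda>b. take 4 (?U b)"
  have es1: "stored s1 es" by (rule stored_frame[OF es(1) 2(2)]) auto
  have z1: "num s1 a i = 0" if "43 \<le> a" "a \<le> 48" for a i using z[of a i] that by (simp add: frame_num[OF 2(2)])
  have v1: "num s1 0 0 = n" "\<And>b. num s1 42 b = ?d b" using n 2(1) by (auto simp: frame_num[OF 2(2)])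
  show ?case
  proof (rule wp_SeqI[OF wp_mark_supported[OF es1 _ v1(2)]], goal_cases)
    case (1 b)
    then show ?case using z1 by simp
  next
    case (2 t2 s2)
    have es2: "stored s2 es" by (rule stored_frame[OF es1 2(2)]) auto
    have z2: "num s2 a i = 0" if "44 \<le> a" "a \<le> 48" for a i using z1[of a i] that by (simp add: frame_num[OF 2(2)])
    have v2: "num s2 0 0 = n" "\<And>b. num s2 42 b = ?d b" "\<And>a. 0 < num s2 43 a \<longleftrightarrow> supported es a"
      using v1 2(1) by (auto simp: frame_num[OF 2(2)])
    note t2 = conjunct1[OF 2(1)]
    show ?case
    proof (rule wp_SeqI[OF wp_collect[OF es2 _ _ v2(3)]], goal_cases)
      case (3 t3 s3)
      have z3: "num s3 a i = 0" if "47 \<le> a" "a \<le> 48" for a i using z2[of a i] that by (simp add: frame_num[OF 3(2)])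
      have v3: "num s3 0 0 = n" "\<And>b. num s3 42 b = ?d b" "slots s3 ?W"
        and f3: "0 < num s3 46 0 \<longleftrightarrow> (\<exists>b. 4 < length (?U b))"
        using v2 3(1) by (auto simp: frame_num[OF 3(2)])
      note t3 = conjunct1[OF 3(1)]
      show ?case
      proof (rule wp_SeqI[OF wp_multiples[OF v3(1)]], goal_cases)
        case (2 t4 s4)
        have z4: "num s4 48 i = 0" for i using z3 by (simp add: frame_num[OF 2(2)])
        have v4: "num s4 0 0 = n" "\<And>b. num s4 42 b = ?d b" "\<forall>x<n. num s4 47 x = x * n"
          using v3 2(1) by (auto simp: frame_num[OF 2(2)])
        have sl4: "slots s4 ?W" using v3(3) by (simp add: slots_def frame_num[OF 2(2)])
        have f4: "num s4 46 0 = num s3 46 0" by (simp add: frame_num[OF 2(2)])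
        have W: "a < n" if "a \<in> set (?W b)" for a b
          using set_take_subset[of 4 "?U b"] that es(3) by (force simp: free_nbrs_def)
        have dW: "length (?W b) \<le> ?d b" for b
          using length_free_nbrs[of "supported es" es b] by simp
        note t4 = conjunct1[OF 2(1)]
        show ?case
        proof (rule wp_SeqI[OF wp_count_pairs[OF v4(1,3) z4 v4(2) sl4 W dW]], goal_cases)
          case (2 t5 s5)
          have v5: "num s5 0 0 = n" "\<forall>x<n. num s5 47 x = x * n"
            using v4 by (auto simp: frame_num[OF 2(2)])
          have sl5: "slots s5 ?W" using sl4 by (simp add: slots_def frame_num[OF 2(2)])
          have f5: "num s5 46 0 = num s3 46 0" using f4 by (simp add: frame_num[OF 2(2)])
          have c: "checkable s5 n ?d ?W"
            unfolding checkable_def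
            using v5 sl5 2(1) W distinct_free_nbrs[OF es(2)] by (auto intro: distinct_take)
          note t5 = conjunct1[OF 2(1)]
          show ?case
          proof (rule wp_mono[OF wp_check_all[OF c]])
            fix t6 s6
            assume A: "t6 \<le> 6000 * (n + 1) \<and>
              (0 < num s6 46 0 \<longleftrightarrow> 0 < num s5 46 0 \<or> (\<exists>b<n. \<exists>p q. rare n ?d ?W b p q))"
            have "num s6 46 0 = 0 \<longleftrightarrow> graph_ok n es"
            proof (cases "\<exists>b. 4 < length (?U b)")
              case True
              then have "\<not> graph_ok n es" by (auto simp: graph_ok_def not_le)
              moreover have "0 < num s6 46 0" using A f5 f3 True by simp
              ultimately show ?thesis by simp
            next
              case False
              \<comment> \<open>Without overflow the truncation to four entries is the
                identity.\<close>
              then have "?W = ?U" by (auto simp: fun_eq_iff not_less)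
              then have "0 < num s6 46 0 \<longleftrightarrow> (\<exists>b<n. \<exists>p q. rare n ?d ?U b p q)"
                using A f5 f3 False by simp
              moreover have "graph_ok n es \<longleftrightarrow> \<not> (\<exists>b<n. \<exists>p q. rare n ?d ?U b p q)"
                using False unfolding graph_ok_def not_less[symmetric] by blast
              ultimately show ?thesis unfolding neq0_conv[symmetric] by blast
            qed
            moreover have "t1 + (t2 + (t3 + (t4 + (t5 + t6)))) \<le> 300 * (length es + 1) + 6300 * (n + 1)"
              using conjunct1[OF \<open>t1 \<le> 100 * (length es + 1) \<and> (\<forall>b. num s1 42 b = ?d b)\<close>] t2 t3 t4 t5 conjunct1[OF A]
              by linarith
            ultimately show "t1 + (t2 + (t3 + (t4 + (t5 + t6)))) \<le> 300 * (length es + 1) + 6300 * (n + 1) \<and>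
              (num s6 46 0 = 0 \<longleftrightarrow> graph_ok n es)" by blast
          qed
        qed assumption
      qed (use z3 in simp)
    qed (use z2 in auto)
  qed
qed

section \<open>Domination in bipartite graphs\<close>

locale bipartite =
  fixes A B :: "'a set" and N :: "'a \<Rightarrow> 'a set"
  assumes fin: "finite A" "finite B" and disj: "A \<inter> B = {}"
    and nbrs: "\<And>b. b \<in> B \<Longrightarrow> N b \<subseteq> A" "\<And>b. b \<in> B \<Longrightarrow> N b \<noteq> {}"
    and cover: "\<And>a. a \<in> A \<Longrightarrow> \<exists>b\<in>B. a \<in> N b"
begin

definition dominating :: "'a set \<Rightarrow> bool" where
  "dominating D \<longleftrightarrow> D \<subseteq> A \<union> B \<and> (\<forall>a\<in>A. a \<in> D \<or> (\<exists>b\<in>B \<inter> D. a \<in> N b)) \<and>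
     (\<forall>b\<in>B. b \<in> D \<or> (\<exists>a\<in>A \<inter> D. a \<in> N b))"

text \<open>The support vertices of graph theory, that is, the neighbours of leaves, restricted to
  the side \<open>A\<close>.\<close>

definition support :: "'a set" where
  "support = {a \<in> A. \<exists>b\<in>B. N b = {a}}"

definition twins :: "'a \<Rightarrow> 'a \<Rightarrow> 'a set" where
  "twins x y = {b \<in> B. N b = {x, y}}"

lemma dominating_A: "dominating A"
  using nbrs by (auto simp: dominating_def) blast

text \<open>Let \<open>b\<close> be the only twin, or \<open>c\<close> if there is none. Replacing
  \<open>x\<close> and \<open>y\<close> by \<open>b\<close> keeps \<open>A\<close> dominating: a
  vertex of \<open>B\<close> with no neighbour outside \<open>{x, y}\<close> is either a leaf, which
  is impossible since \<open>x\<close> and \<open>y\<close> are unsupported, or a twin and hence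
  \<open>b\<close> itself.\<close>

lemma few_twins_dominating:
  assumes c: "c \<in> B" "x \<in> N c - support" "y \<in> N c - support" "x \<noteq> y" and few: "card (twins x y) < 2"
  shows "\<exists>D. dominating D \<and> card D < card A"
proof -
  have "\<exists>b\<in>B. x \<in> N b \<and> y \<in> N b \<and> twins x y \<subseteq> {b}"
  proof (cases "twins x y = {}")
    case True
    then show ?thesis using c by auto
  next
    case False
    moreover have "finite (twins x y)" using fin by (simp add: twins_def)
    ultimately have "card (twins x y) = 1" using few by (metis One_nat_def card_gt_0_iff less_2_cases not_gr_zero)
    then obtain b where "twins x y = {b}" by (auto simp: card_1_singleton_iff)
    moreover have "b \<in> twins x y" using calculation by simp
    ultimately show ?thesis by (auto simp: twins_def)
  qed
  then obtain b where b: "b \<in> B" "x \<in> N b" "y \<in> N b" "twins x y \<subseteq> {b}" by blast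
  let ?D = "insert b (A - {x, y})"
  have xy: "x \<in> A" "y \<in> A" using c nbrs by auto
  have "dominating ?D"
    unfolding dominating_def
  proof (intro conjI ballI)
    show "?D \<subseteq> A \<union> B" using b by auto
    show "a \<in> ?D \<or> (\<exists>b\<in>B \<inter> ?D. a \<in> N b)" if "a \<in> A" for a using that b by auto
    show "e \<in> ?D \<or> (\<exists>a\<in>A \<inter> ?D. a \<in> N e)" if e: "e \<in> B" for e
    proof (cases "N e \<subseteq> {x, y}")
      case True
      then have "N e = {x} \<or> N e = {y} \<or> N e = {x, y}" using nbrs(2)[OF e] by auto
      moreover have "N e \<noteq> {x}" "N e \<noteq> {y}" using c e xy by (auto simp: support_def)
      ultimately have "e \<in> twins x y" using e by (simp add: twins_def)
      then show ?thesis using b by auto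
    next
      case False
      then show ?thesis using nbrs(1)[OF e] by auto
    qed
  qed
  moreover have "card ?D < card A"
  proof -
    have "card (A - {x, y}) = card A - 2" using xy c fin by (simp add: card_Diff_subset)
    moreover have "2 \<le> card A" using card_mono[of A "{x, y}"] xy c fin by simp
    moreover have "card ?D \<le> Suc (card (A - {x, y}))" by (rule card_insert_le_m1) auto
    ultimately show ?thesis by simp
  qed
  ultimately show ?thesis by blast
qed

text \<open>The vertices of \<open>A\<close> missing from a dominating set are mapped injectively to vertices of \<open>B\<close> in it:
  a supported one to a leaf, one with an unsupported missing partner to one of the two twins
  reserved for the pair, any other one to a neighbour.\<close>

lemma card_dominating_ge:
  assumes many: "\<And>b x y. b \<in> B \<Longrightarrow> x \<in> N b - support \<Longrightarrow> y \<in> N b - support \<Longrightarrow> x \<noteq> y \<Longrightarrow> 2 \<le> card (twins x y)"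
    and D: "dominating D"
  shows "card A \<le> card D"
proof -
  define F where "F = A - D - support"
  define partner where "partner x y \<longleftrightarrow> y \<in> F \<and> y \<noteq> x \<and> (\<exists>b\<in>B. x \<in> N b \<and> y \<in> N b)" for x y
  define mate where "mate x = (SOME y. partner x y)" for x
  have mate: "partner x (mate x)" if "\<exists>y. partner x y" for x
    using someI_ex[OF that] by (simp add: mate_def)
  have inD: "b \<in> D" if "b \<in> B" "N b \<inter> D = {}" for b
    using D that by (auto simp: dominating_def)
  have "\<exists>g. inj_on g {x, y} \<and> g ` {x, y} \<subseteq> twins x y" if p: "x \<in> F" "partner x y" for x y
  proof -
    obtain b where b: "b \<in> B" "x \<in> N b" "y \<in> N b" using p by (auto simp: partner_def)
    have "2 \<le> card (twins x y)"
      by (rule many[OF b(1)]) (use b that in \<open>auto simp: partner_def F_def\<close>)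
    moreover have "card {x, y} \<le> 2" by (simp add: card_insert_if)
    moreover have "finite (twins x y)" using fin by (simp add: twins_def)
    ultimately show ?thesis by (meson card_le_inj finite.emptyI finite_insert order.trans)
  qed
  \<comment> \<open>The injection is chosen for the unordered pair \<open>p\<close>. Two vertices
    that are mates of each other thereby use the same injection and receive different twins.\<close>
  then have "\<forall>p. \<exists>g. \<forall>x y. p = {x, y} \<and> x \<in> F \<and> partner x y \<longrightarrow> inj_on g {x, y} \<and> g ` {x, y} \<subseteq> twins x y"
  proof (intro allI, goal_cases)
    case (1 p)
    show ?case
    proof (cases "\<exists>x y. p = {x, y} \<and> x \<in> F \<and> partner x y")
      case True
      then obtain x y where xy: "p = {x, y}" "x \<in> F" "partner x y" by blast
      then obtain g where g: "inj_on g {x, y}" "g ` {x, y} \<subseteq> twins x y" using 1 by blast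
      have "twins u v = twins x y" if "p = {u, v}" for u v
        using that xy by (simp add: twins_def)
      then show ?thesis using g xy by (metis (no_types))
    qed auto
  qed
  then obtain g where g: "\<And>x y. x \<in> F \<Longrightarrow> partner x y \<Longrightarrow> inj_on (g {x, y}) {x, y} \<and> g {x, y} ` {x, y} \<subseteq> twins x y"
    by metis
  define f where "f x = (if x \<in> support then SOME b. b \<in> B \<and> N b = {x}
     else if \<exists>y. partner x y then g {x, mate x} x else SOME b. b \<in> B \<inter> D \<and> x \<in> N b)" for x
  have f1: "f x \<in> B \<and> N (f x) = {x}" if "x \<in> support" for x
    using someI_ex[of "\<lambda>b. b \<in> B \<and> N b = {x}"] that by (auto simp: f_def support_def)
  have f2: "f x \<in> B \<and> N (f x) = {x, mate x}" if "x \<in> F" "\<exists>y. partner x y" for x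
    using g[OF that(1) mate[OF that(2)]] that by (auto simp: f_def F_def twins_def)
  have f3: "f x \<in> B \<inter> D \<and> x \<in> N (f x)" if "x \<in> F" "\<not> (\<exists>y. partner x y)" for x
  proof -
    have "\<exists>b. b \<in> B \<inter> D \<and> x \<in> N b" using D that by (auto simp: dominating_def F_def)
    moreover have "f x = (SOME b. b \<in> B \<inter> D \<and> x \<in> N b)"
    proof -
      have "x \<notin> support" using that by (simp add: F_def)
      with that(2) show ?thesis unfolding f_def by (simp only: if_False)
    qed
    ultimately show ?thesis using someI_ex[of "\<lambda>b. b \<in> B \<inter> D \<and> x \<in> N b"] by simp
  qed
  \<comment> \<open>The trace of \<open>N (f x)\<close> on \<open>F\<close> is empty,
    \<open>{x}\<close> or \<open>{x, mate x}\<close> according to the three clauses of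
    \<open>f\<close>. Equal images therefore come from the same clause, and in the last case from
    the same pair.\<close>
  have F3: "N (f x) \<inter> F = {x}" if "x \<in> F" "\<not> (\<exists>y. partner x y)" for x
    using f3[OF that] that by (auto simp: partner_def)
  have F2: "N (f x) \<inter> F = {x, mate x}" if "x \<in> F" "\<exists>y. partner x y" for x
    using f2[OF that] mate[OF that(2)] that(1) by (auto simp: partner_def)
  have F1: "N (f x) \<inter> F = {}" if "x \<in> support" for x
    using f1[OF that] that by (auto simp: F_def)
  have split: "x \<in> support \<or> x \<in> F" if "x \<in> A - D" for x using that by (auto simp: F_def)
  have ne: "mate x \<noteq> x" if "\<exists>y. partner x y" for x using mate[OF that] by (simp add: partner_def)
  have inj: "inj_on f (A - D)"
  proof (rule inj_onI)
    fix x y assume xy: "x \<in> A - D" "y \<in> A - D" and eq: "f x = f y"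
    have eqN: "N (f x) = N (f y)" and eqF: "N (f x) \<inter> F = N (f y) \<inter> F" by (simp_all only: eq)
    show "x = y"
    proof (cases "x \<in> support")
      case True
      show ?thesis
      proof (cases "y \<in> support")
        case True
        then show ?thesis using f1[OF \<open>x \<in> support\<close>] f1[OF True] eqN by blast
      next
        case False
        then have "y \<in> F" using split[OF xy(2)] by simp
        then have "N (f y) \<inter> F \<noteq> {}" using F2[of y] F3[of y] by blast
        then show ?thesis using F1[OF True] eqF by blast
      qed
    next
      case False
      then have x: "x \<in> F" using split[OF xy(1)] by simp
      have y: "y \<in> F"
      proof (rule ccontr)
        assume "y \<notin> F"
        then have "y \<in> support" using split[OF xy(2)] by simp
        then have "N (f x) \<inter> F = {}" using F1 eqF by blast
        then show False using x F2[of x] F3[of x] by blast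
      qed
      show ?thesis
      proof (cases "\<exists>z. partner x z")
        case True
        then have 1: "N (f x) \<inter> F = {x, mate x}" using F2[OF x] by blast
        have py: "\<exists>z. partner y z"
        proof (rule ccontr)
          assume "\<not> (\<exists>z. partner y z)"
          then have "{x, mate x} = {y}" using F3[OF y] 1 eqF by blast
          then show False using ne[OF True] by auto
        qed
        then have e: "{x, mate x} = {y, mate y}" using 1 F2[OF y py] eqF by blast
        have "g {x, mate x} x = g {x, mate x} y"
        proof -
          have "x \<notin> support" "y \<notin> support" using x y by (auto simp: F_def)
          then have "f x = g {x, mate x} x" "f y = g {y, mate y} y"
            using True py unfolding f_def by (simp_all only: if_False if_True)
          then show ?thesis using eq unfolding e by (simp only:)
        qed
        moreover have "inj_on (g {x, mate x}) {x, mate x}" using g[OF x mate[OF True]] by blast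
        moreover have "y \<in> {x, mate x}" using e by simp
        ultimately show ?thesis by (meson inj_onD insertI1)
      next
        case False
        then have 1: "N (f x) \<inter> F = {x}" using F3[OF x] by blast
        have "\<not> (\<exists>z. partner y z)"
        proof
          assume py: "\<exists>z. partner y z"
          then have "{y, mate y} = {x}" using F2[OF y] 1 eqF by blast
          then show False using ne[OF py] by auto
        qed
        then show ?thesis using F3[OF y] 1 eqF by blast
      qed
    qed
  qed
  \<comment> \<open>Leaves and twins selected by \<open>f\<close> have all their neighbours outside
    \<open>D\<close>, so \<open>D\<close> can dominate them only by containing them.\<close>
  have "f ` (A - D) \<subseteq> B \<inter> D"
  proof
    fix b assume "b \<in> f ` (A - D)"
    then obtain x where x: "x \<in> A - D" "b = f x" by blast
    show "b \<in> B \<inter> D"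
    proof (cases "x \<in> support")
      case True
      then show ?thesis using f1[OF True] x inD[of b] by auto
    next
      case False
      then have F: "x \<in> F" using split x by blast
      show ?thesis
      proof (cases "\<exists>y. partner x y")
        case True
        then show ?thesis using f2[OF F True] mate[OF True] x inD[of b] by (auto simp: partner_def F_def)
      next
        case False
        then show ?thesis using f3[OF F False] x by simp
      qed
    qed
  qed
  then have le: "card (A - D) \<le> card (B \<inter> D)"
    using inj fin by (metis card_inj_on_le finite_Int)
  have "card A = card (A \<inter> D) + card (A - D)"
    using fin by (metis card_Int_Diff)
  also have "\<dots> \<le> card (A \<inter> D) + card (B \<inter> D)" using le by simp
  also have "\<dots> = card ((A \<inter> D) \<union> (B \<inter> D))"
    using fin disj by (subst card_Un_disjoint) auto
  also have "(A \<inter> D) \<union> (B \<inter> D) = D" using D by (auto simp: dominating_def)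
  finally show ?thesis .
qed

lemma card_le_dominating_iff:
  "(\<forall>D. dominating D \<longrightarrow> card A \<le> card D) \<longleftrightarrow>
   (\<forall>b\<in>B. \<forall>x\<in>N b - support. \<forall>y\<in>N b - support. x \<noteq> y \<longrightarrow> 2 \<le> card (twins x y))"
  using few_twins_dominating card_dominating_ge by (metis not_less)

end

text \<open>All five intervals contain \<open>y\<close>, so each of the points escapes the excluded
  intervals on one definite side of \<open>y\<close>. The points \<open>a\<close> and
  \<open>b\<close> lie on opposite sides, since otherwise intervals 2 and 3 would each reach beyond
  the other; so do \<open>b\<close> and \<open>c\<close>, by intervals 3 and 4. Thus
  \<open>a\<close> and \<open>c\<close> agree. On their side \<open>d\<close> conflicts with
  \<open>c\<close>, and \<open>e\<close> with \<open>a\<close>; on the other side \<open>d\<close>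
  and \<open>e\<close> make intervals 2 and 4 each reach beyond the other.\<close>

lemma no_five:
  fixes y :: real
  assumes "l1 \<le> y" "y \<le> h1" "l2 \<le> y" "y \<le> h2" "l3 \<le> y" "y \<le> h3" "l4 \<le> y" "y \<le> h4" "l5 \<le> y" "y \<le> h5"
    and "l1 \<le> a" "a \<le> h1" "l3 \<le> a" "a \<le> h3" "a < l2 \<or> h2 < a"
    and "l2 \<le> b" "b \<le> h2" "l4 \<le> b" "b \<le> h4" "b < l3 \<or> h3 < b"
    and "l3 \<le> c" "c \<le> h3" "l5 \<le> c" "c \<le> h5" "c < l4 \<or> h4 < c"
    and "l1 \<le> d" "d \<le> h1" "l4 \<le> d" "d \<le> h4" "d < l2 \<or> h2 < d" "d < l3 \<or> h3 < d"
    and "l2 \<le> e" "e \<le> h2" "l5 \<le> e" "e \<le> h5" "e < l3 \<or> h3 < e" "e < l4 \<or> h4 < e"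
  shows False
  using assms by linarith

context bipartite
begin

definition rich :: bool where
  "rich \<longleftrightarrow> (\<forall>b\<in>B. \<forall>x\<in>N b - support. \<forall>y\<in>N b - support. x \<noteq> y \<longrightarrow> 2 \<le> card (twins x y))"

text \<open>Twins of \<open>x\<close> and \<open>y\<close> pass beyond all segments between \<open>x\<close> and \<open>y\<close>; five segments crossed by a
  common one cannot all be linked in this way.\<close>

lemma rich_card_le_4:
  fixes c lo hi e f g :: "'a \<Rightarrow> real"
  assumes adj: "\<And>a b. a \<in> A \<Longrightarrow> b \<in> B \<Longrightarrow> a \<in> N b \<longleftrightarrow> f b \<le> c a \<and> c a \<le> g b \<and> lo a \<le> e b \<and> e b \<le> hi a"
    and c: "\<And>b. b \<in> B \<Longrightarrow> inj_on c (N b)"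
    and rich: rich and b: "b \<in> B"
  shows "card (N b - support) \<le> 4"
proof (rule ccontr)
  assume "\<not> card (N b - support) \<le> 4"
  define T where "T = N b - support"
  have fT: "finite T" using fin nbrs(1)[OF b] by (auto simp: T_def intro: finite_subset)
  have inj: "inj_on c T" by (rule inj_on_subset[OF c[OF b]]) (auto simp: T_def)
  define rs where "rs = sorted_list_of_set (c ` T)"
  have len: "5 \<le> length rs" using \<open>\<not> _\<close> by (simp add: rs_def card_image[OF inj] T_def[symmetric])
  have sorted: "rs ! i < rs ! j" if "i < j" "j < 5" for i j
    using sorted_wrt_nth_less[of "(<)" rs i j] strict_sorted_list_of_set[of "c ` T"] that len
    by (simp add: rs_def)
  have "\<exists>x\<in>T. c x = rs ! i" if "i < 5" for i
  proof -
    have "rs ! i \<in> set rs" using that len by simp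
    then show ?thesis using fT by (auto simp: rs_def)
  qed
  then obtain w where w: "\<And>i. i < 5 \<Longrightarrow> w i \<in> T" "\<And>i. i < 5 \<Longrightarrow> c (w i) = rs ! i" by metis
  have wA: "w i \<in> A" "w i \<in> N b" if "i < 5" for i using w(1)[OF that] nbrs(1)[OF b] by (auto simp: T_def)
  have lt: "c (w i) < c (w j)" if "i < j" "j < 5" for i j using sorted[OF that] w(2) that by simp
  have link: "\<exists>t. lo (w i) \<le> t \<and> t \<le> hi (w i) \<and> lo (w j) \<le> t \<and> t \<le> hi (w j) \<and>
      (\<forall>l. i < l \<and> l < j \<longrightarrow> t < lo (w l) \<or> hi (w l) < t)" if ij: "i < j" "j < 5" for i j
  proof -
    have ne: "w i \<noteq> w j" using lt[OF ij] by auto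
    have "2 \<le> card (twins (w i) (w j))"
      using rich b w(1)[of i] w(1)[of j] ij ne unfolding rich_def T_def by (simp add: Ball_def)
    then have "twins (w i) (w j) \<noteq> {}" by auto
    then obtain t where t: "t \<in> B" "N t = {w i, w j}" by (auto simp: twins_def)
    have ti: "f t \<le> c (w i)" "lo (w i) \<le> e t" "e t \<le> hi (w i)"
      and tj: "c (w j) \<le> g t" "lo (w j) \<le> e t" "e t \<le> hi (w j)"
      using adj[OF wA(1) t(1), of i] adj[OF wA(1) t(1), of j] t(2) ij by auto
    have "e t < lo (w l) \<or> hi (w l) < e t" if l: "i < l" "l < j" for l
    proof -
      have il: "c (w i) < c (w l)" and lj: "c (w l) < c (w j)" using l ij by (auto intro!: lt)
      then have "w l \<noteq> w i" "w l \<noteq> w j" by auto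
      then have "w l \<notin> N t" by (simp add: t(2))
      then show ?thesis using adj[OF wA(1) t(1), of l] il lj ti(1) tj(1) l ij by auto
    qed
    then show ?thesis using ti tj by blast
  qed
  have y: "lo (w i) \<le> e b \<and> e b \<le> hi (w i)" if "i < 5" for i
    using adj[OF wA(1)[OF that] b] wA(2)[OF that] by simp
  obtain t1 where t1: "lo (w 0) \<le> t1 \<and> t1 \<le> hi (w 0) \<and> lo (w 2) \<le> t1 \<and> t1 \<le> hi (w 2) \<and>
      (\<forall>l. 0 < l \<and> l < 2 \<longrightarrow> t1 < lo (w l) \<or> hi (w l) < t1)" using link[of 0 2] by auto
  obtain t2 where t2: "lo (w 1) \<le> t2 \<and> t2 \<le> hi (w 1) \<and> lo (w 3) \<le> t2 \<and> t2 \<le> hi (w 3) \<and>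
      (\<forall>l. 1 < l \<and> l < 3 \<longrightarrow> t2 < lo (w l) \<or> hi (w l) < t2)" using link[of 1 3] by auto
  obtain t3 where t3: "lo (w 2) \<le> t3 \<and> t3 \<le> hi (w 2) \<and> lo (w 4) \<le> t3 \<and> t3 \<le> hi (w 4) \<and>
      (\<forall>l. 2 < l \<and> l < 4 \<longrightarrow> t3 < lo (w l) \<or> hi (w l) < t3)" using link[of 2 4] by auto
  obtain t4 where t4: "lo (w 0) \<le> t4 \<and> t4 \<le> hi (w 0) \<and> lo (w 3) \<le> t4 \<and> t4 \<le> hi (w 3) \<and>
      (\<forall>l. 0 < l \<and> l < 3 \<longrightarrow> t4 < lo (w l) \<or> hi (w l) < t4)" using link[of 0 3] by auto
  obtain t5 where t5: "lo (w 1) \<le> t5 \<and> t5 \<le> hi (w 1) \<and> lo (w 4) \<le> t5 \<and> t5 \<le> hi (w 4) \<and>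
      (\<forall>l. 1 < l \<and> l < 4 \<longrightarrow> t5 < lo (w l) \<or> hi (w l) < t5)" using link[of 1 4] by auto
  have m: "t1 < lo (w 1) \<or> hi (w 1) < t1" "t2 < lo (w 2) \<or> hi (w 2) < t2" "t3 < lo (w 3) \<or> hi (w 3) < t3"
    "t4 < lo (w 1) \<or> hi (w 1) < t4" "t4 < lo (w 2) \<or> hi (w 2) < t4"
    "t5 < lo (w 2) \<or> hi (w 2) < t5" "t5 < lo (w 3) \<or> hi (w 3) < t5"
    using t1 t2 t3 t4 t5 by auto
  show False
    by (rule no_five[of "lo (w 0)" "e b" "hi (w 0)" "lo (w 1)" "hi (w 1)" "lo (w 2)" "hi (w 2)"
          "lo (w 3)" "hi (w 3)" "lo (w 4)" "hi (w 4)" t1 t2 t3 t4 t5])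
      (use m t1 t2 t3 t4 t5 y[of 0] y[of 1] y[of 2] y[of 3] y[of 4] in simp_all)
qed

end

section \<open>The domination criterion expressed by an edge list\<close>

locale edge_list = bipartite A B N for A B :: "nat set" and N +
  fixes n :: nat and es :: "(nat \<times> nat) list"
  assumes bounded: "A \<subseteq> {..<n}" "B \<subseteq> {..<n}"
    and es: "distinct es" "set es = {(a, b). b \<in> B \<and> a \<in> N b}"
begin

lemma edge_iff: "(a, b) \<in> set es \<longleftrightarrow> b \<in> B \<and> a \<in> N b"
  by (simp add: es)

lemma fin_N: "b \<in> B \<Longrightarrow> finite (N b)"
  using fin nbrs(1) by (auto intro: finite_subset)

lemma degree_in_eq: "b \<in> B \<Longrightarrow> degree_in es b = card (N b)"
proof -
  assume b: "b \<in> B"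
  have "degree_in es b = card (set (filter (\<lambda>e. snd e = b) es))"
    unfolding degree_in_def by (rule distinct_card[symmetric]) (simp add: es)
  also have "set (filter (\<lambda>e. snd e = b) es) = (\<lambda>a. (a, b)) ` N b"
    using b by (auto simp: es)
  also have "card \<dots> = card (N b)" by (rule card_image) (auto simp: inj_on_def)
  finally show ?thesis .
qed

lemma supported_iff: "supported es a \<longleftrightarrow> a \<in> support"
proof
  assume "supported es a"
  then obtain b where b: "b \<in> B" "a \<in> N b" "card (N b) < 2"
    using degree_in_eq by (auto simp: supported_def edge_iff)
  then have "card (N b) = 1" using fin_N[OF b(1)] by (metis One_nat_def card_0_eq empty_iff less_2_cases)
  then have "N b = {a}" using b(2) by (metis card_1_singletonE singletonD)
  then show "a \<in> support" using b nbrs(1) by (auto simp: support_def)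
next
  assume "a \<in> support"
  then obtain b where "b \<in> B" "N b = {a}" by (auto simp: support_def)
  then show "supported es a" using degree_in_eq[of b] by (auto simp: supported_def edge_iff)
qed

abbreviation free :: "nat \<Rightarrow> nat list" where
  "free \<equiv> free_nbrs (supported es) es"

lemma set_free: "set (free b) = (if b \<in> B then N b - support else {})"
proof -
  have "x \<in> set (free b) \<longleftrightarrow> (x, b) \<in> set es \<and> x \<notin> support" for x
    by (auto simp: free_nbrs_def supported_iff intro: image_eqI[where x = "(x, b)"])
  then show ?thesis by (intro set_eqI) (simp add: edge_iff)
qed

lemma distinct_free: "distinct (free b)"
  by (rule distinct_free_nbrs[OF es(1)])

lemma length_free: "length (free b) = card (set (free b))"
  by (simp add: distinct_card[OF distinct_free])

text \<open>Degree two leaves no room for a supported neighbour beside \<open>x\<close> and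
  \<open>y\<close>, and conversely a twin of unsupported vertices lists both of them, in one order
  or the other.\<close>

lemma dedicated_eq:
  assumes "x \<notin> support" "y \<notin> support" "x \<noteq> y"
  shows "{..<n} \<inter> dedicated (degree_in es) free x y = twins x y"
proof (intro equalityI subsetI)
  fix b assume "b \<in> {..<n} \<inter> dedicated (degree_in es) free x y"
  then have d: "degree_in es b = 2" and "free b = [x, y] \<or> free b = [y, x]"
    by (auto simp: dedicated_def)
  then have s: "set (free b) = {x, y}" by auto
  then have b: "b \<in> B" "{x, y} \<subseteq> N b" using set_free[of b] by (auto split: if_splits)
  have "N b = {x, y}"
    using card_subset_eq[OF fin_N[OF b(1)] b(2)] d degree_in_eq[OF b(1)] assms by simp
  then show "b \<in> twins x y" using b by (simp add: twins_def)
next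
  fix b assume "b \<in> twins x y"
  then have b: "b \<in> B" "N b = {x, y}" by (auto simp: twins_def)
  then have s: "set (free b) = {x, y}" using set_free[of b] assms by auto
  then have "length (free b) = 2" using length_free[of b] assms by simp
  then obtain u v where uv: "free b = [u, v]" by (auto simp: length_Suc_conv numeral_2_eq_2)
  then have "free b = [x, y] \<or> free b = [y, x]" using s assms by (auto simp: doubleton_eq_iff)
  then show "b \<in> {..<n} \<inter> dedicated (degree_in es) free x y"
    using b assms bounded(2) degree_in_eq[OF b(1)] by (auto simp: dedicated_def)
qed

lemma graph_ok_iff:
  "graph_ok n es \<longleftrightarrow> (\<forall>b\<in>B. card (N b - support) \<le> 4) \<and> rich"
proof -
  have 1: "(\<forall>b. length (free b) \<le> 4) \<longleftrightarrow> (\<forall>b\<in>B. card (N b - support) \<le> 4)"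
    by (auto simp: length_free set_free)
  have tw: "twins x y = twins y x" for x y by (auto simp: twins_def)
  have "(\<exists>b<n. \<exists>p q. rare n (degree_in es) free b p q) \<longleftrightarrow> \<not> rich"
  proof
    assume "\<exists>b<n. \<exists>p q. rare n (degree_in es) free b p q"
    then obtain b p q where r: "p < q" "q < length (free b)"
      "card ({..<n} \<inter> dedicated (degree_in es) free (free b ! p) (free b ! q)) < 2"
      by (auto simp: rare_def)
    let ?x = "free b ! p" and ?y = "free b ! q"
    have m: "?x \<in> set (free b)" "?y \<in> set (free b)" and ne: "?x \<noteq> ?y"
      using r(1,2) distinct_free[of b] by (simp_all add: nth_eq_iff_index_eq)
    then have b: "b \<in> B" "?x \<in> N b - support" "?y \<in> N b - support"
      using set_free[of b] by (auto split: if_splits)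
    then have "card (twins ?x ?y) < 2" using dedicated_eq[of ?x ?y] r(3) ne by simp
    then show "\<not> rich" using b ne unfolding rich_def by (metis not_less)
  next
    assume "\<not> rich"
    then obtain b x y where b: "b \<in> B" "x \<in> N b - support" "y \<in> N b - support" "x \<noteq> y" "card (twins x y) < 2"
      by (auto simp: rich_def not_le)
    then have "x \<in> set (free b)" "y \<in> set (free b)" by (auto simp: set_free)
    then obtain i j where ij: "i < length (free b)" "free b ! i = x" "j < length (free b)" "free b ! j = y"
      by (meson in_set_conv_nth)
    have "i \<noteq> j" using ij b(4) by auto
    have bn: "b < n" using b(1) bounded by auto
    show "\<exists>b<n. \<exists>p q. rare n (degree_in es) free b p q"
    proof (cases "i < j")
      case True
      have "rare n (degree_in es) free b i j"
        unfolding rare_def using True ij b dedicated_eq[of x y] by simp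
      then show ?thesis using bn by blast
    next
      case False
      have "rare n (degree_in es) free b j i"
        unfolding rare_def using False \<open>i \<noteq> j\<close> ij b dedicated_eq[of y x] tw[of x y] by simp
      then show ?thesis using bn by blast
    qed
  qed
  then show ?thesis unfolding graph_ok_def 1 by blast
qed

end

section \<open>Correctness of the sweep: every crossing, once\<close>

lemma sorts_less_iff:
  assumes "sorts K M P" "a < M" "b < M"
  shows "key_less K (P a) (P b) \<longleftrightarrow> a < b"
proof -
  have *: "key_less K (P i) (P j)" if "i < j" "j < M" for i j using assms(1) that by (simp add: sorts_def)
  consider "a < b" | "a = b" | "b < a" by linarith
  then show ?thesis using *[of a b] *[of b a] assms key_less_asym[of K "P b" "P a"] by cases auto
qed

lemma sorts_bij:
  assumes "sorts K M P"
  shows "bij_betw P {..<M} {..<M}"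
proof -
  have "inj_on P {..<M}"
  proof (rule inj_onI)
    fix a b assume "a \<in> {..<M}" "b \<in> {..<M}" "P a = P b"
    then show "a = b"
      using sorts_less_iff[OF assms, of a b] sorts_less_iff[OF assms, of b a] by force
  qed
  moreover have "P ` {..<M} \<subseteq> {..<M}" using assms by (auto simp: sorts_def)
  ultimately show ?thesis by (simp add: bij_betw_def endo_inj_surj)
qed

lemma sorts_surj:
  assumes "sorts K M P" "i < M"
  shows "\<exists>a<M. P a = i"
proof -
  have "i \<in> P ` {..<M}" using sorts_bij[OF assms(1)] assms(2) by (simp add: bij_betw_def)
  then show ?thesis by auto
qed

text \<open>Justifies the early exit from a stack: later pushes have smaller keys, so the keys
  increase from the top and nothing is missed behind the first one that is too large.\<close>

lemma takeWhile_sorted: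
  "sorted_wrt (\<lambda>x y. K x \<le> K y) xs \<Longrightarrow> takeWhile (\<lambda>h. K h \<le> (y::real)) xs = filter (\<lambda>h. K h \<le> y) xs"
proof (induction xs)
  case (Cons a xs)
  show ?case
  proof (cases "K a \<le> y")
    case False
    then have "\<forall>x\<in>set xs. \<not> K x \<le> y" using Cons.prems by fastforce
    then show ?thesis using False by (simp add: filter_empty_conv)
  qed (use Cons in simp)
qed simp

lemma distinct_concat_map:
  "distinct xs \<Longrightarrow> (\<And>x. x \<in> set xs \<Longrightarrow> distinct (F x)) \<Longrightarrow>
   (\<And>x y. x \<in> set xs \<Longrightarrow> y \<in> set xs \<Longrightarrow> x \<noteq> y \<Longrightarrow> set (F x) \<inter> set (F y) = {}) \<Longrightarrow> distinct (concat (map F xs))"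
  by (induction xs) (simp, fastforce)

text \<open>\<open>K\<close> and \<open>P\<close> belong to the ordinates and drive the sweep;
  \<open>KX\<close>, \<open>PX\<close> and the inverse \<open>pos\<close> belong to the abscissas
  and address the leaves of the tree.\<close>

locale sweep_sorted = sweep_data n M N L P K V pos for n M N L P K V pos +
  fixes KX :: "nat \<Rightarrow> real" and PX :: "nat \<Rightarrow> nat"
  assumes P: "sorts K M P" and PX: "sorts KX M PX" and pos: "\<And>a. a < M \<Longrightarrow> pos (PX a) = a"
    and K: "\<And>i. i < n \<Longrightarrow> K (n + i) = K i" and KX: "\<And>i. i < n \<Longrightarrow> KX (n + i) = KX i"
begin

lemma pos_less_iff:
  assumes "i < M" "j < M"
  shows "pos i < pos j \<longleftrightarrow> key_less KX i j"
proof -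
  obtain a b where "a < M" "PX a = i" "b < M" "PX b = j" using sorts_surj[OF PX] assms by metis
  then show ?thesis using sorts_less_iff[OF PX, of a b] pos[of a] pos[of b] by simp
qed

lemma pos_le_iff:
  assumes "i < M" "j < M" "i \<noteq> j"
  shows "pos i \<le> pos j \<longleftrightarrow> key_less KX i j"
proof -
  have "pos j < pos i \<longleftrightarrow> key_less KX j i" by (rule pos_less_iff) fact+
  then show ?thesis using key_less_total[OF assms(3)] key_less_asym[of KX] by (metis not_less)
qed

abbreviation node :: "nat \<Rightarrow> nat" where
  "node v \<equiv> N + pos (n + v)"

definition nodes :: "nat \<Rightarrow> nat set" where
  "nodes h = canon (N + pos h) (N + pos (n + n + h))"

lemma nodes_level:
  assumes "h < n" "v < n"
  shows "2 ^ L \<le> N + pos h" "N + pos (n + n + h) \<le> 2 ^ Suc L" "2 ^ L \<le> node v" "node v < 2 ^ Suc L"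
  using assms N M pos_less[of "n + n + h"] pos_less[of "n + v"] by auto

text \<open>The interval of positions is half-open and the interval of abscissas is closed. They
  match because indices grow from \<open>h\<close> over \<open>n + v\<close> to
  \<open>n + n + h\<close>, so ties at either end fall inside.\<close>

lemma hit_iff:
  assumes "h < n" "v < n"
  shows "(\<exists>x\<in>set (ups (node v)). x \<in> nodes h) \<longleftrightarrow> KX h \<le> KX v \<and> KX v \<le> KX (n + n + h)"
proof -
  have "(\<exists>x\<in>set (ups (node v)). x \<in> nodes h) \<longleftrightarrow>
      N + pos h \<le> node v \<and> node v < N + pos (n + n + h)"
    unfolding nodes_def by (rule canon_ups(1)[OF nodes_level]) fact+
  also have "\<dots> \<longleftrightarrow> key_less KX h (n + v) \<and> key_less KX (n + v) (n + n + h)"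
    using pos_le_iff[of h "n + v"] pos_less_iff[of "n + v" "n + n + h"] assms M by simp
  also have "\<dots> \<longleftrightarrow> KX h \<le> KX v \<and> KX v \<le> KX (n + n + h)"
    using assms KX[of v] by (auto simp: key_less_def)
  finally show ?thesis .
qed

text \<open>The push of \<open>h\<close> has index \<open>n + h\<close>, which exceeds
  \<open>v\<close>. On equal keys it therefore lies later in the sorted order than the query, and
  the strict order of events becomes a non-strict comparison of keys.\<close>

lemma mem_pushed:
  assumes "a < M" "P a = v" "v < n"
  shows "h \<in> set (pushed a) \<longleftrightarrow> h < n \<and> \<not> V h \<and> K v \<le> K h"
proof -
  have "h \<in> set (pushed a) \<longleftrightarrow> h < n \<and> \<not> V h \<and> (\<exists>c. a \<le> c \<and> c < M \<and> P c = n + h)"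
  proof
    assume "h \<in> set (pushed a)"
    then obtain c where "h = P c - n" "a \<le> c" "c < M" "n \<le> P c" "P c < n + n" "\<not> V (P c - n)"
      by (auto simp: pushed_def)
    then show "h < n \<and> \<not> V h \<and> (\<exists>c. a \<le> c \<and> c < M \<and> P c = n + h)" by auto
  next
    assume "h < n \<and> \<not> V h \<and> (\<exists>c. a \<le> c \<and> c < M \<and> P c = n + h)"
    then obtain c where c: "h < n" "\<not> V h" "a \<le> c" "c < M" "P c = n + h" by blast
    then show "h \<in> set (pushed a)" by (auto simp: pushed_def intro!: image_eqI[of h _ c])
  qed
  moreover have "(\<exists>c. a \<le> c \<and> c < M \<and> P c = n + h) \<longleftrightarrow> K v \<le> K h" if h: "h < n"
  proof -
    have "n + h < M" using h M by simp
    then obtain c where c: "c < M" "P c = n + h" using sorts_surj[OF P] by blast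
    have uniq: "d = c" if "d < M" "P d = n + h" for d
      using sorts_bij[OF P] c that unfolding bij_betw_def inj_on_def by simp
    have "a \<noteq> c" using assms c by auto
    then have "a \<le> c \<longleftrightarrow> key_less K v (n + h)"
      using sorts_less_iff[OF P assms(1) c(1)] assms c by auto
    also have "\<dots> \<longleftrightarrow> K v \<le> K h" using K[OF h] assms by (auto simp: key_less_def)
    finally show ?thesis using c uniq by blast
  qed
  ultimately show ?thesis by blast
qed

lemma pushed_sorted: "sorted_wrt (\<lambda>x y. K x \<le> K y) (pushed a)"
  unfolding pushed_def sorted_wrt_map
proof (rule sorted_wrt_mono_rel[of _ "(<)"])
  fix c d assume c: "c \<in> set (filter (\<lambda>a. n \<le> P a \<and> P a < n + n \<and> \<not> V (P a - n)) [a..<M])"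
    and d: "d \<in> set (filter (\<lambda>a. n \<le> P a \<and> P a < n + n \<and> \<not> V (P a - n)) [a..<M])" and "c < d"
  then have "key_less K (P c) (P d)" using P by (simp add: sorts_def)
  then have "K (P c) \<le> K (P d)" by (auto simp: key_less_def)
  then show "K (P c - n) \<le> K (P d - n)" using c d K[of "P c - n"] K[of "P d - n"] by auto
qed (simp add: sorted_wrt_filter)

lemma pushed_distinct: "distinct (pushed a)"
proof -
  have "inj_on (\<lambda>a. P a - n) (set (filter (\<lambda>a. n \<le> P a \<and> P a < n + n \<and> \<not> V (P a - n)) [a..<M]))"
  proof (rule inj_onI)
    fix c d assume "c \<in> set (filter (\<lambda>a. n \<le> P a \<and> P a < n + n \<and> \<not> V (P a - n)) [a..<M])"
      "d \<in> set (filter (\<lambda>a. n \<le> P a \<and> P a < n + n \<and> \<not> V (P a - n)) [a..<M])" "P c - n = P d - n"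
    then have "P c = P d" "c < M" "d < M" by auto
    then show "c = d" using sorts_bij[OF P] unfolding bij_betw_def inj_on_def by simp
  qed
  then show ?thesis unfolding pushed_def by (simp add: distinct_map)
qed

lemma reported_eq:
  "reported (stack a) K y q =
     concat (map (\<lambda>x. filter (\<lambda>h. K h \<le> y) (filter (\<lambda>h. x \<in> nodes h) (pushed a))) (ups q))"
proof -
  have "takeWhile (\<lambda>h. K h \<le> y) (stack a x) = filter (\<lambda>h. K h \<le> y) (stack a x)" for x
    unfolding stack_def by (intro takeWhile_sorted sorted_wrt_filter pushed_sorted)
  then show ?thesis by (simp add: reported_def stack_def nodes_def)
qed

text \<open>Distinctness rests on the uniqueness in \<open>canon_ups\<close>: at most one ancestor
  of the leaf holds a given segment, so the stacks read by one query are disjoint.\<close>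

lemma reported_at:
  assumes a: "a < M" "P a = v" "v < n"
  shows "set (reported (stack a) K (K (n + n + v)) (node v)) = {h. h < n \<and> \<not> V h \<and>
      KX h \<le> KX v \<and> KX v \<le> KX (n + n + h) \<and> K v \<le> K h \<and> K h \<le> K (n + n + v)}"
    and "distinct (reported (stack a) K (K (n + n + v)) (node v))"
proof -
  have mem: "h \<in> set (reported (stack a) K (K (n + n + v)) (node v)) \<longleftrightarrow>
      h \<in> set (pushed a) \<and> K h \<le> K (n + n + v) \<and> (\<exists>x\<in>set (ups (node v)). x \<in> nodes h)" for h
    unfolding reported_eq by auto
  show "set (reported (stack a) K (K (n + n + v)) (node v)) = {h. h < n \<and> \<not> V h \<and>
      KX h \<le> KX v \<and> KX v \<le> KX (n + n + h) \<and> K v \<le> K h \<and> K h \<le> K (n + n + v)}"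
  proof (rule set_eqI)
    fix h
    show "h \<in> set (reported (stack a) K (K (n + n + v)) (node v)) \<longleftrightarrow> h \<in> {h. h < n \<and> \<not> V h \<and>
      KX h \<le> KX v \<and> KX v \<le> KX (n + n + h) \<and> K v \<le> K h \<and> K h \<le> K (n + n + v)}"
    proof (cases "h < n")
      case True
      show ?thesis unfolding mem mem_pushed[OF a] hit_iff[OF True a(3)] by blast
    next
      case False
      then show ?thesis unfolding mem mem_pushed[OF a] by blast
    qed
  qed
  show "distinct (reported (stack a) K (K (n + n + v)) (node v))"
    unfolding reported_eq
  proof (rule distinct_concat_map)
    fix x y assume x: "x \<in> set (ups (node v))" and y: "y \<in> set (ups (node v))" and ne: "x \<noteq> y"
    have "\<not> (x \<in> nodes h \<and> y \<in> nodes h)" if "h < n" for h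
      using canon_ups(2)[OF nodes_level[OF that a(3)] x _ y] ne unfolding nodes_def by blast
    then show "set (filter (\<lambda>h. K h \<le> K (n + n + v)) (filter (\<lambda>h. x \<in> nodes h) (pushed a))) \<inter>
        set (filter (\<lambda>h. K h \<le> K (n + n + v)) (filter (\<lambda>h. y \<in> nodes h) (pushed a))) = {}"
      using mem_pushed[OF a] by auto
  qed (auto simp: distinct_ups pushed_distinct)
qed

lemma found_eq:
  "found 0 = concat (map (\<lambda>a. if P a < n \<and> V (P a)
     then map (Pair (P a)) (reported (stack a) K (K (n + n + P a)) (node (P a))) else []) (rev [0..<M]))"
  by (simp only: found_def)

lemma set_found:
  "set (found 0) = {(v, h). v < n \<and> V v \<and> h < n \<and> \<not> V h \<and>
      KX h \<le> KX v \<and> KX v \<le> KX (n + n + h) \<and> K v \<le> K h \<and> K h \<le> K (n + n + v)}"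
proof -
  have "(v, h) \<in> set (found 0) \<longleftrightarrow> v < n \<and> V v \<and>
      (\<exists>a<M. P a = v \<and> h \<in> set (reported (stack a) K (K (n + n + v)) (node v)))" for v h
    by (auto simp: found_eq split: if_splits)
  moreover have "\<exists>a<M. P a = v" if "v < n" for v using sorts_surj[OF P, of v] that M by simp
  ultimately show ?thesis using reported_at(1) by fastforce
qed

text \<open>Needed twice: degrees are counted as occurrences in this list, and its length has to be
  bounded by the number of intersection points.\<close>

lemma distinct_found: "distinct (found 0)"
  unfolding found_eq
proof (rule distinct_concat_map)
  fix a assume "a \<in> set (rev [0..<M])"
  then show "distinct (if P a < n \<and> V (P a)
     then map (Pair (P a)) (reported (stack a) K (K (n + n + P a)) (node (P a))) else [])"
    using reported_at(2)[of a "P a"] by (simp add: distinct_map inj_on_def)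
next
  fix a b assume "a \<in> set (rev [0..<M])" "b \<in> set (rev [0..<M])" "a \<noteq> b"
  then have "P a \<noteq> P b" using sorts_bij[OF P] unfolding bij_betw_def inj_on_def by auto
  then show "set (if P a < n \<and> V (P a)
     then map (Pair (P a)) (reported (stack a) K (K (n + n + P a)) (node (P a))) else []) \<inter>
    set (if P b < n \<and> V (P b)
     then map (Pair (P b)) (reported (stack b) K (K (n + n + P b)) (node (P b))) else []) = {}"
    by auto
qed simp

end

section \<open>Grids of segments\<close>

lemma closed_segment_Pair_same_fst:
  "closed_segment (a, b) (a, d) = {a} \<times> {min b d..max b (d::real)}" for a :: real
proof -
  have "closed_segment (a, b) (a, d) = Pair a ` closed_segment b d"
    by (simp add: closed_segment_image_interval image_image algebra_simps)
  then show ?thesis by (auto simp: closed_segment_eq_real_ivl min_def max_def)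
qed

lemma closed_segment_Pair_same_snd:
  "closed_segment (b, a) (d, a) = {min b d..max b (d::real)} \<times> {a}" for a :: real
proof -
  have "closed_segment (b, a) (d, a) = (\<lambda>x. (x, a)) ` closed_segment b d"
    by (simp add: closed_segment_image_interval image_image algebra_simps)
  then show ?thesis by (auto simp: closed_segment_eq_real_ivl min_def max_def)
qed

lemma collinear_same_fst: "(\<And>p. p \<in> T \<Longrightarrow> fst p = a) \<Longrightarrow> collinear T" for T :: "point set"
  unfolding collinear_def
  by (rule exI[of _ "(0, 1)"]) (auto simp: prod_eq_iff)

lemma collinear_same_snd: "(\<And>p. p \<in> T \<Longrightarrow> snd p = a) \<Longrightarrow> collinear T" for T :: "point set"
  unfolding collinear_def
  by (rule exI[of _ "(1, 0)"]) (auto simp: prod_eq_iff)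

locale grid_input =
  fixes xs :: "(point \<times> point) list" and S :: "point set set"
  assumes grid: "grid S" and lists: "lists_segments xs S"
begin

abbreviation n :: nat where "n \<equiv> length xs"

definition seg :: "nat \<Rightarrow> point set" where
  "seg i = closed_segment (fst (xs ! i)) (snd (xs ! i))"

definition vert :: "nat \<Rightarrow> bool" where
  "vert i \<longleftrightarrow> fst (fst (xs ! i)) = fst (snd (xs ! i))"

definition xlo :: "nat \<Rightarrow> real" where "xlo i = min (fst (fst (xs ! i))) (fst (snd (xs ! i)))"
definition xhi :: "nat \<Rightarrow> real" where "xhi i = max (fst (fst (xs ! i))) (fst (snd (xs ! i)))"
definition ylo :: "nat \<Rightarrow> real" where "ylo i = min (snd (fst (xs ! i))) (snd (snd (xs ! i)))"
definition yhi :: "nat \<Rightarrow> real" where "yhi i = max (snd (fst (xs ! i))) (snd (snd (xs ! i)))"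

definition Vs :: "nat set" where "Vs = {i. i < n \<and> vert i}"
definition Hs :: "nat set" where "Hs = {i. i < n \<and> \<not> vert i}"

lemma map_seg: "map (\<lambda>(p, q). closed_segment p q) xs = map seg [0..<n]"
  by (rule nth_equalityI) (auto simp: seg_def case_prod_unfold)

lemma S_eq: "S = seg ` {..<n}"
  using lists by (simp add: lists_segments_def map_seg atLeast0LessThan)

lemma inj_seg: "inj_on seg {..<n}"
  using lists by (simp add: lists_segments_def map_seg distinct_map atLeast0LessThan)

lemma seg_eq_iff: "i < n \<Longrightarrow> j < n \<Longrightarrow> seg i = seg j \<longleftrightarrow> i = j"
  using inj_seg by (auto simp: inj_on_def)

lemma card_S: "card S = n"
  by (simp add: S_eq card_image[OF inj_seg])

lemma n_ge: "2 \<le> n"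
  using grid card_S by (simp add: grid_def)

text \<open>A segment determines its two end points up to their order, and segments of a grid have
  positive length. Hence equal abscissas of the end points already identify the vertical segments,
  and exactly one direction applies.\<close>

lemma orientation:
  assumes "i < n"
  shows "vert i \<and> vertical (seg i) \<and> \<not> horizontal (seg i) \<or>
    \<not> vert i \<and> horizontal (seg i) \<and> \<not> vertical (seg i) \<and> ylo i = yhi i"
proof -
  obtain a b c d where pq: "xs ! i = ((a, b), (c, d))" by (metis prod.exhaust_sel)
  have v: "vertical (seg i) \<longleftrightarrow> a = c \<and> b \<noteq> d"
  proof
    assume "vertical (seg i)"
    then show "a = c \<and> b \<noteq> d"
      by (auto simp: vertical_def seg_def pq closed_segment_eq doubleton_eq_iff)
  next
    assume *: "a = c \<and> b \<noteq> d"
    then have "min b d < max b d" "seg i = closed_segment (a, min b d) (a, max b d)"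
      by (auto simp: seg_def pq closed_segment_eq doubleton_eq_iff min_def max_def)
    then show "vertical (seg i)" unfolding vertical_def by blast
  qed
  have h: "horizontal (seg i) \<longleftrightarrow> b = d \<and> a \<noteq> c"
  proof
    assume "horizontal (seg i)"
    then show "b = d \<and> a \<noteq> c"
      by (auto simp: horizontal_def seg_def pq closed_segment_eq doubleton_eq_iff)
  next
    assume *: "b = d \<and> a \<noteq> c"
    then have "min a c < max a c" "seg i = closed_segment (min a c, b) (max a c, b)"
      by (auto simp: seg_def pq closed_segment_eq doubleton_eq_iff min_def max_def)
    then show "horizontal (seg i)" unfolding horizontal_def by blast
  qed
  have "horizontal (seg i) \<or> vertical (seg i)" using grid assms by (auto simp: grid_def S_eq)
  then show ?thesis using v h by (auto simp: vert_def ylo_def yhi_def pq)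
qed

lemma seg_box:
  assumes "i < n"
  shows "seg i = {xlo i..xhi i} \<times> {ylo i..yhi i}"
proof -
  obtain a b c d where pq: "xs ! i = ((a, b), (c, d))" by (metis prod.exhaust_sel)
  show ?thesis
  proof (cases "vert i")
    case True
    then show ?thesis
      by (auto simp: vert_def pq seg_def xlo_def xhi_def ylo_def yhi_def closed_segment_Pair_same_fst)
  next
    case False
    then have "b = d" using orientation[OF assms] by (auto simp: pq ylo_def yhi_def min_def max_def split: if_splits)
    then show ?thesis
      by (auto simp: pq seg_def xlo_def xhi_def ylo_def yhi_def closed_segment_Pair_same_snd)
  qed
qed

lemma vert_x: "i \<in> Vs \<Longrightarrow> xhi i = xlo i"
  by (simp add: Vs_def vert_def xlo_def xhi_def)

lemma horiz_y: "i \<in> Hs \<Longrightarrow> yhi i = ylo i"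
  using orientation[of i] by (auto simp: Hs_def)

lemma lo_le_hi: "xlo i \<le> xhi i" "ylo i \<le> yhi i"
  by (auto simp: xlo_def xhi_def ylo_def yhi_def)

text \<open>Parallel segments with a common point lie on one line, where the grid condition forbids
  contact. This makes the intersection graph bipartite.\<close>

lemma parallel_disjoint:
  assumes "i < n" "j < n" "vert i = vert j" "seg i \<inter> seg j \<noteq> {}"
  shows "i = j"
proof (rule ccontr)
  assume "i \<noteq> j"
  obtain p where p: "p \<in> seg i" "p \<in> seg j" using assms by blast
  have "collinear (seg i \<union> seg j)"
  proof (cases "vert i")
    case True
    then have "i \<in> Vs" "j \<in> Vs" using assms by (auto simp: Vs_def)
    then show ?thesis
      using p assms(1,2) vert_x by (intro collinear_same_fst[of _ "fst p"]) (auto simp: seg_box)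
  next
    case False
    then have "i \<in> Hs" "j \<in> Hs" using assms by (auto simp: Hs_def)
    then show ?thesis
      using p assms(1,2) horiz_y by (intro collinear_same_snd[of _ "snd p"]) (auto simp: seg_box)
  qed
  then show False
    using grid assms seg_eq_iff[of i j] \<open>i \<noteq> j\<close> by (auto simp: grid_def S_eq)
qed

lemma seg_nonempty: "seg i \<noteq> {}"
  by (simp add: seg_def)

text \<open>Otherwise the segment and the union of all others would be two nonempty disjoint closed
  sets covering the connected union. By \<open>parallel_disjoint\<close> the segment met has the
  other direction.\<close>

lemma not_isolated:
  assumes "i < n"
  shows "\<exists>j<n. vert j \<noteq> vert i \<and> seg i \<inter> seg j \<noteq> {}"
proof -
  let ?R = "\<Union>(seg ` ({..<n} - {i}))"
  obtain j where j: "j < n" "j \<noteq> i" using n_ge that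
    by (cases "i = 0") (auto intro: that[of 0] that[of 1])
  have "\<Union>S = seg i \<union> ?R" using assms by (auto simp: S_eq)
  then have "connected (seg i \<union> ?R)" using grid by (simp add: grid_def)
  moreover have "closed (seg i)" by (simp add: seg_def closed_segment)
  moreover have "closed ?R" by (auto simp: seg_def closed_segment intro!: closed_UN)
  moreover have "?R \<noteq> {}" using j seg_nonempty by auto
  ultimately have "seg i \<inter> ?R \<noteq> {}"
    using seg_nonempty[of i] unfolding connected_closed by blast
  then obtain k where k: "k < n" "k \<noteq> i" "seg i \<inter> seg k \<noteq> {}" by auto
  then show ?thesis using parallel_disjoint[OF assms k(1)] by metis
qed

lemma cross_iff:
  assumes "v \<in> Vs" "h \<in> Hs"
  shows "seg v \<inter> seg h \<noteq> {} \<longleftrightarrow> xlo h \<le> xlo v \<and> xlo v \<le> xhi h \<and> ylo v \<le> ylo h \<and> ylo h \<le> yhi v"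
proof -
  have "seg v = {xlo v} \<times> {ylo v..yhi v}" "seg h = {xlo h..xhi h} \<times> {ylo h}"
    using assms vert_x[OF assms(1)] horiz_y[OF assms(2)] by (auto simp: seg_box Vs_def Hs_def)
  then show ?thesis by (auto simp: Times_Int_Times)
qed

lemma crossing_point:
  assumes "v \<in> Vs" "h \<in> Hs" "seg v \<inter> seg h \<noteq> {}"
  shows "(xlo v, ylo h) \<in> seg v \<inter> seg h"
  using assms cross_iff[OF assms(1,2)] lo_le_hi vert_x[OF assms(1)] horiz_y[OF assms(2)]
  by (auto simp: seg_box Vs_def Hs_def)

definition crossings :: "(nat \<times> nat) set" where
  "crossings = {(v, h). v \<in> Vs \<and> h \<in> Hs \<and> seg v \<inter> seg h \<noteq> {}}"

text \<open>A point lies on at most one vertical and at most one horizontal segment, so crossings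
  inject into intersection points. Several pairs never share a point, and the output size is
  controlled by \<open>m\<close>.\<close>

lemma card_crossings: "card crossings \<le> card (intersection_points S)"
proof (rule card_inj_on_le)
  show "inj_on (\<lambda>(v, h). (xlo v, ylo h)) crossings"
  proof (rule inj_onI, clarify)
    fix v h v' h'
    assume a: "(v, h) \<in> crossings" "(v', h') \<in> crossings" and e: "xlo v = xlo v'" "ylo h = ylo h'"
    have p: "(xlo v, ylo h) \<in> seg v \<inter> seg h" "(xlo v, ylo h) \<in> seg v' \<inter> seg h'"
      using a e crossing_point[of v h] crossing_point[of v' h'] by (auto simp: crossings_def)
    have o: "v < n" "v' < n" "h < n" "h' < n" "vert v = vert v'" "vert h = vert h'"
      using a by (auto simp: crossings_def Vs_def Hs_def)
    show "v = v' \<and> h = h'"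
      using parallel_disjoint[OF o(1,2,5)] parallel_disjoint[OF o(3,4,6)] p by blast
  qed
  show "(\<lambda>(v, h). (xlo v, ylo h)) ` crossings \<subseteq> intersection_points S"
  proof clarify
    fix v h assume c: "(v, h) \<in> crossings"
    then have o: "v < n" "h < n" "v \<noteq> h" by (auto simp: crossings_def Vs_def Hs_def)
    then have "seg v \<noteq> seg h" using seg_eq_iff by blast
    then show "(xlo v, ylo h) \<in> intersection_points S"
      using o crossing_point[of v h] c by (auto simp: intersection_points_def S_eq crossings_def)
  qed
  \<comment> \<open>Finiteness has to be shown separately, because \<open>card\<close> of an
    infinite set is 0.\<close>
  have "intersection_points S \<subseteq> (\<lambda>(v, h). (xlo v, ylo h)) ` ({..<n} \<times> {..<n})"
  proof
    fix p assume "p \<in> intersection_points S"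
    then obtain i j where ij: "i < n" "j < n" "seg i \<noteq> seg j" "p \<in> seg i" "p \<in> seg j"
      by (auto simp: intersection_points_def S_eq)
    have ne: "vert i \<noteq> vert j" using parallel_disjoint[OF ij(1,2)] ij(3-5) by auto
    have "p = (xlo v, ylo h)" if "v \<in> Vs" "h \<in> Hs" "p \<in> seg v" "p \<in> seg h" for v h
      using that vert_x[OF that(1)] horiz_y[OF that(2)] by (auto simp: seg_box Vs_def Hs_def)
    then show "p \<in> (\<lambda>(v, h). (xlo v, ylo h)) ` ({..<n} \<times> {..<n})"
      using ij ne by (cases "vert i") (force simp: Vs_def Hs_def)+
  qed
  then show "finite (intersection_points S)" by (rule finite_subset) simp
qed

lemma card_vertical: "card (vertical_segments S) = card Vs"
proof -
  have "vertical_segments S = seg ` Vs" using orientation by (auto simp: vertical_segments_def S_eq Vs_def)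
  moreover have "Vs \<subseteq> {..<n}" by (auto simp: Vs_def)
  ultimately show ?thesis using card_image[OF inj_on_subset[OF inj_seg]] by simp
qed

lemma card_horizontal: "card (horizontal_segments S) = card Hs"
proof -
  have "horizontal_segments S = seg ` Hs" using orientation by (auto simp: horizontal_segments_def S_eq Hs_def)
  moreover have "Hs \<subseteq> {..<n}" by (auto simp: Hs_def)
  ultimately show ?thesis using card_image[OF inj_on_subset[OF inj_seg]] by simp
qed

definition crossing_nbrs :: "nat set \<Rightarrow> nat \<Rightarrow> nat set" where
  "crossing_nbrs A b = {a \<in> A. seg a \<inter> seg b \<noteq> {}}"

section \<open>Extremality as a domination condition, for either choice of the smaller
  direction\<close>

context
  fixes A B :: "nat set"
  assumes AB: "A = Vs \<and> B = Hs \<or> A = Hs \<and> B = Vs"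
begin

lemma bipartite_AB: "bipartite A B (crossing_nbrs A)"
proof
  show "finite A" "finite B" "A \<inter> B = {}" using AB by (auto simp: Vs_def Hs_def)
  show "crossing_nbrs A b \<subseteq> A" for b by (auto simp: crossing_nbrs_def)
  show "crossing_nbrs A b \<noteq> {}" if b: "b \<in> B" for b
  proof -
    have "b < n" using b AB by (auto simp: Vs_def Hs_def)
    from not_isolated[OF this] obtain a where "a < n" "vert a \<noteq> vert b" "seg b \<inter> seg a \<noteq> {}" by blast
    moreover have "a \<in> A" using calculation b AB by (auto simp: Vs_def Hs_def)
    ultimately show ?thesis by (auto simp: crossing_nbrs_def)
  qed
  show "\<exists>b\<in>B. a \<in> crossing_nbrs A b" if a: "a \<in> A" for a
  proof -
    have "a < n" using a AB by (auto simp: Vs_def Hs_def)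
    from not_isolated[OF this] obtain b where "b < n" "vert b \<noteq> vert a" "seg a \<inter> seg b \<noteq> {}" by blast
    moreover have "b \<in> B" using calculation a AB by (auto simp: Vs_def Hs_def)
    ultimately show ?thesis using a by (auto simp: crossing_nbrs_def)
  qed
qed

interpretation bipartite A B "crossing_nbrs A" by (rule bipartite_AB)

lemma union_AB: "A \<union> B = {..<n}"
  using AB by (auto simp: Vs_def Hs_def)

text \<open>A segment meets a parallel one only if both are equal, so guards other than the segment
  itself always come from the opposite side of the bipartition.\<close>

lemma patrolling_iff:
  assumes "D \<subseteq> {..<n}"
  shows "patrolling_set S (seg ` D) \<longleftrightarrow> dominating D"
proof -
  have mem: "seg i \<in> seg ` D \<longleftrightarrow> i \<in> D" if "i < n" for i
    using assms that inj_seg by (auto simp: inj_on_def)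
  have same: "i \<in> D" if "j \<in> D" "seg i \<inter> seg j \<noteq> {}" "i \<in> A \<longleftrightarrow> j \<in> A" "i < n" for i j
  proof -
    have j: "j < n" using that assms by auto
    then have "vert i = vert j" using that AB by (auto simp: Vs_def Hs_def)
    then have "i = j" by (rule parallel_disjoint[OF that(4) j _ that(2)])
    then show ?thesis using that by simp
  qed
  have disjAB: "i \<in> B \<longleftrightarrow> i \<notin> A" if "i < n" for i using that union_AB disj by auto
  have "patrolling_set S (seg ` D) \<longleftrightarrow> (\<forall>i<n. i \<in> D \<or> (\<exists>j\<in>D. seg i \<inter> seg j \<noteq> {}))"
    using assms by (auto simp: patrolling_set_def S_eq mem)
  also have "\<dots> \<longleftrightarrow> dominating D"
  proof
    assume *: "\<forall>i<n. i \<in> D \<or> (\<exists>j\<in>D. seg i \<inter> seg j \<noteq> {})"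
    have ex: "i \<in> D \<or> (\<exists>j\<in>D. seg i \<inter> seg j \<noteq> {} \<and> (j \<in> A \<longleftrightarrow> i \<notin> A))" if "i < n" for i
      using * same[of _ i] that by blast
    show "dominating D"
      unfolding dominating_def
    proof (intro conjI ballI)
      show "D \<subseteq> A \<union> B" using assms union_AB by simp
      show "a \<in> D \<or> (\<exists>b\<in>B \<inter> D. a \<in> crossing_nbrs A b)" if "a \<in> A" for a
      proof -
        have "a < n" using that union_AB by auto
        from ex[OF this] show ?thesis using that assms disjAB by (auto simp: crossing_nbrs_def)
      qed
      show "b \<in> D \<or> (\<exists>a\<in>A \<inter> D. a \<in> crossing_nbrs A b)" if "b \<in> B" for b
      proof -
        have "b < n" using that union_AB by auto
        from ex[OF this] show ?thesis
          using that disjAB[OF \<open>b < n\<close>] by (auto simp: crossing_nbrs_def Int_commute)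
      qed
    qed
  next
    assume *: "dominating D"
    show "\<forall>i<n. i \<in> D \<or> (\<exists>j\<in>D. seg i \<inter> seg j \<noteq> {})"
    proof (intro allI impI)
      fix i assume "i < n"
      then have "i \<in> A \<or> i \<in> B" using union_AB by auto
      then show "i \<in> D \<or> (\<exists>j\<in>D. seg i \<inter> seg j \<noteq> {})"
      proof
        assume "i \<in> A"
        then have "i \<in> D \<or> (\<exists>b\<in>B \<inter> D. i \<in> crossing_nbrs A b)" using * by (simp add: dominating_def)
        then show ?thesis by (auto simp: crossing_nbrs_def)
      next
        assume "i \<in> B"
        then have "i \<in> D \<or> (\<exists>a\<in>A \<inter> D. a \<in> crossing_nbrs A i)" using * by (simp add: dominating_def)
        then show ?thesis by (auto simp: crossing_nbrs_def)
      qed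
    qed
  qed
  finally show ?thesis .
qed

text \<open>Since \<open>A\<close> itself dominates, the minimum cannot exceed
  \<open>card A\<close>; extremality says that no dominating set is smaller.\<close>

lemma extremal_iff_rich:
  assumes "card A \<le> card B"
  shows "extremal S \<longleftrightarrow> rich"
proof -
  let ?F = "{card C | C. patrolling_set S C}"
  have min: "min (card (vertical_segments S)) (card (horizontal_segments S)) = card A"
    using assms AB by (auto simp: card_vertical card_horizontal)
  have cards: "card (seg ` D) = card D" if "D \<subseteq> {..<n}" for D
    using card_image[OF inj_on_subset[OF inj_seg that]] .
  have F: "?F = card ` {D. dominating D}"
  proof (intro equalityI subsetI)
    fix k assume "k \<in> ?F"
    then obtain C where C: "patrolling_set S C" "k = card C" by blast
    then have "C \<subseteq> seg ` {..<n}" by (auto simp: patrolling_set_def S_eq)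
    then obtain D where D: "D \<subseteq> {..<n}" "C = seg ` D" by (meson subset_image_iff)
    then show "k \<in> card ` {D. dominating D}" using C patrolling_iff[OF D(1)] cards[OF D(1)] by auto
  next
    fix k assume "k \<in> card ` {D. dominating D}"
    then obtain D where D: "dominating D" "k = card D" by blast
    then have "D \<subseteq> {..<n}" using union_AB by (auto simp: dominating_def)
    then show "k \<in> ?F" using D patrolling_iff cards by (metis (mono_tags, lifting) mem_Collect_eq)
  qed
  have fin: "finite ?F"
  proof -
    have "{D. dominating D} \<subseteq> Pow (A \<union> B)" by (auto simp: dominating_def)
    then have "finite {D. dominating D}" using union_AB by (auto intro: finite_subset)
    then show ?thesis unfolding F by simp
  qed
  have in_F: "card A \<in> ?F" unfolding F using dominating_A by blast
  have "extremal S \<longleftrightarrow> Min ?F = card A" unfolding extremal_def min ..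
  also have "\<dots> \<longleftrightarrow> (\<forall>k\<in>?F. card A \<le> k)"
    using fin in_F by (subst Min_eq_iff) auto
  also have "\<dots> \<longleftrightarrow> (\<forall>D. dominating D \<longrightarrow> card A \<le> card D)" unfolding F by auto
  also have "\<dots> \<longleftrightarrow> rich" unfolding rich_def by (rule card_le_dominating_iff)
  finally show ?thesis .
qed

text \<open>The two cases instantiate \<open>rich_card_le_4\<close> with the coordinates exchanged.
  The position along \<open>b\<close> is injective on its neighbours because two parallel segments
  crossing \<open>b\<close> at one place would meet each other.\<close>

lemma rich_imp_card_le_4:
  assumes rich "b \<in> B"
  shows "card (crossing_nbrs A b - support) \<le> 4"
proof (cases "A = Vs \<and> B = Hs")
  case True
  show ?thesis
  proof (rule rich_card_le_4[where c = xlo and f = xlo and g = xhi and lo = ylo and hi = yhi and e = ylo])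
    show "a \<in> crossing_nbrs A b \<longleftrightarrow> xlo b \<le> xlo a \<and> xlo a \<le> xhi b \<and> ylo a \<le> ylo b \<and> ylo b \<le> yhi a"
      if "a \<in> A" "b \<in> B" for a b
      using that True cross_iff[of a b] by (auto simp: crossing_nbrs_def)
    show "inj_on xlo (crossing_nbrs A b)" if b: "b \<in> B" for b
    proof (rule inj_onI)
      fix a a' assume a: "a \<in> crossing_nbrs A b" "a' \<in> crossing_nbrs A b" "xlo a = xlo a'"
      then have "(xlo a, ylo b) \<in> seg a \<inter> seg a'"
        using b True crossing_point[of a b] crossing_point[of a' b] by (auto simp: crossing_nbrs_def)
      then show "a = a'" using a True by (intro parallel_disjoint) (auto simp: crossing_nbrs_def Vs_def)
    qed
  qed (use assms in auto)
next
  case False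
  then have H: "A = Hs" "B = Vs" using AB by auto
  show ?thesis
  proof (rule rich_card_le_4[where c = ylo and f = ylo and g = yhi and lo = xlo and hi = xhi and e = xlo])
    show "a \<in> crossing_nbrs A b \<longleftrightarrow> ylo b \<le> ylo a \<and> ylo a \<le> yhi b \<and> xlo a \<le> xlo b \<and> xlo b \<le> xhi a"
      if "a \<in> A" "b \<in> B" for a b
      using that H cross_iff[of b a] by (auto simp: crossing_nbrs_def)
    show "inj_on ylo (crossing_nbrs A b)" if b: "b \<in> B" for b
    proof (rule inj_onI)
      fix a a' assume a: "a \<in> crossing_nbrs A b" "a' \<in> crossing_nbrs A b" "ylo a = ylo a'"
      then have "(xlo b, ylo a) \<in> seg a \<inter> seg a'"
        using b H crossing_point[of b a] crossing_point[of b a'] by (auto simp: crossing_nbrs_def)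
      then show "a = a'" using a H by (intro parallel_disjoint) (auto simp: crossing_nbrs_def Hs_def)
    qed
  qed (use assms in auto)
qed

lemma extremal_iff_graph_ok:
  assumes "card A \<le> card B" "distinct es" "set es = {(a, b). a \<in> A \<and> b \<in> B \<and> seg a \<inter> seg b \<noteq> {}}"
  shows "extremal S \<longleftrightarrow> graph_ok n es"
proof -
  interpret edge_list A B "crossing_nbrs A" n es
    by unfold_locales (use assms union_AB in \<open>auto simp: crossing_nbrs_def\<close>)
  show ?thesis
    using extremal_iff_rich[OF assms(1)] rich_imp_card_le_4 graph_ok_iff by blast
qed

end

end

section \<open>The program\<close>

definition copy_edges :: "nat \<Rightarrow> nat \<Rightarrow> com" where
  "copy_edges a b = For 11 (Var 32) (Seq (Assign 40 (Var 11) (Cell a (Var 11)))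
     (Assign 41 (Var 11) (Cell b (Var 11))))"

text \<open>\<open>Minus (Var 0) (Var 16)\<close> is the number of horizontal segments. The vertical
  segments form the first class unless there are strictly fewer horizontal ones.\<close>

definition orient :: com where
  "orient = If (Less (Minus (Var 0) (Var 16)) (Var 16)) (copy_edges 31 30) (copy_edges 30 31)"

lemma copy_edges_writes [simp]:
  "num_writes (copy_edges a b) = {11, 40, 41}" "crd_writes (copy_edges a b) = {}"
  by (auto simp: copy_edges_def)

lemma orient_writes [simp]: "num_writes orient = {11, 40, 41}" "crd_writes orient = {}"
  by (auto simp: orient_def)

lemma wp_copy_edges:
  assumes es: "num s 32 0 = length es" "\<And>k. k < length es \<Longrightarrow> num s a k = fst (es ! k) \<and> num s b k = snd (es ! k)"
    and ab: "11 < a" "a < 40" "11 < b" "b < 40"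
  shows "wp (copy_edges a b) (\<lambda>t s'. t \<le> 100 * (length es + 1) \<and> stored s' es) s"
  unfolding copy_edges_def
proof (rule wp_For[where n = "length es" and C = 60 and
    I = "\<lambda>k s'. \<forall>i<k. num s' 40 i = fst (es ! i) \<and> num s' 41 i = snd (es ! i)"], goal_cases)
  case 1
  then show ?case by simp
next
  case (2 k s')
  then show ?case using es by (simp add: frame_num[OF 2(3)])
next
  case (3 k s')
  have "num s' a = num s a" "num s' b = num s b"
    using ab by (auto simp: fun_eq_iff frame_num[OF 3(4)])
  then show ?case using 3 es ab by (auto simp: less_Suc_eq)
next
  case (4 t s')
  have "num s' 32 0 = length es" using es by (simp add: frame_num[OF 4(2)])
  then show ?case using 4 by (simp add: stored_def)
qed

lemma wp_orient:
  assumes "edges s es"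
  shows "wp orient (\<lambda>t s'. t \<le> 100 * (length es + 1) + 20 \<and>
     stored s' (if num s 0 0 - num s 16 0 < num s 16 0 then map prod.swap es else es)) s"
proof -
  have 1: "wp (copy_edges 31 30) (\<lambda>t s'. t \<le> 100 * (length (map prod.swap es) + 1) \<and> stored s' (map prod.swap es)) s"
    by (rule wp_copy_edges) (use assms in \<open>auto simp: edges_def\<close>)
  have 2: "wp (copy_edges 30 31) (\<lambda>t s'. t \<le> 100 * (length es + 1) \<and> stored s' es) s"
    by (rule wp_copy_edges) (use assms in \<open>auto simp: edges_def\<close>)
  show ?thesis
    unfolding orient_def by (auto intro: wp_mono[OF 1] wp_mono[OF 2])
qed

text \<open>The abscissas are sorted first because only their inverse table has to survive. Keys and
  sorted order are then overwritten by those of the ordinates, which the sweep reads.\<close>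

definition prepare :: com where
  "prepare = Seq (Set 10 (Plus (Plus (Var 0) (Var 0)) (Var 0))) (Seq mark_vertical
     (Seq (keys 0 2) (Seq merge_sort (Seq inverse_table (Seq (keys 1 3) (Seq merge_sort
     (Seq (Set 12 (Var 2)) half_table)))))))"

text \<open>The flag in array 46 is positive exactly on failure; truncated subtraction from 1 turns
  it into the answer.\<close>

definition extremal_test :: com where
  "extremal_test = Seq prepare (Seq sweep (Seq orient (Seq graph (Set 0 (Minus (Const 1) (Var 46))))))"

section \<open>Correctness and running time of the whole program\<close>

context grid_input
begin

abbreviation M :: nat where "M \<equiv> 3 * n"

definition untouched :: "state \<Rightarrow> bool" where
  "untouched s \<longleftrightarrow> num s 0 0 = n \<and> num s 10 0 = M \<and>
     (\<forall>a<4. crd s a = crd (initial_state xs) a) \<and> (\<forall>a i. 25 \<le> a \<longrightarrow> num s a i = 0)"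

lemma untouched_frame:
  "untouched s \<Longrightarrow> frame c s s' \<Longrightarrow> num_writes c \<subseteq> {2..9} \<union> {11..24} \<Longrightarrow> crd_writes c \<subseteq> {4} \<Longrightarrow> untouched s'"
proof -
  assume u: "untouched s" and f: "frame c s s'" and w: "num_writes c \<subseteq> {2..9} \<union> {11..24}" "crd_writes c \<subseteq> {4}"
  have "num s' a i = num s a i" if "a = 0 \<or> a = 10 \<or> 25 \<le> a" for a i
    by (rule frame_num[OF f]) (use w that in auto)
  moreover have "crd s' a i = crd s a i" if "a < 4" for a i
    by (rule frame_crd[OF f]) (use w that in auto)
  ultimately show "untouched s'" using u by (simp add: untouched_def fun_eq_iff)
qed

lemma initial_crd:
  assumes "i < n"
  shows "crd (initial_state xs) 0 i = fst (fst (xs ! i))" "crd (initial_state xs) 1 i = snd (fst (xs ! i))"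
    "crd (initial_state xs) 2 i = fst (snd (xs ! i))" "crd (initial_state xs) 3 i = snd (snd (xs ! i))"
  using assms by (auto simp: initial_state_def)

definition prepared :: "nat \<Rightarrow> state \<Rightarrow> bool" where
  "prepared L s \<longleftrightarrow> (\<exists>P K pos KX PX. sweep_sorted n M (2 ^ L) L P K pos KX PX \<and>
     sweep_data.ready n M (2 ^ L) P K vert pos s \<and>
     (\<forall>i<n. K i = ylo i \<and> K (n + n + i) = yhi i \<and> KX i = xlo i \<and> KX (n + n + i) = xhi i)) \<and>
     num s 16 0 = card Vs \<and> (\<forall>a i. 25 \<le> a \<longrightarrow> num s a i = 0)"

lemma wp_prepare:
  "wp prepare (\<lambda>t s. \<exists>l L. prepared L s \<and> 2 ^ l < 2 * M \<and> 2 ^ L < 2 * M \<and>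
     t \<le> 600 * (M + 1) * (l + 1) + 600 * (M + 1) * (L + 1) + 500 * (n + 1) + 100 * (M + 1) + 200 * (M + 1) + 20)
     (initial_state xs)"
proof -
  let ?init = "initial_state xs"
  have M0: "0 < M" using n_ge by linarith
  let ?s = "?init\<lparr>num := set_cell (num ?init) 10 0 M\<rparr>"
  have u1: "untouched ?s" by (auto simp: untouched_def initial_state_def set_cell_apply)
  have z1: "num ?s 16 0 = 0" "num ?s 24 = (\<lambda>_. 0)" by (auto simp: initial_state_def fun_eq_iff set_cell_apply)
  have "wp (Seq mark_vertical (Seq (keys 0 2) (Seq merge_sort (Seq inverse_table (Seq (keys 1 3) (Seq merge_sort
     (Seq (Set 12 (Var 2)) half_table)))))))
    (\<lambda>t s. \<exists>l L. prepared L s \<and> 2 ^ l < 2 * M \<and> 2 ^ L < 2 * M \<and>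
     t \<le> 600 * (M + 1) * (l + 1) + 600 * (M + 1) * (L + 1) + 500 * (n + 1) + 100 * (M + 1) + 200 * (M + 1) + 10) ?s"
  proof (rule wp_SeqI[OF wp_mark_vertical[of _ n]], goal_cases)
    case (4 t2 s2)
    have u2: "untouched s2" by (rule untouched_frame[OF u1 4(2)]) auto
    have V: "\<And>i. i < n \<Longrightarrow> 0 < num s2 24 i \<longleftrightarrow> vert i"
      using 4(1) initial_crd by (auto simp: vert_def)
    have "{i. i < n \<and> crd ?s 0 i = crd ?s 2 i} = Vs"
      using initial_crd by (auto simp: Vs_def vert_def)
    then have nv: "num s2 16 0 = card Vs" using 4(1) by simp
    note t2 = conjunct1[OF 4(1)]
    show ?case
    proof (rule wp_SeqI[OF wp_keys[of _ n]], goal_cases)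
      case (4 t3 s3)
      have u3: "untouched s3" by (rule untouched_frame[OF u2 4(2)]) auto
      define KX where "KX = crd s3 4"
      have KX: "KX i = xlo i" "KX (n + i) = xlo i" "KX (n + n + i) = xhi i" if "i < n" for i
        using 4(1) that u2 initial_crd[OF that] by (auto simp: KX_def untouched_def xlo_def xhi_def)
      have f3: "num s3 16 0 = card Vs" "num s3 24 = num s2 24"
        using nv by (auto simp: fun_eq_iff frame_num[OF 4(2)])
      note t3 = conjunct1[OF 4(1)]
      have M3: "num s3 10 0 = M" using u3 by (simp add: untouched_def)
      show ?case
      proof (rule wp_SeqI[OF wp_merge_sort[OF M3 M0 KX_def[symmetric]]], goal_cases)
        case (1 t4 s4)
        have u4: "untouched s4" by (rule untouched_frame[OF u3 1(2)]) auto
        define PX where "PX = num s4 20"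
        have PX: "sorts KX M PX" using 1(1) by (simp add: PX_def)
        obtain l where l: "2 ^ l < 2 * M" "t4 \<le> 600 * (M + 1) * (l + 1)" using 1(1) by blast
        have f4: "num s4 16 0 = card Vs" "num s4 24 = num s2 24"
          using f3 by (auto simp: fun_eq_iff frame_num[OF 1(2)])
        have M4: "num s4 10 0 = M" using u4 by (simp add: untouched_def)
        have inj: "inj_on (num s4 20) {..<M}" using sorts_bij[OF PX] by (simp add: bij_betw_def PX_def)
        show ?case
        proof (rule wp_SeqI[OF wp_inverse_table[OF M4 inj]], goal_cases)
          case (1 t5 s5)
          have u5: "untouched s5" by (rule untouched_frame[OF u4 1(2)]) auto
          define pos where "pos = num s5 22"
          have pos: "pos (PX a) = a" if "a < M" for a using 1(1) that by (simp add: pos_def PX_def)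
          have f5: "num s5 16 0 = card Vs" "num s5 24 = num s2 24"
            using f4 by (auto simp: fun_eq_iff frame_num[OF 1(2)])
          note t5 = conjunct1[OF 1(1)]
          show ?case
          proof (rule wp_SeqI[OF wp_keys[of _ n]], goal_cases)
            case (4 t6 s6)
            have u6: "untouched s6" by (rule untouched_frame[OF u5 4(2)]) auto
            define K where "K = crd s6 4"
            have K: "K i = ylo i" "K (n + i) = ylo i" "K (n + n + i) = yhi i" if "i < n" for i
              using 4(1) that u5 initial_crd[OF that] by (auto simp: K_def untouched_def ylo_def yhi_def)
            have f6: "num s6 16 0 = card Vs" "num s6 24 = num s2 24" "num s6 22 = pos"
              using f5 by (auto simp: fun_eq_iff frame_num[OF 4(2)] pos_def)
            note t6 = conjunct1[OF 4(1)]
            have M6: "num s6 10 0 = M" using u6 by (simp add: untouched_def)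
            show ?case
            proof (rule wp_SeqI[OF wp_merge_sort[OF M6 M0 K_def[symmetric]]], goal_cases)
              case (1 t7 s7)
              have u7: "untouched s7" by (rule untouched_frame[OF u6 1(2)]) auto
              define P where "P = num s7 20"
              have P: "sorts K M P" using 1(1) by (simp add: P_def)
              obtain L where L: "num s7 2 0 = 2 ^ L" "M \<le> 2 ^ L" "2 ^ L < 2 * M" "t7 \<le> 600 * (M + 1) * (L + 1)"
                using 1(1) by blast
              have f7: "num s7 16 0 = card Vs" "num s7 24 = num s2 24" "num s7 22 = pos" "crd s7 4 = K"
                using f6 by (auto simp: fun_eq_iff frame_num[OF 1(2)] frame_crd[OF 1(2)] K_def)
              let ?s8 = "s7\<lparr>num := set_cell (num s7) 12 0 (2 ^ L)\<rparr>"
              have u8: "untouched ?s8" using u7 by (simp add: untouched_def set_cell_apply)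
              have "sweep_data n M (2 ^ L) L P pos"
              proof
                show "pos i < M" if i: "i < M" for i
                proof -
                  obtain a where "a < M" "PX a = i" using sorts_surj[OF PX i] by blast
                  then show ?thesis using pos by auto
                qed
              qed (use L P in \<open>auto simp: sorts_def\<close>)
              then have sw: "sweep_sorted n M (2 ^ L) L P K pos KX PX"
                unfolding sweep_sorted_def sweep_sorted_axioms_def using P PX pos K KX by simp
              have "wp half_table (\<lambda>t s. prepared L s \<and> t \<le> 100 * (2 ^ L + 1)) ?s8"
              proof (rule wp_frame[OF wp_half_table[of _ "2 ^ L"]])
                show "num ?s8 12 0 = 2 ^ L" by simp
                fix t :: nat and s assume A: "t \<le> 100 * (2 ^ L + 1) \<and> (\<forall>x<2 * 2 ^ L. num s 23 x = x div 2)"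
                  and f: "frame half_table ?s8 s"
                have u9: "untouched s" by (rule untouched_frame[OF u8 f]) auto
                have "num s 12 0 = 2 ^ L" "num s 16 0 = card Vs" "num s 24 = num s2 24" "num s 22 = pos"
                  "num s 20 = P" "crd s 4 = K"
                  using f7 by (auto simp: fun_eq_iff frame_num[OF f] frame_crd[OF f] P_def)
                then have "sweep_data.ready n M (2 ^ L) P K vert pos s"
                  unfolding sweep_data.ready_def[OF \<open>sweep_data n M (2 ^ L) L P pos\<close>]
                  using A u9 V by (simp add: untouched_def)
                then have "\<exists>P K pos KX PX. sweep_sorted n M (2 ^ L) L P K pos KX PX \<and>
                  sweep_data.ready n M (2 ^ L) P K vert pos s \<and>
                  (\<forall>i<n. K i = ylo i \<and> K (n + n + i) = yhi i \<and> KX i = xlo i \<and> KX (n + n + i) = xhi i)"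
                  using sw K KX by (intro exI[of _ P] exI[of _ K] exI[of _ pos] exI[of _ KX] exI[of _ PX]) simp
                then show "prepared L s \<and> t \<le> 100 * (2 ^ L + 1)"
                  unfolding prepared_def using A u9 \<open>num s 16 0 = card Vs\<close> by (simp add: untouched_def)
              qed
              then have "wp half_table (\<lambda>t s. prepared L s \<and> t \<le> 200 * (M + 1)) ?s8"
                by (rule wp_mono) (use L(3) in auto)
              then have "wp (Seq (Set 12 (Var 2)) half_table) (\<lambda>t s. prepared L s \<and> t \<le> 200 * (M + 1) + 10) s7"
                using L(1) by (simp, elim wp_mono) simp
              then show ?case
              proof (rule wp_mono, intro exI conjI)
                fix t8 s8 assume p: "prepared L s8 \<and> t8 \<le> 200 * (M + 1) + 10"
                then show "prepared L s8" ..
                show "t2 + (t3 + (t4 + (t5 + (t6 + (t7 + t8))))) \<le> 600 * (M + 1) * (l + 1) +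
                  600 * (M + 1) * (L + 1) + 500 * (n + 1) + 100 * (M + 1) + 200 * (M + 1) + 10"
                  using t2 t3 l(2) t5 t6 L(4) conjunct2[OF p] by linarith
              qed (use l(1) L(3) in auto)
            qed
          qed (use u5 in \<open>auto simp: untouched_def\<close>)
        qed
      qed
    qed (use u2 in \<open>auto simp: untouched_def\<close>)
  qed (use u1 z1 in \<open>auto simp: untouched_def\<close>)
  then have *: "wp (Seq mark_vertical (Seq (keys 0 2) (Seq merge_sort (Seq inverse_table (Seq (keys 1 3) (Seq merge_sort
     (Seq (Set 12 (Var 2)) half_table)))))))
    (\<lambda>t s. \<exists>l L. prepared L s \<and> 2 ^ l < 2 * M \<and> 2 ^ L < 2 * M \<and>
     10 + t \<le> 600 * (M + 1) * (l + 1) + 600 * (M + 1) * (L + 1) + 500 * (n + 1) + 100 * (M + 1) + 200 * (M + 1) + 20) ?s"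
    by (rule wp_mono) (auto simp: algebra_simps)
  have "num ?init 0 0 = n" by (simp add: initial_state_def)
  moreover have "n + n + n = M" by simp
  ultimately have st: "?init\<lparr>num := set_cell (num ?init) 10 (expr_val (Const 0) ?init) (expr_val (Plus (Plus (Var 0) (Var 0)) (Var 0)) ?init)\<rparr> = ?s"
    by (simp only: expr_val.simps)
  show ?thesis
    unfolding prepare_def wp_Seq[of "Set 10 _"] wp_Assign st
    by (rule wp_mono[OF *]) simp
qed

lemma wp_extremal_test:
  "wp extremal_test (\<lambda>t s. num s 0 0 = (if extremal S then 1 else 0) \<and>
     (\<exists>l L. 2 ^ l < 2 * M \<and> 2 ^ L < 2 * M \<and>
      t \<le> 600 * (M + 1) * (l + 1) + 600 * (M + 1) * (L + 1) + 300 * (M + 1) + 7000 * (n + 1) +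
        M * (200 * L + 500) + 500 * card (intersection_points S) + 1000)) (initial_state xs)"
  unfolding extremal_test_def
proof (rule wp_SeqI[OF wp_prepare], goal_cases)
  case (1 t1 s1)
  then obtain l L where p: "prepared L s1" and lL: "2 ^ l < 2 * M" "2 ^ L < 2 * M"
    and t1: "t1 \<le> 600 * (M + 1) * (l + 1) + 600 * (M + 1) * (L + 1) + 500 * (n + 1) + 100 * (M + 1) + 200 * (M + 1) + 20"
    by blast
  from p obtain P K pos KX PX where sw: "sweep_sorted n M (2 ^ L) L P K pos KX PX"
    and ready: "sweep_data.ready n M (2 ^ L) P K vert pos s1"
    and k: "\<And>i. i < n \<Longrightarrow> K i = ylo i" "\<And>i. i < n \<Longrightarrow> K (n + n + i) = yhi i"
      "\<And>i. i < n \<Longrightarrow> KX i = xlo i" "\<And>i. i < n \<Longrightarrow> KX (n + n + i) = xhi i"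
    and nv: "num s1 16 0 = card Vs" and z: "\<And>a i. 25 \<le> a \<Longrightarrow> num s1 a i = 0"
    unfolding prepared_def by blast
  interpret sweep_sorted n M "2 ^ L" L P K vert pos KX PX by (rule sw)
  have n1: "num s1 0 0 = n" using ready by (simp add: ready_def)
  have st: "stacks s1 (\<lambda>_. [])" using z by (simp add: stacks_def)
  have ed: "edges s1 []" using z by (simp add: edges_def)
  define es where "es = found 0"
  have set_es: "set es = crossings"
  proof -
    have "(v, h) \<in> set es \<longleftrightarrow> (v, h) \<in> crossings" for v h
    proof (cases "v \<in> Vs \<and> h \<in> Hs")
      case True
      then have "v < n" "h < n" "vert v" "\<not> vert h" by (auto simp: Vs_def Hs_def)
      then show ?thesis
        unfolding es_def set_found crossings_def using True cross_iff[of v h] by (simp add: k)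
    next
      case False
      then show ?thesis by (auto simp: es_def set_found crossings_def Vs_def Hs_def)
    qed
    then show ?thesis by auto
  qed
  have dist: "distinct es" unfolding es_def by (rule distinct_found)
  have len: "length es \<le> card (intersection_points S)"
    using card_crossings distinct_card[OF dist] set_es by simp
  let ?es = "if n - card Vs < card Vs then map prod.swap es else es"
  have VH: "card Vs + card Hs = n"
  proof -
    have "card (Vs \<union> Hs) = card Vs + card Hs" by (rule card_Un_disjoint) (auto simp: Vs_def Hs_def)
    moreover have "Vs \<union> Hs = {..<n}" by (auto simp: Vs_def Hs_def)
    ultimately show ?thesis by simp
  qed
  have ok: "graph_ok n ?es \<longleftrightarrow> extremal S"
  proof (cases "n - card Vs < card Vs")
    case True
    have "extremal S \<longleftrightarrow> graph_ok n (map prod.swap es)"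
    proof (rule extremal_iff_graph_ok[of Hs Vs])
      show "card Hs \<le> card Vs" using True VH by simp
      show "distinct (map prod.swap es)" using dist by (simp add: distinct_map)
      show "set (map prod.swap es) = {(a, b). a \<in> Hs \<and> b \<in> Vs \<and> seg a \<inter> seg b \<noteq> {}}"
        using set_es by (auto simp: crossings_def Int_commute)
    qed simp
    then show ?thesis using True by simp
  next
    case False
    have "extremal S \<longleftrightarrow> graph_ok n es"
      by (rule extremal_iff_graph_ok[of Vs Hs]) (use False VH dist set_es in \<open>auto simp: crossings_def\<close>)
    then show ?thesis using False by simp
  qed
  have es_n: "fst e < n \<and> snd e < n" if "e \<in> set ?es" for e
  proof -
    have cr: "fst d < n \<and> snd d < n" if "d \<in> crossings" for d
      using that by (auto simp: crossings_def Vs_def Hs_def)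
    show ?thesis
    proof (cases "n - card Vs < card Vs")
      case True
      then have "e \<in> prod.swap ` crossings" using that set_es by simp
      then show ?thesis using cr by fastforce
    next
      case False
      then have "e \<in> crossings" using that set_es by simp
      then show ?thesis by (rule cr)
    qed
  qed
  have dist': "distinct ?es" using dist by (simp add: distinct_map)
  show ?case
  proof (rule wp_SeqI[OF wp_sweep[OF ready st ed]], goal_cases)
    case (1 t2 s2)
    have e2: "edges s2 es" and t2: "t2 \<le> 60 * length es + M * (200 * L + 500) + 20"
      subgoal using 1(1) unfolding es_def by (rule conjunct1)
      subgoal using 1(1) unfolding es_def by (rule conjunct2)
      done
    have v2: "num s2 0 0 = n" "num s2 16 0 = card Vs"
      using n1 nv by (simp_all add: frame_num[OF 1(2)])
    have z2: "num s2 a i = 0" if "42 \<le> a" for a i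
      using z[of a i] that by (simp add: frame_num[OF 1(2)])
    show ?case
    proof (rule wp_SeqI[OF wp_orient[OF e2]], goal_cases)
      case (1 t3 s3)
      have st3: "stored s3 ?es" and t3: "t3 \<le> 100 * (length es + 1) + 20"
        using 1(1) unfolding v2 by blast+
      have v3: "num s3 0 0 = n" using v2 by (simp add: frame_num[OF 1(2)])
      have z3: "num s3 a i = 0" if "42 \<le> a" for a i
        using z2[of a i] that by (simp add: frame_num[OF 1(2)])
      show ?case
      proof (rule wp_SeqI[OF wp_graph[OF st3 dist' es_n v3]], goal_cases)
        case (3 t4 s4)
        have "length ?es = length es" by simp
        with 3(1) have t4: "t4 \<le> 300 * (length es + 1) + 6300 * (n + 1)"
          and a: "num s4 46 0 = 0 \<longleftrightarrow> extremal S" using ok by auto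
        \<comment> \<open>The 6 is the cost of the final assignment of the answer.\<close>
        have "t1 + (t2 + (t3 + (t4 + 6))) \<le> 600 * (M + 1) * (l + 1) + 600 * (M + 1) * (L + 1) + 300 * (M + 1) + 7000 * (n + 1) +
        M * (200 * L + 500) + 500 * card (intersection_points S) + 1000"
          using t1 t2 t3 t4 len by (simp add: algebra_simps)
        then show ?case using a lL by auto
      qed (use z3 in auto)
    qed
  qed
qed

end

text \<open>The bound \<open>6 * n\<close> is rounded up to \<open>8 * n\<close>, whose logarithm is
  \<open>3 + log 2 n\<close>. Since \<open>n\<close> is at least 2, the logarithm is at least 1 and
  absorbs the constant 4.\<close>

lemma exponent_le_log:
  fixes n l :: nat
  assumes "2 \<le> n" "2 ^ l < 2 * (3 * n)"
  shows "real l + 1 \<le> 5 * log 2 (real n)"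
proof -
  have "log 2 (2 ^ l) \<le> log 2 (8 * real n)"
  proof (subst log_le_cancel_iff)
    have "real (2 ^ l) \<le> real (8 * n)" using assms by (subst of_nat_le_iff) simp
    then show "2 ^ l \<le> 8 * real n" by simp
  qed (use assms in auto)
  also have "\<dots> = 3 + log 2 (real n)"
  proof -
    have "log 2 8 = (3 :: real)" using log_pow_cancel[of 2 3] by simp
    then show ?thesis using assms by (simp add: log_mult)
  qed
  finally have "real l \<le> 3 + log 2 (real n)" by (simp add: log_pow_cancel)
  moreover have "1 \<le> log 2 (real n)" using assms by (subst le_log_iff) auto
  ultimately show ?thesis by simp
qed

text \<open>Every summand is at most a multiple of \<open>n * log 2 n\<close> or of
  \<open>m\<close>, again because the logarithm is at least 1. The coefficients add up to less than
  half of the generous 100000.\<close>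

lemma time_bound:
  fixes n l L t m :: nat
  assumes n: "2 \<le> n" and l: "2 ^ l < 2 * (3 * n)" and L: "2 ^ L < 2 * (3 * n)"
    and t: "t \<le> 600 * (3 * n + 1) * (l + 1) + 600 * (3 * n + 1) * (L + 1) + 300 * (3 * n + 1) + 7000 * (n + 1) +
        3 * n * (200 * L + 500) + 500 * m + 1000"
  shows "real t \<le> 100000 * (real n * log 2 (real n) + real m)"
proof -
  define g where "g = log 2 (real n)"
  have g: "1 \<le> g" using n unfolding g_def by (subst le_log_iff) auto
  have ng: "real n \<le> real n * g" "2 \<le> real n" using g n by (auto simp: mult_le_cancel_left1)
  have a: "real ((3 * n + 1) * (k + 1)) \<le> 20 * (real n * g)" if "2 ^ k < 2 * (3 * n)" for k
  proof -
    have "real (3 * n + 1) * real (k + 1) \<le> (4 * real n) * (5 * g)"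
      using exponent_le_log[OF n that] n by (intro mult_mono) (auto simp: g_def)
    then show ?thesis by (simp only: of_nat_mult)
  qed
  have b: "real (n * L) \<le> 5 * (real n * g)"
  proof -
    have "real n * real L \<le> real n * (5 * g)"
      using exponent_le_log[OF n L] by (intro mult_left_mono) (auto simp: g_def)
    then show ?thesis by simp
  qed
  define A B C where "A = real ((3 * n + 1) * (l + 1))" and "B = real ((3 * n + 1) * (L + 1))"
    and "C = real (n * L)"
  define X where "X = real n * g"
  have "real t \<le> real (600 * ((3 * n + 1) * (l + 1)) + 600 * ((3 * n + 1) * (L + 1)) + 300 * (3 * n + 1) +
      7000 * (n + 1) + 600 * (n * L) + 1500 * n + 500 * m + 1000)"
    using t by (subst of_nat_le_iff) (simp add: algebra_simps)
  also have "\<dots> = 600 * A + 600 * B + 300 * (3 * real n + 1) +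
      7000 * (real n + 1) + 600 * C + 1500 * real n + 500 * real m + 1000"
    by (simp only: A_def B_def C_def of_nat_add of_nat_mult of_nat_numeral of_nat_1)
  also have "\<dots> \<le> 100000 * (real n * g + real m)"
    using a[OF l, folded A_def X_def] a[OF L, folded B_def X_def] b[folded C_def X_def] ng[folded X_def]
      of_nat_0_le_iff[of m, where 'a = real]
    unfolding X_def[symmetric] by (simp add: algebra_simps)
  finally show ?thesis by (simp add: g_def)
qed

theorem theorem18:
  "\<exists>P::com. \<exists>K::real. \<forall>(S::point set set) (xs::(point \<times> point) list).
     grid S \<longrightarrow> lists_segments xs S \<longrightarrow>
     (\<exists>t s. exec P (initial_state xs) t s \<and>
        answer s = (if extremal S then 1 else 0) \<and>
        real t \<le> K * (real (card S) * log 2 (real (card S)) + real (card (intersection_points S))))"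
proof (rule exI[of _ extremal_test], rule exI[of _ "100000 :: real"], intro allI impI)
  fix S :: "point set set" and xs :: "(point \<times> point) list"
  assume "grid S" "lists_segments xs S"
  then interpret grid_input xs S by unfold_locales
  obtain t s l L where e: "exec extremal_test (initial_state xs) t s"
    and a: "num s 0 0 = (if extremal S then 1 else 0)"
    and t: "2 ^ l < 2 * M" "2 ^ L < 2 * M"
      "t \<le> 600 * (M + 1) * (l + 1) + 600 * (M + 1) * (L + 1) + 300 * (M + 1) + 7000 * (n + 1) +
        M * (200 * L + 500) + 500 * card (intersection_points S) + 1000"
    using wp_extremal_test unfolding wp_def by blast
  from time_bound[OF n_ge t]
  have "real t \<le> 100000 * (real (card S) * log 2 (real (card S)) + real (card (intersection_points S)))"
    by (simp add: card_S)
  with e a show "\<exists>t s. exec extremal_test (initial_state xs) t s \<and>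
        answer s = (if extremal S then 1 else 0) \<and>
        real t \<le> 100000 * (real (card S) * log 2 (real (card S)) + real (card (intersection_points S)))"
    unfolding answer_def by blast
qed

end
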